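(* In the setting of the context, the operator $H=\Omega+|g\rangle\langle h|$ maps $\mathcal{D}(G)$ to $\mathcal{D}(G)$, and for $x\in P(K)$ (with $C_2(x)\neq0$ in the equations involving $p$, $\alpha$, $\alpha'$) $$H\kappa(x)=\kappa(x)H=x\,\kappa(x),\qquad Hp(x)=p(x)H=x\,p(x),$$ $$H|\alpha(x)\rangle=x|\alpha(x)\rangle,\qquad \langle\alpha'(x)|H=x\langle\alpha'(x)| .$$ These equations are understood as equations for sesquilinear forms bracketed between functions in $\mathcal{D}(G)$, respectively as equations between functionals on $\mathcal{D}(G)$.
   Context: Setting. $G\subset\mathbb{R}^n$ is open and bounded, $P:G\to\mathbb{R}$ is $C^\infty$, bounded with all its derivatives, with $\nabla P(y)\ne0$ for all $y\in G$. $V=L^2(G)$, $\langle f_1|f_2\rangle=\int\overline{f_1}f_2\,dy$, $(\Omega f)(y)=P(y)f(y)$, $R_\Omega(z)=1/(z-\Omega)$. $\mathcal{D}(\cdot)$ denotes $C^\infty$ functions with compact support in the indicated open set. $S(x)=\{y\in G:P(y)=x\}$, $d\sigma_x$ is its Euclidean surface element, $d\tau_x(y)=d\sigma_x(y)/|\nabla P(y)|$. For $f_1,f_2\in\mathcal{D}(G)$, $x\in\mathbb{R}$: $$\langle f_1|\delta(x-\Omega)|f_2\rangle=\int_{S(x)}\overline{f_1(y)}f_2(y)\,d\tau_x(y),\qquad \langle f_1|\tfrac{\mathcal{P}}{x-\Omega}|f_2\rangle=\int d\omega\,\tfrac{\mathcal{P}}{x-\omega}\int_{S(\omega)}\overline{f_1(y)}f_2(y)\,d\tau_\omega(y)$$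 ($\mathcal{P}$ = Cauchy principal value). Ket-vectors are functionals $f\mapsto\langle f|\cdots\rangle$ on $\mathcal{D}(G)$ and bra-vectors functionals $f\mapsto\langle\cdots|f\rangle$; a product ket$\cdot$bra is the corresponding sesquilinear form on $\mathcal{D}(G)$. Let $g,h\in\mathcal{D}(G)$ be real, $H=\Omega+|g\rangle\langle h|$ (so $Hf=\Omega f+\langle h|f\rangle g$ and $H^*=\Omega+|h\rangle\langle g|$), with resolvent $R(z)=R_\Omega(z)+R_\Omega(z)|g\rangle\langle h|R_\Omega(z)/C(z)$, $C(z)=1-\langle h|R_\Omega(z)|g\rangle$. Let $K\subset G$ be compact containing the supports of $g,h$. Standing assumption: there are an open $G_1\subset\mathbb{R}$ containing $P(K)$ and an open interval $I\ni0$ such that, with $G_0=\{x+iu:x\in G_1,u\in I\}$, $C(z)$ is holomorphic and $\ne0$ in $G_0\setminus P(K)$ and $C(x\pm i0)=C_1(x)\pm i\pi C_2(x)\ne0$ for $x\in G_0\cap\mathbb{R}$, where $C_1(x)=1-\langle h|\frac{\mathcal{P}}{x-\Omega}|g\rangle$, $C_2(x)=\langle h|\delta(x-\Omega)|g\rangle$. It is also assumed that $C_2(x)=0$ implies $\delta(x-\Omega)|g\rangle=0$ and $\langle h|\delta(x-\Omega)=0$. For $x\in G_1$, $\langle f_1|\kappa(x)|f_2\rangle=\frac1{2\pi i}\big(\lim_{u\to0-}\langle f_1|R(x+iu)|f_2\rangle-\lim_{u\to0+}\langle f_1|R(x+iu)|f_2\rangle\big)$ for $f_1,f_2\in\mathcal{D}(G)$.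 For $C_2(x)\neq0$: $$p(x)=\delta(x-\Omega)-\frac{\delta(x-\Omega)|g\rangle\langle h|\delta(x-\Omega)}{\langle h|\delta(x-\Omega)|g\rangle},$$ $$|\alpha(x)\rangle=N(x)\Big(C_1(x)\delta(x-\Omega)|g\rangle+C_2(x)\tfrac{\mathcal{P}}{x-\Omega}|g\rangle\Big),\quad \langle\alpha'(x)|=N(x)\Big(C_1(x)\langle h|\delta(x-\Omega)+C_2(x)\langle h|\tfrac{\mathcal{P}}{x-\Omega}\Big),$$ with $N(x)$ a (possibly non-real) square root of $1/((C_1^2+\pi^2C_2^2)C_2)$. Meaning of the products: $\langle f_1|H\kappa(x)|f_2\rangle=\langle H^*f_1|\kappa(x)|f_2\rangle$, $\langle f_1|\kappa(x)H|f_2\rangle=\langle f_1|\kappa(x)|Hf_2\rangle$ (likewise for $p$), $\langle f|H|\alpha(x)\rangle=\langle H^*f|\alpha(x)\rangle$, $\langle\alpha'(x)|H|f\rangle=\langle\alpha'(x)|Hf\rangle$. *)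

theory Defs
  imports "HOL-Analysis.Analysis"
begin

section \<open>Smooth functions and test functions\<close>

definition partial_derivative ::
    "'n::finite \<Rightarrow> (real^'n \<Rightarrow> 'b::real_normed_vector) \<Rightarrow> real^'n \<Rightarrow> 'b"
  where "partial_derivative i f y = frechet_derivative f (at y) (axis i 1)"

definition iterated_partial ::
    "'n::finite list \<Rightarrow> (real^'n \<Rightarrow> 'b::real_normed_vector) \<Rightarrow> real^'n \<Rightarrow> 'b"
  where "iterated_partial js f = foldr partial_derivative js f"

text \<open>\<open>C\<^sup>\<infinity>\<close> on an open set: Frechet differentiability of every iterated partial derivative makes
  all of them continuous.\<close>

definition smooth_on_open :: "(real^'n::finite) set \<Rightarrow> (real^'n \<Rightarrow> 'b::real_normed_vector) \<Rightarrow> bool"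
  where "smooth_on_open U f \<longleftrightarrow> (\<forall>js. \<forall>y\<in>U. iterated_partial js f differentiable (at y))"

definition gradient :: "(real^'n::finite \<Rightarrow> real) \<Rightarrow> real^'n \<Rightarrow> real^'n"
  where "gradient P y = (\<chi> i. partial_derivative i P y)"

definition supp :: "('a::topological_space \<Rightarrow> 'b::zero) \<Rightarrow> 'a set"
  where "supp f = closure {y. f y \<noteq> 0}"

text \<open>Elements of \<open>\<D>(G)\<close> are represented by their extensions by zero to the whole space.\<close>

definition test_functions :: "(real^'n::finite) set \<Rightarrow> (real^'n \<Rightarrow> complex) set"
  where "test_functions G = {f. smooth_on_open UNIV f \<and> compact (supp f) \<and> supp f \<subseteq> G}"


section \<open>The Euclidean surface measure of a level set\<close>

definition level_set :: "(real^'n::finite) set \<Rightarrow> (real^'n \<Rightarrow> real) \<Rightarrow> real \<Rightarrow> (real^'n) set"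
  where "level_set G P x = {y\<in>G. P y = x}"

text \<open>\<open>(n - 1)\<close>-dimensional Lebesgue measure on the coordinate hyperplane \<open>{u. u $ i = 0}\<close>, as a
  measure on the whole space. If \<open>n = 1\<close>, it is the unit point mass at \<open>0\<close>.\<close>

definition hyperplane_measure :: "'n::finite \<Rightarrow> (real^'n) measure"
  where "hyperplane_measure i =
    distr (\<Pi>\<^sub>M j\<in>UNIV - {i}. lborel) borel (\<lambda>u. \<chi> j. if j = i then 0 else u j)"

text \<open>Where \<open>\<nabla>P \<noteq> 0\<close>, the level sets of \<open>P\<close> are locally graphs \<open>y\<^sub>i = \<phi>(u)\<close> over the \<open>i\<close>-th coordinate
  hyperplane as soon as \<open>\<partial>\<^sub>iP \<noteq> 0\<close>. The surface element of such a graph is \<open>sqrt (1 + |\<nabla>\<phi>|\<^sup>2) du\<close>,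
  and \<open>\<partial>\<^sub>j\<phi> = - \<partial>\<^sub>jP / \<partial>\<^sub>iP\<close> by implicit differentiation.\<close>

definition graph_area_factor :: "(real^'n::finite \<Rightarrow> real) \<Rightarrow> 'n \<Rightarrow> real^'n \<Rightarrow> real"
  where "graph_area_factor P i y =
    sqrt (1 + (\<Sum>j\<in>UNIV - {i}. (partial_derivative j P y / partial_derivative i P y)\<^sup>2))"

text \<open>A coordinate with respect to which the level set through \<open>y\<close> is a graph near \<open>y\<close>: one where
  \<open>|\<partial>\<^sub>iP(y)|\<close> is maximal. Ties are broken by a fixed enumeration of the index type.\<close>

definition graph_coordinate :: "(real^'n::finite \<Rightarrow> real) \<Rightarrow> real^'n \<Rightarrow> 'n"
  where "graph_coordinate P y =
    (ARG_MIN to_nat i. \<forall>j. \<bar>partial_derivative j P y\<bar> \<le> \<bar>partial_derivative i P y\<bar>)"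

text \<open>The level set is cut into the pieces belonging to the different graph coordinates, and the
  areas of these (local) graphs are added. The sum over \<open>t\<close> (an integral with respect to counting
  measure) runs over the sheets of the \<open>i\<close>-th piece that lie above the point \<open>u\<close> of the hyperplane.
  By the transformation formula, the result does not depend on how the level set is cut into
  graphs. If \<open>n = 1\<close>, it is counting measure on the level set.\<close>

definition surface_measure ::
    "(real^'n::finite) set \<Rightarrow> (real^'n \<Rightarrow> real) \<Rightarrow> real \<Rightarrow> (real^'n) measure"
  where "surface_measure G P x = measure_of UNIV (sets borel)
    (\<lambda>A. \<Sum>i\<in>UNIV. \<integral>\<^sup>+u. (\<integral>\<^sup>+t.
        indicator (A \<inter> level_set G P x \<inter> {y. graph_coordinate P y = i}) (u + t *\<^sub>R axis i 1)
        * ennreal (graph_area_factor P i (u + t *\<^sub>R axis i 1))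
      \<partial>count_space UNIV) \<partial>hyperplane_measure i)"

definition level_measure ::
    "(real^'n::finite) set \<Rightarrow> (real^'n \<Rightarrow> real) \<Rightarrow> real \<Rightarrow> (real^'n) measure"
  where "level_measure G P x =
    density (surface_measure G P x) (\<lambda>y. ennreal (indicator G y / norm (gradient P y)))"


section \<open>The multiplication operator and its generalized functions\<close>

definition braket ::
    "(real^'n::finite) set \<Rightarrow> (real^'n \<Rightarrow> complex) \<Rightarrow> (real^'n \<Rightarrow> complex) \<Rightarrow> complex"
  where "braket G f1 f2 = (LINT y:G|lborel. cnj (f1 y) * f2 y)"

definition Omega ::
    "(real^'n::finite \<Rightarrow> real) \<Rightarrow> (real^'n \<Rightarrow> complex) \<Rightarrow> real^'n \<Rightarrow> complex"
  where "Omega P f = (\<lambda>y. of_real (P y) * f y)"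

definition resolvent_Omega ::
    "(real^'n::finite \<Rightarrow> real) \<Rightarrow> complex \<Rightarrow> (real^'n \<Rightarrow> complex) \<Rightarrow> real^'n \<Rightarrow> complex"
  where "resolvent_Omega P z f = (\<lambda>y. f y / (z - of_real (P y)))"

text \<open>\<open>\<langle>f\<^sub>1|\<delta>(x - \<Omega>)|f\<^sub>2\<rangle>\<close>\<close>

definition delta_form ::
    "(real^'n::finite) set \<Rightarrow> (real^'n \<Rightarrow> real) \<Rightarrow> real
      \<Rightarrow> (real^'n \<Rightarrow> complex) \<Rightarrow> (real^'n \<Rightarrow> complex) \<Rightarrow> complex"
  where "delta_form G P x f1 f2 =
    (LINT y:level_set G P x|level_measure G P x. cnj (f1 y) * f2 y)"

definition principal_value :: "real \<Rightarrow> (real \<Rightarrow> complex) \<Rightarrow> complex"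
  where "principal_value x \<rho> =
    Lim (at_right 0) (\<lambda>\<epsilon>. LINT \<omega>:{\<omega>. \<epsilon> < \<bar>x - \<omega>\<bar>}|lebesgue. \<rho> \<omega> / of_real (x - \<omega>))"

text \<open>\<open>\<langle>f\<^sub>1|\<P>/(x - \<Omega>)|f\<^sub>2\<rangle>\<close>\<close>

definition pv_form ::
    "(real^'n::finite) set \<Rightarrow> (real^'n \<Rightarrow> real) \<Rightarrow> real
      \<Rightarrow> (real^'n \<Rightarrow> complex) \<Rightarrow> (real^'n \<Rightarrow> complex) \<Rightarrow> complex"
  where "pv_form G P x f1 f2 = principal_value x (\<lambda>\<omega>. delta_form G P \<omega> f1 f2)"


section \<open>The rank one perturbation\<close>

text \<open>\<open>perturbed G P g h\<close> is \<open>\<Omega> + |g\<rangle>\<langle>h|\<close>; its adjoint is \<open>perturbed G P h g\<close>.\<close>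

definition perturbed ::
    "(real^'n::finite) set \<Rightarrow> (real^'n \<Rightarrow> real) \<Rightarrow> (real^'n \<Rightarrow> complex) \<Rightarrow> (real^'n \<Rightarrow> complex)
      \<Rightarrow> (real^'n \<Rightarrow> complex) \<Rightarrow> real^'n \<Rightarrow> complex"
  where "perturbed G P g h f = (\<lambda>y. Omega P f y + braket G h f * g y)"

definition C_fun ::
    "(real^'n::finite) set \<Rightarrow> (real^'n \<Rightarrow> real) \<Rightarrow> (real^'n \<Rightarrow> complex) \<Rightarrow> (real^'n \<Rightarrow> complex)
      \<Rightarrow> complex \<Rightarrow> complex"
  where "C_fun G P g h z = 1 - braket G h (resolvent_Omega P z g)"

definition C1 ::
    "(real^'n::finite) set \<Rightarrow> (real^'n \<Rightarrow> real) \<Rightarrow> (real^'n \<Rightarrow> complex) \<Rightarrow> (real^'n \<Rightarrow> complex)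
      \<Rightarrow> real \<Rightarrow> complex"
  where "C1 G P g h x = 1 - pv_form G P x h g"

definition C2 ::
    "(real^'n::finite) set \<Rightarrow> (real^'n \<Rightarrow> real) \<Rightarrow> (real^'n \<Rightarrow> complex) \<Rightarrow> (real^'n \<Rightarrow> complex)
      \<Rightarrow> real \<Rightarrow> complex"
  where "C2 G P g h x = delta_form G P x h g"

definition resolvent ::
    "(real^'n::finite) set \<Rightarrow> (real^'n \<Rightarrow> real) \<Rightarrow> (real^'n \<Rightarrow> complex) \<Rightarrow> (real^'n \<Rightarrow> complex)
      \<Rightarrow> complex \<Rightarrow> (real^'n \<Rightarrow> complex) \<Rightarrow> real^'n \<Rightarrow> complex"
  where "resolvent G P g h z f = (\<lambda>y. resolvent_Omega P z f y
    + braket G h (resolvent_Omega P z f) / C_fun G P g h z * resolvent_Omega P z g y)"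

definition kappa ::
    "(real^'n::finite) set \<Rightarrow> (real^'n \<Rightarrow> real) \<Rightarrow> (real^'n \<Rightarrow> complex) \<Rightarrow> (real^'n \<Rightarrow> complex)
      \<Rightarrow> real \<Rightarrow> (real^'n \<Rightarrow> complex) \<Rightarrow> (real^'n \<Rightarrow> complex) \<Rightarrow> complex"
  where "kappa G P g h x f1 f2 = 1 / (2 * of_real pi * \<i>) *
    (Lim (at_left 0) (\<lambda>u. braket G f1 (resolvent G P g h (Complex x u) f2))
     - Lim (at_right 0) (\<lambda>u. braket G f1 (resolvent G P g h (Complex x u) f2)))"

definition p_form ::
    "(real^'n::finite) set \<Rightarrow> (real^'n \<Rightarrow> real) \<Rightarrow> (real^'n \<Rightarrow> complex) \<Rightarrow> (real^'n \<Rightarrow> complex)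
      \<Rightarrow> real \<Rightarrow> (real^'n \<Rightarrow> complex) \<Rightarrow> (real^'n \<Rightarrow> complex) \<Rightarrow> complex"
  where "p_form G P g h x f1 f2 = delta_form G P x f1 f2
    - delta_form G P x f1 g * delta_form G P x h f2 / delta_form G P x h g"

text \<open>\<open>alpha_ket \<dots> f = \<langle>f|\<alpha>(x)\<rangle>\<close> and \<open>alpha_bra \<dots> f = \<langle>\<alpha>'(x)|f\<rangle>\<close>; the complex number \<open>c\<close> stands for
  the normalization \<open>N(x)\<close>.\<close>

definition alpha_ket ::
    "(real^'n::finite) set \<Rightarrow> (real^'n \<Rightarrow> real) \<Rightarrow> (real^'n \<Rightarrow> complex) \<Rightarrow> (real^'n \<Rightarrow> complex)
      \<Rightarrow> complex \<Rightarrow> real \<Rightarrow> (real^'n \<Rightarrow> complex) \<Rightarrow> complex"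
  where "alpha_ket G P g h c x f =
    c * (C1 G P g h x * delta_form G P x f g + C2 G P g h x * pv_form G P x f g)"

definition alpha_bra ::
    "(real^'n::finite) set \<Rightarrow> (real^'n \<Rightarrow> real) \<Rightarrow> (real^'n \<Rightarrow> complex) \<Rightarrow> (real^'n \<Rightarrow> complex)
      \<Rightarrow> complex \<Rightarrow> real \<Rightarrow> (real^'n \<Rightarrow> complex) \<Rightarrow> complex"
  where "alpha_bra G P g h c x f =
    c * (C1 G P g h x * delta_form G P x h f + C2 G P g h x * pv_form G P x h f)"

end

theory Submission
  imports Defs
begin

text \<open>
  All eigenvalue equations come from the identity \<open>(P - x) F / (x - P) = - F\<close>. For \<open>\<kappa>\<close> it
  gives \<open>\<langle>f\<^sub>1|R(z) H|f\<^sub>2\<rangle> = z \<langle>f\<^sub>1|R(z)|f\<^sub>2\<rangle> - \<langle>f\<^sub>1|f\<^sub>2\<rangle>\<close>, and the last term cancels in the jump across the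
  real axis. For \<open>|\<alpha>\<rangle>\<close> and \<open>\<langle>\<alpha>'|\<close> it turns into
  \<open>\<langle>f\<^sub>1|(\<Omega> - x) (\<P> / (x - \<Omega>))|f\<^sub>2\<rangle> = - \<langle>f\<^sub>1|f\<^sub>2\<rangle>\<close>, which is the coarea formula
  \<open>\<integral> d\<omega> \<integral> F d\<tau>\<^sub>\<omega> = \<integral> F dy\<close>.

  Since the limits are defined by \<^const>\<open>Lim\<close>, whose value is arbitrary for a divergent
  function, their existence has to be shown. Let \<open>\<Psi>' = k\<close> and \<open>X = \<nabla>P / |\<nabla>P|\<^sup>2\<close>; then
  \<open>k(P) = X \<cdot> \<nabla>(\<Psi>(P))\<close>, and integration by parts gives \<open>\<integral> F k(P) = - \<integral> div (F X) \<Psi>(P)\<close>.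
  For \<open>k(\<omega>) = 1 / (x + iu - \<omega>)\<close> and for the truncated kernels \<open>1 / (x - \<omega>)\<close> the primitives \<open>\<Psi>\<close> are
  dominated by \<open>|ln |x - \<omega>||\<close>, and \<open>ln |x - P|\<close> is locally integrable because the level measures of
  a compact set are bounded. So dominated convergence applies.
\<close>

section \<open>Smooth functions\<close>

text \<open>Two obstacles shape the proof. The surface measure is given concretely, as a sum over
  the sheets of local graphs, so that its countable additivity and the coarea formula have to be
  extracted from this description. Everything is reduced to coordinate lines: the map that replaces
  the i-th coordinate of y by P y has the Jacobian \<open>\<partial>\<^sub>iP\<close>, and the
  surface element divided by the norm of the gradient is exactly
  \<open>du / |\<partial>\<^sub>iP|\<close>. Hence the coarea formula is a substitution on lines
  followed by Tonelli's theorem. The second obstacle is the regularity of the density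
  \<open>\<omega> \<mapsto> \<integral> F d\<tau>\<^sub>\<omega>\<close>, the usual source of
  boundary values and principal values. Its smoothness is never established: the integration by
  parts takes place in space, under the volume integral, and about the density only boundedness is
  used. In the final algebra the rank one terms cancel because
  \<open>\<langle>h|R\<^sub>\<Omega>(z)|g\<rangle> = 1 - C(z)\<close>, and because the principal
  value form of h and g is \<open>1 - C1\<close>.\<close>

primrec times_differentiable_on ::
    "nat \<Rightarrow> (real^'n::finite) set \<Rightarrow> (real^'n \<Rightarrow> 'b::real_normed_vector) \<Rightarrow> bool" where
  "times_differentiable_on 0 U f \<longleftrightarrow> f differentiable_on U"
| "times_differentiable_on (Suc n) U f \<longleftrightarrow>
     f differentiable_on U \<and> (\<forall>i. times_differentiable_on n U (partial_derivative i f))"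

text \<open>\<open>foldr\<close> lets the last entry of the list act first, so the innermost
  derivative sits at the right end; this is the derivative that the recursion of
  \<open>times_differentiable_on\<close> splits off.\<close>

lemma iterated_partial_snoc:
  "iterated_partial (js @ [i]) f = iterated_partial js (partial_derivative i f)"
  by (simp add: iterated_partial_def)

lemma differentiable_on_open_iff:
  "open U \<Longrightarrow> f differentiable_on U \<longleftrightarrow> (\<forall>y\<in>U. f differentiable (at y))"
  by (simp add: differentiable_on_def at_within_open_NO_MATCH)

lemma times_differentiable_iff:
  assumes "open U"
  shows "times_differentiable_on n U f \<longleftrightarrow>
    (\<forall>js. length js \<le> n \<longrightarrow> (\<forall>y\<in>U. iterated_partial js f differentiable (at y)))"
proof (induction n arbitrary: f)
  case 0
  then show ?case
    using assms by (simp add: differentiable_on_open_iff iterated_partial_def)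
next
  case (Suc n)
  show ?case
  proof
    assume L: "times_differentiable_on (Suc n) U f"
    show "\<forall>js. length js \<le> Suc n \<longrightarrow> (\<forall>y\<in>U. iterated_partial js f differentiable (at y))"
    proof (intro allI impI)
      fix js :: "'a list" assume len: "length js \<le> Suc n"
      show "\<forall>y\<in>U. iterated_partial js f differentiable (at y)"
      proof (cases js rule: rev_cases)
        case Nil
        then show ?thesis
          using L assms by (simp add: differentiable_on_open_iff iterated_partial_def)
      next
        case (snoc ks i)
        then show ?thesis
          using L len by (auto simp: iterated_partial_snoc Suc.IH)
      qed
    qed
  next
    assume R: "\<forall>js. length js \<le> Suc n \<longrightarrow> (\<forall>y\<in>U. iterated_partial js f differentiable (at y))"
    have "\<forall>y\<in>U. f differentiable (at y)"
      using R[rule_format, of "[]"] by (simp add: iterated_partial_def)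
    moreover have "times_differentiable_on n U (partial_derivative i f)" for i
      unfolding Suc.IH using R by (auto simp: iterated_partial_snoc[symmetric])
    ultimately show "times_differentiable_on (Suc n) U f"
      using assms by (simp add: differentiable_on_open_iff)
  qed
qed

text \<open>Smoothness is graded by a finite order because the derivative of a product or of an
  inverse contains the undifferentiated functions again; an induction closes only if these reappear
  at a lower order.\<close>

lemma smooth_on_open_iff:
  assumes "open U"
  shows "smooth_on_open U f \<longleftrightarrow> (\<forall>n. times_differentiable_on n U f)"
  unfolding smooth_on_open_def times_differentiable_iff[OF assms] by auto

lemma smooth_on_open_partial_derivative:
  "open U \<Longrightarrow> smooth_on_open U f \<Longrightarrow> smooth_on_open U (partial_derivative i f)"
  unfolding smooth_on_open_def by (auto simp: iterated_partial_snoc[symmetric])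

lemma times_differentiable_SucD:
  "times_differentiable_on (Suc n) U f \<Longrightarrow> times_differentiable_on n U f"
proof (induction n arbitrary: f)
  case (Suc n)
  then have "times_differentiable_on n U (partial_derivative i f)" for i
    by (metis times_differentiable_on.simps(2))
  with Suc.prems show ?case by (simp only: times_differentiable_on.simps(2)) blast
qed simp

lemma has_derivative_frechet:
  "f differentiable (at y) \<Longrightarrow> (f has_derivative frechet_derivative f (at y)) (at y)"
  by (simp add: frechet_derivative_works)

lemma partial_derivative_eq:
  "(f has_derivative f') (at y) \<Longrightarrow> partial_derivative i f y = f' (axis i 1)"
  by (simp add: partial_derivative_def frechet_derivative_at[symmetric])

lemma has_derivative_cong_open:
  assumes "open U" "y \<in> U" "\<And>z. z \<in> U \<Longrightarrow> f z = g z"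
  shows "(f has_derivative D) (at y) \<longleftrightarrow> (g has_derivative D) (at y)"
  using assms by (metis has_derivative_transform_within_open)

lemma differentiable_on_cong_open:
  assumes "open U" "\<And>z. z \<in> U \<Longrightarrow> f z = g z" "f differentiable_on U"
  shows "g differentiable_on U"
  using assms has_derivative_cong_open[OF assms(1) _ assms(2)]
  by (auto simp: differentiable_on_open_iff differentiable_def)

text \<open>The sum, product and quotient rules determine \<open>partial_derivative\<close> on U
  only; elsewhere \<open>frechet_derivative\<close> may be an arbitrary choice. The formulas must
  therefore be exchangeable when they agree merely on U, which suffices because derivatives are
  local.\<close>

lemma times_differentiable_cong:
  assumes "open U" "\<And>z. z \<in> U \<Longrightarrow> f z = g z" "times_differentiable_on n U f"
  shows "times_differentiable_on n U g"
  using assms(2,3)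
proof (induction n arbitrary: f g)
  case 0
  then show ?case
    using differentiable_on_cong_open[OF assms(1), of f g] by simp
next
  case (Suc n)
  have eq: "partial_derivative i f y = partial_derivative i g y" if "y \<in> U" for y i
    using has_derivative_cong_open[OF assms(1) that Suc.prems(1)]
    by (simp add: partial_derivative_def frechet_derivative_def)
  have "times_differentiable_on n U (partial_derivative i g)" for i
    by (rule Suc.IH[OF eq]) (use Suc.prems(2) in auto)
  moreover have "g differentiable_on U"
    by (rule differentiable_on_cong_open[OF assms(1) Suc.prems(1)]) (use Suc.prems(2) in auto)
  ultimately show ?case by simp
qed

lemma times_differentiable_Un:
  assumes "open U" "open V"
  shows "times_differentiable_on n U f \<Longrightarrow> times_differentiable_on n V f
    \<Longrightarrow> times_differentiable_on n (U \<union> V) f"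
  using assms by (induction n arbitrary: f) (auto simp: differentiable_on_open_iff open_Un)

section \<open>Closure of smoothness under algebraic operations\<close>

lemma times_differentiable_add:
  assumes "open U"
  shows "times_differentiable_on n U f \<Longrightarrow> times_differentiable_on n U g
    \<Longrightarrow> times_differentiable_on n U (\<lambda>y. f y + g y)"
proof (induction n arbitrary: f g)
  case 0
  then show ?case by (simp add: differentiable_on_add)
next
  case (Suc n)
  have eq: "partial_derivative i f y + partial_derivative i g y
      = partial_derivative i (\<lambda>y. f y + g y) y" if "y \<in> U" for i y
  proof -
    have "f differentiable (at y)" "g differentiable (at y)"
      using Suc.prems that assms by (auto simp: differentiable_on_open_iff)
    from this[THEN has_derivative_frechet] show ?thesis
      by (subst partial_derivative_eq[OF has_derivative_add]) (auto simp: partial_derivative_def)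
  qed
  have "times_differentiable_on n U (\<lambda>y. partial_derivative i f y + partial_derivative i g y)" for i
    using Suc by auto
  from times_differentiable_cong[OF assms eq this] Suc.prems show ?case
    by (auto intro: differentiable_on_add)
qed

lemma differentiable_on_bounded_bilinear:
  assumes "bounded_bilinear bil" "f differentiable_on U" "g differentiable_on U"
  shows "(\<lambda>y. bil (f y) (g y)) differentiable_on U"
  unfolding differentiable_on_def
proof
  fix y assume y: "y \<in> U"
  with assms obtain f' g' where "(f has_derivative f') (at y within U)" "(g has_derivative g') (at y within U)"
    unfolding differentiable_on_def differentiable_def by blast
  from bounded_bilinear.FDERIV[OF assms(1) this]
  show "(\<lambda>y. bil (f y) (g y)) differentiable at y within U"
    unfolding differentiable_def by blast
qed

lemma times_differentiable_bilinear:
  assumes "open U" "bounded_bilinear bil"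
  shows "times_differentiable_on n U f \<Longrightarrow> times_differentiable_on n U g
    \<Longrightarrow> times_differentiable_on n U (\<lambda>y. bil (f y) (g y))"
proof (induction n arbitrary: f g)
  case 0
  then show ?case using assms(2) by (simp add: differentiable_on_bounded_bilinear)
next
  case (Suc n)
  have eq: "bil (f y) (partial_derivative i g y) + bil (partial_derivative i f y) (g y)
      = partial_derivative i (\<lambda>y. bil (f y) (g y)) y" if "y \<in> U" for i y
  proof -
    have "f differentiable (at y)" "g differentiable (at y)"
      using Suc.prems that assms by (auto simp: differentiable_on_open_iff)
    from this[THEN has_derivative_frechet] show ?thesis
      by (subst partial_derivative_eq[OF bounded_bilinear.FDERIV[OF assms(2)]])
        (auto simp: partial_derivative_def)
  qed
  \<comment> \<open>Each term of the product rule keeps one factor undifferentiated; its order is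
    lowered to that of the differentiated factor, so that the induction hypothesis applies to the
    pair.\<close>
  have "times_differentiable_on n U f" "times_differentiable_on n U g"
    using Suc.prems times_differentiable_SucD by blast+
  then have "times_differentiable_on n U
      (\<lambda>y. bil (f y) (partial_derivative i g y) + bil (partial_derivative i f y) (g y))" for i
    using Suc assms by (auto intro!: times_differentiable_add)
  from times_differentiable_cong[OF assms(1) eq this] Suc.prems assms(2) show ?case
    by (auto intro: differentiable_on_bounded_bilinear)
qed

lemma times_differentiable_const:
  assumes "open U" shows "times_differentiable_on n U (\<lambda>y. c)"
proof (induction n arbitrary: c)
  case (Suc n)
  have "partial_derivative i (\<lambda>y. c) = (\<lambda>y. 0)" for i :: 'a
    by (rule ext, subst partial_derivative_eq) (auto intro: has_derivative_const)
  with Suc show ?case by (auto simp: differentiable_on_const)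
qed (auto simp: differentiable_on_const)

lemma differentiable_on_bounded_linear:
  assumes "bounded_linear L" "f differentiable_on U"
  shows "(\<lambda>y. L (f y)) differentiable_on U"
  unfolding differentiable_on_def
proof
  fix y assume "y \<in> U"
  with assms obtain f' where "(f has_derivative f') (at y within U)"
    unfolding differentiable_on_def differentiable_def by blast
  from bounded_linear.has_derivative[OF assms(1) this]
  show "(\<lambda>y. L (f y)) differentiable at y within U"
    unfolding differentiable_def by blast
qed

lemma times_differentiable_linear:
  assumes "open U" "bounded_linear L" "times_differentiable_on n U f"
  shows "times_differentiable_on n U (\<lambda>y. L (f y))"
  using assms(3)
proof (induction n arbitrary: f)
  case 0
  then show ?case using assms(2) by (simp add: differentiable_on_bounded_linear)
next
  case (Suc n)
  have der: "((\<lambda>y. L (f y)) has_derivative (\<lambda>v. L (frechet_derivative f (at y) v))) (at y)"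
    if "y \<in> U" for y
    using Suc.prems that assms(1)
    by (intro bounded_linear.has_derivative[OF assms(2)] has_derivative_frechet)
      (simp add: differentiable_on_open_iff)
  have eq: "L (partial_derivative i f y) = partial_derivative i (\<lambda>y. L (f y)) y" if "y \<in> U" for i y
    using partial_derivative_eq[OF der[OF that]] by (simp add: partial_derivative_def)
  have "times_differentiable_on n U (\<lambda>y. L (partial_derivative i f y))" for i
    by (rule Suc.IH) (use Suc.prems in simp)
  from times_differentiable_cong[OF assms(1) eq this] show ?case
    using differentiable_on_bounded_linear[OF assms(2), of f U] Suc.prems by simp
qed

text \<open>The derivative of \<open>inverse q\<close> is a product of the derivative of q with two
  copies of \<open>inverse q\<close> itself, which are needed only one order lower and come from the
  induction hypothesis.\<close>

lemma times_differentiable_inverse: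
  fixes q :: "real^'n::finite \<Rightarrow> real"
  assumes "open U" "\<And>y. y \<in> U \<Longrightarrow> q y \<noteq> 0"
  shows "times_differentiable_on n U q \<Longrightarrow> times_differentiable_on n U (\<lambda>y. inverse (q y))"
proof (induction n)
  case 0
  then show ?case using assms by (auto simp: differentiable_on_inverse)
next
  case (Suc n)
  have der: "((\<lambda>y. inverse (q y)) has_derivative
      (\<lambda>v. - (inverse (q y) * frechet_derivative q (at y) v * inverse (q y)))) (at y)"
    if "y \<in> U" for y
    using Suc.prems that assms
    by (intro Deriv.has_derivative_inverse has_derivative_frechet)
      (simp_all add: differentiable_on_open_iff)
  have eq: "- 1 * (inverse (q y) * partial_derivative i q y * inverse (q y))
      = partial_derivative i (\<lambda>y. inverse (q y)) y" if "y \<in> U" for i y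
    using partial_derivative_eq[OF der[OF that]] by (simp add: partial_derivative_def)
  have "times_differentiable_on n U (\<lambda>y. inverse (q y))"
    using Suc times_differentiable_SucD by blast
  then have "times_differentiable_on n U
      (\<lambda>y. - 1 * (inverse (q y) * partial_derivative i q y * inverse (q y)))" for i
    using Suc.prems assms(1)
    by (intro times_differentiable_bilinear[OF _ bounded_bilinear_mult] times_differentiable_const) auto
  from times_differentiable_cong[OF assms(1) eq this] show ?case
    using Suc.prems assms(2) by (simp add: differentiable_on_inverse)
qed

lemma smooth_on_open_add:
  "open U \<Longrightarrow> smooth_on_open U f \<Longrightarrow> smooth_on_open U g \<Longrightarrow> smooth_on_open U (\<lambda>y. f y + g y)"
  by (simp add: smooth_on_open_iff times_differentiable_add)

lemma smooth_on_open_mult: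
  fixes f g :: "real^'n::finite \<Rightarrow> 'b::real_normed_algebra"
  shows "open U \<Longrightarrow> smooth_on_open U f \<Longrightarrow> smooth_on_open U g \<Longrightarrow> smooth_on_open U (\<lambda>y. f y * g y)"
  by (simp add: smooth_on_open_iff times_differentiable_bilinear[OF _ bounded_bilinear_mult])

lemma smooth_on_open_linear:
  "open U \<Longrightarrow> bounded_linear L \<Longrightarrow> smooth_on_open U f \<Longrightarrow> smooth_on_open U (\<lambda>y. L (f y))"
  by (simp add: smooth_on_open_iff times_differentiable_linear)

lemma smooth_on_open_const: "open U \<Longrightarrow> smooth_on_open U (\<lambda>y. c)"
  by (simp add: smooth_on_open_iff times_differentiable_const)

lemma smooth_on_open_inverse:
  fixes q :: "real^'n::finite \<Rightarrow> real"
  shows "open U \<Longrightarrow> (\<And>y. y \<in> U \<Longrightarrow> q y \<noteq> 0) \<Longrightarrow> smooth_on_open U q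
    \<Longrightarrow> smooth_on_open U (\<lambda>y. inverse (q y))"
  by (simp add: smooth_on_open_iff times_differentiable_inverse)

lemma smooth_on_open_sum:
  "finite A \<Longrightarrow> open U \<Longrightarrow> (\<And>i. i \<in> A \<Longrightarrow> smooth_on_open U (f i))
    \<Longrightarrow> smooth_on_open U (\<lambda>y. \<Sum>i\<in>A. f i y)"
  by (induction rule: finite_induct) (auto intro: smooth_on_open_const smooth_on_open_add)

lemma smooth_on_open_cong:
  "open U \<Longrightarrow> (\<And>z. z \<in> U \<Longrightarrow> f z = g z) \<Longrightarrow> smooth_on_open U f \<Longrightarrow> smooth_on_open U g"
  unfolding smooth_on_open_iff using times_differentiable_cong by blast

lemma smooth_on_open_Un:
  "open U \<Longrightarrow> open V \<Longrightarrow> smooth_on_open U f \<Longrightarrow> smooth_on_open V f \<Longrightarrow> smooth_on_open (U \<union> V) f"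
  by (simp add: smooth_on_open_iff times_differentiable_Un open_Un)

lemma smooth_on_open_differentiable:
  "smooth_on_open U f \<Longrightarrow> y \<in> U \<Longrightarrow> f differentiable (at y)"
  unfolding smooth_on_open_def iterated_partial_def by (auto dest: spec[of _ "[]"])

lemma smooth_on_open_continuous_on: "smooth_on_open U f \<Longrightarrow> continuous_on U f"
  by (meson continuous_at_imp_continuous_on differentiable_imp_continuous_within
      smooth_on_open_differentiable)

section \<open>Supports and test functions\<close>

lemma notin_supp: "y \<notin> supp f \<Longrightarrow> f y = 0"
  unfolding supp_def using closure_subset[of "{y. f y \<noteq> 0}"] by blast

lemma supp_subset_iff: "closed C \<Longrightarrow> supp f \<subseteq> C \<longleftrightarrow> (\<forall>y. y \<notin> C \<longrightarrow> f y = 0)"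
  unfolding supp_def using closure_subset[of "{y. f y \<noteq> 0}"] closure_minimal[of "{y. f y \<noteq> 0}" C] by blast

lemma closed_supp [simp]: "closed (supp f)"
  by (simp add: supp_def)

lemma test_functions_smooth: "f \<in> test_functions G \<Longrightarrow> smooth_on_open U f"
  unfolding test_functions_def smooth_on_open_def by auto

lemma test_functions_support:
  assumes "f \<in> test_functions G"
  shows "compact (supp f)" "supp f \<subseteq> G"
  using assms by (simp_all add: test_functions_def)

text \<open>The open sets G and \<open>- C\<close> cover the whole space; f is smooth on the first
  by assumption and identically 0 on the second. Smoothness of an extension by zero thus never has
  to be examined at the boundary of G.\<close>

lemma test_functionsI:
  assumes "open G" "smooth_on_open G f" "compact C" "C \<subseteq> G" "\<And>y. y \<notin> C \<Longrightarrow> f y = 0"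
  shows "f \<in> test_functions G"
proof -
  have sub: "supp f \<subseteq> C"
    using assms by (simp add: supp_subset_iff compact_imp_closed)
  have "open (- C)"
    using assms(3) by (simp add: compact_imp_closed open_Compl)
  have "smooth_on_open (G \<union> - C) f"
  proof (rule smooth_on_open_Un[OF assms(1) \<open>open (- C)\<close> assms(2)])
    show "smooth_on_open (- C) f"
      by (rule smooth_on_open_cong[OF \<open>open (- C)\<close> _ smooth_on_open_const[OF \<open>open (- C)\<close>, of 0]])
        (simp add: assms(5))
  qed
  moreover have "G \<union> - C = UNIV"
    using assms by auto
  moreover have "compact (supp f)"
    using sub assms(3) closed_supp compact_Int_closed[of C "supp f"] by (simp add: inf.absorb2)
  ultimately show ?thesis
    using sub assms by (auto simp: test_functions_def)
qed

lemma test_functions_add: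
  assumes "open G" "f1 \<in> test_functions G" "f2 \<in> test_functions G"
  shows "(\<lambda>y. f1 y + f2 y) \<in> test_functions G"
proof (rule test_functionsI[OF assms(1), of _ "supp f1 \<union> supp f2"])
  show "smooth_on_open G (\<lambda>y. f1 y + f2 y)"
    using assms by (intro smooth_on_open_add test_functions_smooth)
qed (use assms in \<open>auto simp: notin_supp intro!: compact_Un dest: test_functions_support\<close>)

lemma test_functions_mult:
  assumes "open G" "f \<in> test_functions G" "smooth_on_open G q"
  shows "(\<lambda>y. q y * f y) \<in> test_functions G"
proof (rule test_functionsI[OF assms(1), of _ "supp f"])
  show "smooth_on_open G (\<lambda>y. q y * f y)"
    by (rule smooth_on_open_mult[OF assms(1,3) test_functions_smooth[OF assms(2)]])
qed (use assms(2) in \<open>auto simp: notin_supp dest: test_functions_support\<close>)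

lemma test_functions_cnj_mult:
  assumes "open G" "f1 \<in> test_functions G" "f2 \<in> test_functions G"
  shows "(\<lambda>y. cnj (f1 y) * f2 y) \<in> test_functions G"
  using test_functions_mult[OF assms(1,3) smooth_on_open_linear[OF assms(1) bounded_linear_cnj
      test_functions_smooth[OF assms(2)]]] .

lemma smooth_on_open_of_real:
  "open U \<Longrightarrow> smooth_on_open U f \<Longrightarrow> smooth_on_open U (\<lambda>y. of_real (f y) :: complex)"
  using smooth_on_open_linear[OF _ bounded_linear_of_real] .

lemma test_functions_Omega:
  assumes "open G" "smooth_on_open G P" "f \<in> test_functions G"
  shows "Omega P f \<in> test_functions G"
  unfolding Omega_def
  by (rule test_functions_mult[OF assms(1,3) smooth_on_open_of_real[OF assms(1,2)]])

lemma test_functions_cmult: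
  assumes "open G" "f \<in> test_functions G"
  shows "(\<lambda>y. c * f y) \<in> test_functions G"
  by (rule test_functions_mult[OF assms smooth_on_open_const[OF assms(1)]])

lemma perturbed_in_test_functions:
  assumes "open G" "smooth_on_open G P" "f \<in> test_functions G" "g \<in> test_functions G"
  shows "perturbed G P g h f \<in> test_functions G"
  unfolding perturbed_def
  by (rule test_functions_add[OF assms(1) test_functions_Omega[OF assms(1-3)]
      test_functions_cmult[OF assms(1,4)]])

lemma partial_derivative_eq_0:
  assumes "y \<notin> supp f"
  shows "partial_derivative i f y = 0"
proof -
  have "(f has_derivative (\<lambda>_. 0)) (at y)"
    using assms notin_supp[of _ f]
      has_derivative_cong_open[of "- supp f" y f "\<lambda>_. 0" "\<lambda>_. 0"]
    by (simp add: open_Compl)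
  from partial_derivative_eq[OF this] show ?thesis .
qed

lemma partial_derivative_test_functions:
  assumes "open G" "f \<in> test_functions G"
  shows "partial_derivative i f \<in> test_functions G"
proof (rule test_functionsI[OF assms(1), of _ "supp f"])
  show "smooth_on_open G (partial_derivative i f)"
    using assms by (intro smooth_on_open_partial_derivative test_functions_smooth)
  show "partial_derivative i f y = 0" if "y \<notin> supp f" for y
    by (rule partial_derivative_eq_0[OF that])
qed (use test_functions_support[OF assms(2)] in auto)

section \<open>Splitting Lebesgue measure along a coordinate\<close>

text \<open>The entry \<open>w i\<close> is overwritten. Therefore w may be a point of the product
  space over the other indices as well as the coordinate function \<open>($) y\<close> of a whole
  vector.\<close>

definition glue :: "'n::finite \<Rightarrow> ('n \<Rightarrow> real) \<Rightarrow> real \<Rightarrow> real^'n" where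
  "glue i w t = (\<chi> j. if j = i then t else w j)"

abbreviation lines_measure :: "'n::finite \<Rightarrow> ('n \<Rightarrow> real) measure" where
  "lines_measure i \<equiv> \<Pi>\<^sub>M j\<in>UNIV - {i}. lborel"

lemma glue_nth [simp]: "glue i w t $ j = (if j = i then t else w j)"
  by (simp add: glue_def)

lemma glue_eq: "glue i w t = glue i w 0 + t *\<^sub>R axis i 1"
  by (simp add: vec_eq_iff axis_def)

lemma Basis_real_vec: "(Basis :: (real^'n::finite) set) = (\<lambda>i. axis i 1) ` UNIV"
  by (auto simp: Basis_vec_def)

lemma inj_axis_one: "inj (\<lambda>i::'n::finite. axis i (1::real))"
  by (simp add: inj_on_def axis_eq_axis)

lemma borel_measurable_vecI:
  fixes f :: "'a \<Rightarrow> real^'n::finite"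
  assumes "\<And>j. (\<lambda>x. f x $ j) \<in> borel_measurable M"
  shows "f \<in> borel_measurable M"
  using assms by (subst borel_measurable_euclidean_space) (auto simp: Basis_real_vec inner_axis)

lemma measurable_glue [measurable]:
  "(\<lambda>(w, t). glue i w t) \<in> borel_measurable (lines_measure i \<Otimes>\<^sub>M borel)"
proof (rule borel_measurable_vecI)
  fix j
  show "(\<lambda>x. (case x of (w, t) \<Rightarrow> glue i w t) $ j) \<in> borel_measurable (lines_measure i \<Otimes>\<^sub>M borel)"
    by (cases "j = i") (auto simp: case_prod_beta')
qed

lemma measurable_glue1 [measurable]: "(\<lambda>w. glue i w t) \<in> borel_measurable (lines_measure i)"
  using measurable_compose[OF measurable_Pair1' measurable_glue] by auto

lemma measurable_glue2:
  "w \<in> space (lines_measure i) \<Longrightarrow> (\<lambda>t. glue i w t) \<in> borel_measurable borel"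
  using measurable_compose[OF measurable_Pair1' measurable_glue] by auto

lemma sigma_finite_lines_measure: "sigma_finite_measure (lines_measure i)"
proof -
  interpret product_sigma_finite "\<lambda>_::'a. lborel :: real measure"
    by standard
  show ?thesis by (rule sigma_finite) simp
qed

lemma measurable_glue_lborel:
  "(\<lambda>(w, t). glue i w t) \<in> borel_measurable (lines_measure i \<Otimes>\<^sub>M lborel)"
  by (subst measurable_cong_sets[OF sets_pair_measure_cong[OF refl sets_lborel] refl])
    (rule measurable_glue)

text \<open>Lebesgue measure is determined by its values on open boxes, and the preimage of a box
  under \<open>glue\<close> is a product of intervals, whose measure is the product of the side
  lengths.\<close>

lemma lborel_eq_distr_glue:
  "(lborel :: (real^'n::finite) measure) =
    distr (lines_measure i \<Otimes>\<^sub>M lborel) borel (\<lambda>(w, t). glue i w t)" (is "_ = ?D")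
proof (rule lborel_eqI)
  interpret product_sigma_finite "\<lambda>_::'n. lborel :: real measure"
    by standard
  fix l u :: "real^'n"
  assume lu: "\<And>b. b \<in> Basis \<Longrightarrow> l \<bullet> b \<le> u \<bullet> b"
  have le: "l $ j \<le> u $ j" for j
    using lu[of "axis j 1"] by (simp add: Basis_real_vec inner_axis)
  have "emeasure ?D (box l u) = emeasure (lines_measure i \<Otimes>\<^sub>M lborel)
      ((\<lambda>(w, t). glue i w t) -` box l u \<inter> space (lines_measure i \<Otimes>\<^sub>M lborel))"
    by (rule emeasure_distr[OF measurable_glue_lborel]) simp
  also have "(\<lambda>(w, t). glue i w t) -` box l u \<inter> space (lines_measure i \<Otimes>\<^sub>M lborel)
      = (\<Pi>\<^sub>E j\<in>UNIV - {i}. {l $ j<..<u $ j}) \<times> {l $ i<..<u $ i}"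
  proof (intro set_eqI iffI)
    fix x assume x: "x \<in> (\<lambda>(w, t). glue i w t) -` box l u \<inter> space (lines_measure i \<Otimes>\<^sub>M lborel)"
    obtain w t where [simp]: "x = (w, t)" by (cases x)
    have "w \<in> extensional (UNIV - {i})"
      using x by (simp add: space_pair_measure space_PiM PiE_def)
    moreover have "l $ j < glue i w t $ j \<and> glue i w t $ j < u $ j" for j
      using x by (simp add: mem_box_cart)
    from this[of i] this have "l $ i < t" "t < u $ i" "\<And>j. j \<noteq> i \<Longrightarrow> l $ j < w j \<and> w j < u $ j"
      by (simp, simp, metis glue_nth)
    ultimately show "x \<in> (\<Pi>\<^sub>E j\<in>UNIV - {i}. {l $ j<..<u $ j}) \<times> {l $ i<..<u $ i}"
      by (simp add: PiE_iff)
  next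
    fix x assume x: "x \<in> (\<Pi>\<^sub>E j\<in>UNIV - {i}. {l $ j<..<u $ j}) \<times> {l $ i<..<u $ i}"
    obtain w t where [simp]: "x = (w, t)" by (cases x)
    show "x \<in> (\<lambda>(w, t). glue i w t) -` box l u \<inter> space (lines_measure i \<Otimes>\<^sub>M lborel)"
      using x by (simp add: mem_box_cart space_pair_measure space_PiM PiE_iff)
  qed
  also have "emeasure (lines_measure i \<Otimes>\<^sub>M lborel) \<dots>
      = emeasure (lines_measure i) (\<Pi>\<^sub>E j\<in>UNIV - {i}. {l $ j<..<u $ j}) * emeasure lborel {l $ i<..<u $ i}"
    by (subst lborel.emeasure_pair_measure_Times) (auto intro!: sets_PiM_I_finite)
  also have "\<dots> = (\<Prod>j\<in>UNIV - {i}. ennreal (u $ j - l $ j)) * ennreal (u $ i - l $ i)"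
    using le by (subst emeasure_PiM) auto
  also have "\<dots> = (\<Prod>j\<in>UNIV. ennreal (u $ j - l $ j))"
    by (subst prod.remove[of UNIV i]) (auto simp: mult.commute)
  also have "\<dots> = ennreal (\<Prod>j\<in>UNIV. (u $ j - l $ j))"
    using le by (intro prod_ennreal) auto
  also have "(\<Prod>j\<in>UNIV. (u $ j - l $ j)) = (\<Prod>b\<in>Basis. (u - l) \<bullet> b)"
    by (simp add: Basis_real_vec prod.reindex[OF inj_axis_one] inner_axis)
  finally show "emeasure ?D (box l u) = (\<Prod>b\<in>Basis. (u - l) \<bullet> b)" .
qed simp

lemma nn_integral_glue:
  fixes f :: "real^'n::finite \<Rightarrow> ennreal"
  assumes [measurable]: "f \<in> borel_measurable borel"
  shows "(\<integral>\<^sup>+y. f y \<partial>lborel) = (\<integral>\<^sup>+w. \<integral>\<^sup>+t. f (glue i w t) \<partial>lborel \<partial>lines_measure i)"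
  by (subst lborel_eq_distr_glue[of i])
    (simp add: nn_integral_distr measurable_glue_lborel lborel.nn_integral_fst[symmetric] case_prod_beta'
      measurable_compose[OF measurable_glue_lborel[unfolded case_prod_beta']])

lemma nn_integral_glue_swap:
  fixes f :: "real^'n::finite \<Rightarrow> ennreal"
  assumes [measurable]: "f \<in> borel_measurable borel"
  shows "(\<integral>\<^sup>+y. f y \<partial>lborel) = (\<integral>\<^sup>+t. \<integral>\<^sup>+w. f (glue i w t) \<partial>lines_measure i \<partial>lborel)"
proof -
  interpret L: sigma_finite_measure "lines_measure i" by (rule sigma_finite_lines_measure)
  interpret pair_sigma_finite "lines_measure i" "lborel :: real measure" ..
  have "(\<lambda>(w, t). f (glue i w t)) \<in> borel_measurable (lines_measure i \<Otimes>\<^sub>M lborel)"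
    using measurable_compose[OF measurable_glue_lborel[of i] assms] by (simp add: case_prod_beta')
  from Fubini'[OF this] show ?thesis
    by (simp add: nn_integral_glue[OF assms, of i])
qed

text \<open>Serves the integration by parts, where the integrand is a total derivative along every
  line in direction i.\<close>

lemma integral_glue_eq_zero:
  fixes f :: "real^'n::finite \<Rightarrow> 'b::{banach, second_countable_topology}"
  assumes "integrable lborel f"
    and "\<And>w. integral\<^sup>L lborel (\<lambda>t. f (glue i w t)) = 0"
  shows "integral\<^sup>L lborel f = 0"
proof -
  interpret L: sigma_finite_measure "lines_measure i" by (rule sigma_finite_lines_measure)
  interpret pair_sigma_finite "lines_measure i" "lborel :: real measure" ..
  have [measurable]: "f \<in> borel_measurable borel"
    using assms(1) by (auto dest: borel_measurable_integrable)
  have "integral\<^sup>L lborel f = integral\<^sup>L (lines_measure i \<Otimes>\<^sub>M lborel) (\<lambda>(w, t). f (glue i w t))"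
    by (subst lborel_eq_distr_glue[of i], subst integral_distr)
      (auto simp: measurable_glue_lborel case_prod_beta')
  moreover have "integrable (lines_measure i \<Otimes>\<^sub>M lborel) (\<lambda>(w, t). f (glue i w t))"
    using assms(1) by (subst (asm) lborel_eq_distr_glue[of i], subst (asm) integrable_distr_eq)
      (auto simp: measurable_glue_lborel case_prod_beta')
  ultimately show ?thesis
    using assms(2) by (simp add: integral_fst'[symmetric])
qed

section \<open>Level sets and lines\<close>

lemma nn_integral_substitution_pos:
  fixes p p' :: "real \<Rightarrow> real" and F :: "real \<Rightarrow> ennreal"
  assumes F: "F \<in> borel_measurable borel"
    and der: "\<And>t. t \<in> {a..b} \<Longrightarrow> (p has_real_derivative p' t) (at t)"
    and cont: "continuous_on {a..b} p'"
    and pos: "\<And>t. t \<in> {a..b} \<Longrightarrow> p' t > 0"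
    and zero: "\<And>s. s \<notin> p ` {a..b} \<Longrightarrow> F s = 0"
    and ab: "a \<le> b"
  shows "(\<integral>\<^sup>+s. F s \<partial>lborel) = (\<integral>\<^sup>+t. F (p t) * ennreal \<bar>p' t\<bar> * indicator {a..b} t \<partial>lborel)"
proof (cases "a = b")
  \<comment> \<open>The degenerate interval is treated apart: both integrands then live on a single
    point, hence on a null set.\<close>
  case True
  have "AE s in lborel. s \<noteq> p a" by (rule AE_lborel_singleton)
  then have "(\<integral>\<^sup>+s. F s \<partial>lborel) = (\<integral>\<^sup>+s. 0 \<partial>(lborel::real measure))"
    by (intro nn_integral_cong_AE) (auto simp: True zero elim!: eventually_mono)
  moreover have "AE t in lborel. t \<noteq> a" by (rule AE_lborel_singleton)
  then have "(\<integral>\<^sup>+t. F (p t) * ennreal \<bar>p' t\<bar> * indicator {a..b} t \<partial>lborel) = (\<integral>\<^sup>+s. 0 \<partial>(lborel::real measure))"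
    by (intro nn_integral_cong_AE) (auto simp: True elim!: eventually_mono)
  ultimately show ?thesis by simp
next
  case False
  with ab have "a < b" by simp
  have mono: "p s \<le> p t" if "a \<le> s" "s \<le> t" "t \<le> b" for s t
    using that DERIV_nonneg_imp_nondecreasing[of s t p] der pos by (meson atLeastAtMost_iff less_imp_le order_trans)
  have "(\<integral>\<^sup>+s. F s \<partial>lborel) = (\<integral>\<^sup>+s. F s * indicator {p a..p b} s \<partial>lborel)"
  proof (rule nn_integral_cong)
    fix s
    show "F s = F s * indicator {p a..p b} s"
    proof (cases "s \<in> p ` {a..b}")
      case True
      then show ?thesis using mono by auto
    qed (simp add: zero)
  qed
  also have "\<dots> = (\<integral>\<^sup>+t. F (p t) * ennreal (p' t) * indicator {a..b} t \<partial>lborel)"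
    using pos by (intro nn_integral_substitution_aux F der cont \<open>a < b\<close>) (auto intro: less_imp_le)
  also have "\<dots> = (\<integral>\<^sup>+t. F (p t) * ennreal \<bar>p' t\<bar> * indicator {a..b} t \<partial>lborel)"
    using pos by (intro nn_integral_cong) (auto simp: abs_of_pos split: split_indicator)
  finally show ?thesis .
qed

text \<open>A continuous derivative without zeros has constant sign on the interval. A decreasing p
  is made increasing by reflecting the target line, that is, by passing to \<open>- p\<close> and
  \<open>F (- s)\<close>.\<close>

lemma nn_integral_substitution_nonzero:
  fixes p p' :: "real \<Rightarrow> real" and F :: "real \<Rightarrow> ennreal"
  assumes F[measurable]: "F \<in> borel_measurable borel"
    and der: "\<And>t. t \<in> {a..b} \<Longrightarrow> (p has_real_derivative p' t) (at t)"
    and cont: "continuous_on {a..b} p'"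
    and nz: "\<And>t. t \<in> {a..b} \<Longrightarrow> p' t \<noteq> 0"
    and zero: "\<And>s. s \<notin> p ` {a..b} \<Longrightarrow> F s = 0"
    and ab: "a \<le> b"
  shows "(\<integral>\<^sup>+s. F s \<partial>lborel) = (\<integral>\<^sup>+t. F (p t) * ennreal \<bar>p' t\<bar> * indicator {a..b} t \<partial>lborel)"
proof -
  have "connected (p' ` {a..b})"
    by (intro connected_continuous_image cont) simp
  then have iv: "is_interval (p' ` {a..b})"
    by (simp add: is_interval_connected_1)
  have "(\<forall>t\<in>{a..b}. p' t > 0) \<or> (\<forall>t\<in>{a..b}. p' t < 0)"
  proof (rule ccontr)
    assume "\<not> ?thesis"
    then obtain s t where st: "s \<in> {a..b}" "t \<in> {a..b}" "p' s \<le> 0" "0 \<le> p' t"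
      by (meson not_less)
    then have "0 \<in> p' ` {a..b}"
      using iv unfolding is_interval_1 by (meson imageI)
    with nz show False by auto
  qed
  then show ?thesis
  proof
    assume "\<forall>t\<in>{a..b}. p' t > 0"
    then show ?thesis
      using assms by (intro nn_integral_substitution_pos) auto
  next
    assume neg: "\<forall>t\<in>{a..b}. p' t < 0"
    have "(\<integral>\<^sup>+s. F s \<partial>lborel) = (\<integral>\<^sup>+s. F (- s) \<partial>lborel)"
      by (subst nn_integral_real_affine[of _ "-1" 0]) auto
    also have "\<dots> = (\<integral>\<^sup>+t. F (- (- p t)) * ennreal \<bar>- p' t\<bar> * indicator {a..b} t \<partial>lborel)"
    proof (rule nn_integral_substitution_pos[where F = "\<lambda>s. F (- s)"])
      show "F (- s) = 0" if "s \<notin> (\<lambda>t. - p t) ` {a..b}" for s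
        using that by (intro zero) (metis (no_types, lifting) image_iff minus_minus)
    qed (use der cont neg ab in \<open>auto intro!: derivative_eq_intros continuous_intros\<close>)
    finally show ?thesis by simp
  qed
qed

section \<open>Level sets cut by coordinate lines\<close>

locale smooth_levels =
  fixes G :: "(real^'n::finite) set" and P :: "real^'n \<Rightarrow> real"
  assumes open_G: "open G" and smooth_P: "smooth_on_open G P"
    and gradient_nonzero: "\<And>y. y \<in> G \<Longrightarrow> gradient P y \<noteq> 0"
begin

definition noncrit :: "'n \<Rightarrow> (real^'n) set" where
  "noncrit i = {y \<in> G. partial_derivative i P y \<noteq> 0}"

lemma continuous_P: "continuous_on G P"
  by (rule smooth_on_open_continuous_on[OF smooth_P])

lemma continuous_partial_P: "continuous_on G (partial_derivative i P)"
  by (rule smooth_on_open_continuous_on[OF smooth_on_open_partial_derivative[OF open_G smooth_P]])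

lemma open_noncrit: "open (noncrit i)"
proof -
  have "noncrit i = G \<inter> partial_derivative i P -` (- {0})"
    by (auto simp: noncrit_def)
  then show ?thesis
    using continuous_open_preimage[OF continuous_partial_P open_G, of "- {0}" i]
    by (simp add: open_Compl)
qed

lemma noncrit_subset: "noncrit i \<subseteq> G"
  by (auto simp: noncrit_def)

end

lemma glue_nth_self: "glue i (($) y) (y $ i) = y"
  by (simp add: vec_eq_iff)

lemma glue_glue: "glue i (($) (glue i w x)) t = glue i w t"
  by (simp add: vec_eq_iff)

lemma has_vector_derivative_glue:
  assumes "f differentiable (at (glue i w t))"
  shows "((\<lambda>t. f (glue i w t)) has_vector_derivative partial_derivative i f (glue i w t)) (at t)"
proof -
  let ?D = "frechet_derivative f (at (glue i w t))"
  have D: "(f has_derivative ?D) (at (glue i w t))"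
    by (rule has_derivative_frechet[OF assms])
  have "((\<lambda>t. glue i w 0 + t *\<^sub>R axis i 1) has_derivative (\<lambda>h. 0 + h *\<^sub>R axis i 1)) (at t)"
    by (intro has_derivative_add has_derivative_const has_derivative_scaleR_left has_derivative_ident)
  also have "(\<lambda>t. glue i w 0 + t *\<^sub>R axis i 1) = glue i w"
    by (rule ext) (rule glue_eq[symmetric])
  finally have "(glue i w has_derivative (\<lambda>h. h *\<^sub>R axis i 1)) (at t)"
    by (simp only: add_0_left)
  from has_derivative_compose[OF this D]
  have "((\<lambda>t. f (glue i w t)) has_derivative (\<lambda>h. ?D (h *\<^sub>R axis i 1))) (at t)" .
  moreover have "?D (h *\<^sub>R axis i 1) = h *\<^sub>R partial_derivative i f (glue i w t)" for h
    using linear_cmul[OF linear_frechet_derivative[OF assms]] by (simp add: partial_derivative_def)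
  ultimately show ?thesis
    by (simp add: has_vector_derivative_def)
qed

lemma continuous_glue: "continuous_on S (glue i w)"
proof -
  have "continuous_on S (\<lambda>t. glue i w 0 + t *\<^sub>R axis i 1)"
    by (intro continuous_intros)
  also have "(\<lambda>t. glue i w 0 + t *\<^sub>R axis i 1) = glue i w"
    by (rule ext) (rule glue_eq[symmetric])
  finally show ?thesis .
qed

text \<open>The sum of \<open>\<psi>\<close> over the preimages of \<open>v\<close> under the map that replaces the \<open>i\<close>-th coordinate of a
  point \<open>y\<close> by \<open>P y\<close>.\<close>

definition sheets :: "'n::finite \<Rightarrow> (real^'n \<Rightarrow> real) \<Rightarrow> (real^'n \<Rightarrow> ennreal) \<Rightarrow> real^'n \<Rightarrow> ennreal" where
  "sheets i P \<psi> v = (\<integral>\<^sup>+t. indicator {t. P (glue i (($) v) t) = v $ i} t * \<psi> (glue i (($) v) t)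
    \<partial>count_space UNIV)"

lemma sheets_glue:
  "sheets i P \<psi> (glue i w x) =
    (\<integral>\<^sup>+t. indicator {t. P (glue i w t) = x} t * \<psi> (glue i w t) \<partial>count_space UNIV)"
  by (simp add: sheets_def glue_glue)

lemma sheets_suminf:
  assumes "\<And>y. \<psi> y = (\<Sum>k. \<phi> k y)"
  shows "sheets i P \<psi> v = (\<Sum>k. sheets i P (\<phi> k) v)"
proof -
  have "indicator A t * (\<Sum>k. \<phi> k y) = (\<Sum>k. indicator A t * \<phi> k y)" for A :: "real set" and t y
    by simp
  then show ?thesis
    unfolding sheets_def assms by (simp only:) (subst nn_integral_suminf, auto)
qed

context smooth_levels
begin

lemma line_derivative:
  assumes "glue i w t \<in> G"
  shows "((\<lambda>t. P (glue i w t)) has_real_derivative partial_derivative i P (glue i w t)) (at t)"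
  using has_vector_derivative_glue[OF smooth_on_open_differentiable[OF smooth_P assms]]
  by (simp add: has_real_derivative_iff_has_vector_derivative)

text \<open>By Rolle's theorem a line in direction \<open>i\<close> meets a level set at most once inside a box on which
  \<open>\<partial>\<^sub>iP \<noteq> 0\<close>. Countably many such boxes cover the set \<^const>\<open>noncrit\<close>, which makes the sums over
  sheets measurable.\<close>

lemma box_line_inj:
  assumes C: "cbox a b \<subseteq> noncrit i" and st: "glue i w s \<in> cbox a b" "glue i w t \<in> cbox a b"
    and eq: "P (glue i w s) = P (glue i w t)"
  shows "s = t"
proof -
  have False if hyps: "s < t" "glue i w s \<in> cbox a b" "glue i w t \<in> cbox a b"
      "P (glue i w s) = P (glue i w t)" for s t
  proof -
    have mem: "glue i w r \<in> noncrit i" if "s \<le> r" "r \<le> t" for r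
    proof -
      have "glue i w r \<in> cbox a b"
        unfolding mem_box_cart
      proof
        fix j
        show "a $ j \<le> glue i w r $ j \<and> glue i w r $ j \<le> b $ j"
          using \<open>glue i w s \<in> cbox a b\<close> \<open>glue i w t \<in> cbox a b\<close> that
          by (cases "j = i") (auto simp: mem_box_cart dest!: spec[of _ j])
      qed
      with C show ?thesis by blast
    qed
    have "\<exists>z. s < z \<and> z < t \<and> P (glue i w t) - P (glue i w s)
        = (t - s) * partial_derivative i P (glue i w z)"
      using \<open>s < t\<close> mem by (intro MVT2) (auto intro!: line_derivative simp: noncrit_def)
    then obtain z where "s < z" "z < t" "partial_derivative i P (glue i w z) = 0"
      using hyps by auto
    with mem[of z] show False by (simp add: noncrit_def)
  qed
  from this[of s t] this[of t s] st eq show ?thesis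
    by (metis linorder_neqE_linordered_idom)
qed

text \<open>The straightening map of the implicit function theorem: it sends the level set at height
  x into the hyperplane \<open>v $ i = x\<close>, and its Jacobian determinant is
  \<open>\<partial>\<^sub>iP\<close>.\<close>

abbreviation flatten :: "'n \<Rightarrow> real^'n \<Rightarrow> real^'n" where
  "flatten i y \<equiv> glue i (($) y) (P y)"

lemma flatten_inj:
  assumes "cbox a b \<subseteq> noncrit i"
  shows "inj_on (flatten i) (cbox a b)"
proof (rule inj_onI)
  fix y z assume yz: "y \<in> cbox a b" "z \<in> cbox a b" and eq: "flatten i y = flatten i z"
  have "P y = P z"
    using arg_cong[OF eq, of "\<lambda>v. v $ i"] by simp
  have "y $ j = z $ j" if "j \<noteq> i" for j
    using arg_cong[OF eq, of "\<lambda>v. v $ j"] that by simp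
  then have z: "glue i (($) y) (z $ i) = z"
    by (simp add: vec_eq_iff)
  have "y $ i = z $ i"
    by (rule box_line_inj[OF assms, of "($) y"])
      (use yz \<open>P y = P z\<close> in \<open>simp_all add: z glue_nth_self\<close>)
  with z show "y = z" by (metis glue_nth_self)
qed

text \<open>Inside the box a line carries at most one point of each level, so the sum over sheets
  has at most one nonzero term, found by the local inverse of \<open>flatten i\<close>.\<close>

lemma sheets_box:
  assumes C: "cbox a b \<subseteq> noncrit i" and zero: "\<And>y. y \<notin> cbox a b \<Longrightarrow> \<psi> y = 0"
  shows "sheets i P \<psi> v = indicator (flatten i ` cbox a b) v * \<psi> (inv_into (cbox a b) (flatten i) v)"
proof (cases "v \<in> flatten i ` cbox a b")
  case True
  then obtain y where y: "y \<in> cbox a b" "v = flatten i y" by blast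
  have eqg: "glue i (($) v) t = glue i (($) y) t" for t
    by (simp add: y glue_glue)
  have "sheets i P \<psi> v = (\<Sum>t\<in>{y $ i}. indicator {t. P (glue i (($) v) t) = v $ i} t * \<psi> (glue i (($) v) t))"
    unfolding sheets_def
  proof (rule nn_integral_count_space')
    fix t assume "t \<notin> {y $ i}"
    then have "P (glue i (($) y) t) = P y \<Longrightarrow> glue i (($) y) t \<notin> cbox a b"
      using box_line_inj[OF C, of "($) y" t "y $ i"] y(1) by (auto simp: glue_nth_self)
    then show "indicator {t. P (glue i (($) v) t) = v $ i} t * \<psi> (glue i (($) v) t) = 0"
      unfolding eqg using zero by (auto simp: y split: split_indicator)
  qed auto
  also have "\<dots> = \<psi> y"
    unfolding eqg by (simp add: glue_nth_self y)
  also have "y = inv_into (cbox a b) (flatten i) v"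
    using inv_into_f_f[OF flatten_inj[OF C] y(1)] y(2) by simp
  finally show ?thesis using True by simp
next
  case False
  have "indicator {t. P (glue i (($) v) t) = v $ i} t * \<psi> (glue i (($) v) t) = 0" for t
  proof (cases "P (glue i (($) v) t) = v $ i")
    case True
    then have "flatten i (glue i (($) v) t) = v"
      by (simp only: glue_glue glue_nth_self)
    with False have "glue i (($) v) t \<notin> cbox a b"
      using imageI[of "glue i (($) v) t" "cbox a b" "flatten i"] by force
    from zero[OF this] show ?thesis by simp
  qed simp
  with False show ?thesis by (simp only: sheets_def) simp
qed

text \<open>A continuous injection of a compact box has a compact image and a continuous inverse;
  the formula of \<open>sheets_box\<close> is then visibly Borel.\<close>

lemma borel_measurable_sheets_box:
  assumes C: "cbox a b \<subseteq> noncrit i" and zero: "\<And>y. y \<notin> cbox a b \<Longrightarrow> \<psi> y = 0"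
    and [measurable]: "\<psi> \<in> borel_measurable borel"
  shows "sheets i P \<psi> \<in> borel_measurable borel"
proof -
  let ?C = "cbox a b"
  have CG: "?C \<subseteq> G" using C noncrit_subset by blast
  have eq: "flatten i = (\<lambda>y. y + (P y - y $ i) *\<^sub>R axis i 1)"
    by (auto simp: fun_eq_iff vec_eq_iff axis_def)
  have cont: "continuous_on ?C (flatten i)"
    unfolding eq by (intro continuous_intros continuous_on_subset[OF continuous_P CG])
  have compact: "compact (flatten i ` ?C)"
    using cont by (intro compact_continuous_image) auto
  have "continuous_on (flatten i ` ?C) (inv_into ?C (flatten i))"
    by (intro continuous_on_inv[OF cont]) (use inv_into_f_f[OF flatten_inj[OF C]] in auto)
  \<comment> \<open>Off the image \<open>inv_into\<close> is an arbitrary choice; the indicator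
    replaces it by 0 and yields a Borel function on the whole space.\<close>
  then have [measurable]:
    "(\<lambda>v. indicator (flatten i ` ?C) v *\<^sub>R inv_into ?C (flatten i) v) \<in> borel_measurable borel"
    using compact by (intro borel_measurable_continuous_on_indicator) (auto intro: borel_compact)
  have [measurable]: "flatten i ` ?C \<in> sets borel"
    using compact by (rule borel_compact)
  have "(\<lambda>v. indicator (flatten i ` ?C) v
      * \<psi> (indicator (flatten i ` ?C) v *\<^sub>R inv_into ?C (flatten i) v)) \<in> borel_measurable borel"
    by measurable
  also have "(\<lambda>v. indicator (flatten i ` ?C) v
      * \<psi> (indicator (flatten i ` ?C) v *\<^sub>R inv_into ?C (flatten i) v)) = sheets i P \<psi>"
    by (auto simp: fun_eq_iff sheets_box[OF C zero] split: split_indicator)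
  finally show ?thesis .
qed

text \<open>On a fixed line this is the substitution \<open>s = P (glue i w t)\<close>, where t runs
  over the edge of the box in direction i. A line that misses the box contributes 0 to both
  sides.\<close>

lemma nn_integral_sheets_box:
  assumes C: "cbox a b \<subseteq> noncrit i" and zero: "\<And>y. y \<notin> cbox a b \<Longrightarrow> \<psi> y = 0"
    and [measurable]: "\<psi> \<in> borel_measurable borel"
    and w: "w \<in> space (lines_measure i)"
  shows "(\<integral>\<^sup>+s. sheets i P \<psi> (glue i w s) \<partial>lborel)
    = (\<integral>\<^sup>+t. \<psi> (glue i w t) * ennreal \<bar>partial_derivative i P (glue i w t)\<bar> \<partial>lborel)"
proof (cases "(\<forall>j. j \<noteq> i \<longrightarrow> a $ j \<le> w j \<and> w j \<le> b $ j) \<and> a $ i \<le> b $ i")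
  case False
  have notin: "glue i w t \<notin> cbox a b" for t
  proof
    assume *: "glue i w t \<in> cbox a b"
    have "a $ j \<le> w j \<and> w j \<le> b $ j" if "j \<noteq> i" for j
      using * that unfolding mem_box_cart by (auto dest!: spec[of _ j])
    moreover have "a $ i \<le> b $ i"
      using * unfolding mem_box_cart by (auto dest!: spec[of _ i])
    ultimately show False using False by blast
  qed
  show ?thesis by (simp add: sheets_glue zero[OF notin])
next
  case True
  have mem: "glue i w t \<in> cbox a b \<longleftrightarrow> t \<in> {a $ i..b $ i}" for t
    using True unfolding mem_box_cart by (auto split: if_splits)
  have inG: "glue i w t \<in> noncrit i" if "t \<in> {a $ i..b $ i}" for t
    using C that mem by blast
  have "(\<integral>\<^sup>+s. sheets i P \<psi> (glue i w s) \<partial>lborel)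
    = (\<integral>\<^sup>+t. sheets i P \<psi> (glue i w (P (glue i w t)))
      * ennreal \<bar>partial_derivative i P (glue i w t)\<bar> * indicator {a $ i..b $ i} t \<partial>lborel)"
  proof (rule nn_integral_substitution_nonzero)
    show "(\<lambda>s. sheets i P \<psi> (glue i w s)) \<in> borel_measurable borel"
      using borel_measurable_sheets_box[OF C zero] measurable_glue2[OF w] by measurable
    show "((\<lambda>t. P (glue i w t)) has_real_derivative partial_derivative i P (glue i w t)) (at t)"
      if "t \<in> {a $ i..b $ i}" for t
      using inG[OF that] by (intro line_derivative) (simp add: noncrit_def)
    show "continuous_on {a $ i..b $ i} (\<lambda>t. partial_derivative i P (glue i w t))"
      using inG by (intro continuous_on_compose2[OF continuous_partial_P continuous_glue])
        (auto simp: noncrit_def)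
    show "partial_derivative i P (glue i w t) \<noteq> 0" if "t \<in> {a $ i..b $ i}" for t
      using inG[OF that] by (simp add: noncrit_def)
    show "sheets i P \<psi> (glue i w s) = 0" if "s \<notin> (\<lambda>t. P (glue i w t)) ` {a $ i..b $ i}" for s
    proof -
      have "indicator {t. P (glue i w t) = s} t * \<psi> (glue i w t) = 0" for t
        using that zero[of "glue i w t"] mem[of t] by (auto split: split_indicator)
      then show ?thesis by (simp only: sheets_glue) simp
    qed
  qed (use True in simp)
  also have "\<dots> = (\<integral>\<^sup>+t. \<psi> (glue i w t) * ennreal \<bar>partial_derivative i P (glue i w t)\<bar> \<partial>lborel)"
  proof (rule nn_integral_cong)
    fix t
    show "sheets i P \<psi> (glue i w (P (glue i w t)))
      * ennreal \<bar>partial_derivative i P (glue i w t)\<bar> * indicator {a $ i..b $ i} t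
      = \<psi> (glue i w t) * ennreal \<bar>partial_derivative i P (glue i w t)\<bar>"
    proof (cases "t \<in> {a $ i..b $ i}")
      case True
      have y: "glue i w t \<in> cbox a b"
        using True mem by blast
      have v: "flatten i (glue i w t) = glue i w (P (glue i w t))"
        by (rule glue_glue)
      have "glue i w (P (glue i w t)) \<in> flatten i ` cbox a b"
        using imageI[OF y, of "flatten i"] unfolding v .
      moreover have "inv_into (cbox a b) (flatten i) (glue i w (P (glue i w t))) = glue i w t"
        using inv_into_f_f[OF flatten_inj[OF C] y] unfolding v .
      ultimately have "sheets i P \<psi> (glue i w (P (glue i w t))) = \<psi> (glue i w t)"
        by (subst sheets_box[OF C zero]) simp_all
      with True show ?thesis by simp
    next
      case False
      then show ?thesis using zero mem by simp
    qed
  qed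
  finally show ?thesis .
qed

lemma noncrit_box_cover:
  obtains C where "\<And>k::nat. \<exists>a b. C k = cbox a b" "(\<Union>k. C k) = noncrit i"
proof -
  obtain D where D: "countable D" "\<And>X. X \<in> D \<Longrightarrow> \<exists>a b. X = cbox a b" "\<Union>D = noncrit i"
    using open_countable_Union_open_cbox[OF open_noncrit[of i]] by metis
  \<comment> \<open>The empty box keeps the family nonempty, so that \<open>from_nat_into\<close>
    enumerates it even if \<open>noncrit i\<close> is empty.\<close>
  let ?D = "insert {} D"
  have range: "range (from_nat_into ?D) = ?D"
    using D(1) by (intro range_from_nat_into) auto
  have "\<exists>a b. X = cbox a b" if "X \<in> ?D" for X
    using that D(2) empty_as_interval by auto
  then have "\<exists>a b. from_nat_into ?D k = cbox a b" for k
    using range by blast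
  moreover have "(\<Union>k. from_nat_into ?D k) = noncrit i"
    using D(3) range by auto
  ultimately show ?thesis by (rule that)
qed

text \<open>The change of variables for \<open>flatten i\<close>, counted with multiplicity. This
  map is injective only on each box, and the boxes may overlap; so the cover is made disjoint,
  \<psi> is cut along the pieces, each of which lies in one box, and the results are added up by
  monotone convergence.\<close>

lemma
  assumes [measurable]: "\<psi> \<in> borel_measurable borel" and zero: "\<And>y. y \<notin> noncrit i \<Longrightarrow> \<psi> y = 0"
  shows borel_measurable_sheets: "sheets i P \<psi> \<in> borel_measurable borel"
    and nn_integral_sheets: "(\<integral>\<^sup>+v. sheets i P \<psi> v \<partial>lborel)
      = (\<integral>\<^sup>+y. \<psi> y * ennreal \<bar>partial_derivative i P y\<bar> \<partial>lborel)"
proof -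
  obtain C where C: "\<And>k::nat. \<exists>a b. C k = cbox a b" "(\<Union>k. C k) = noncrit i"
    using noncrit_box_cover[of i] by metis
  define B where "B = disjointed C"
  have dis: "disjoint_family B"
    unfolding B_def by (rule disjoint_family_disjointed)
  have UB: "(\<Union>k. B k) = noncrit i"
    unfolding B_def UN_disjointed_eq by (rule C)
  have rangeC: "range C \<subseteq> sets borel"
    using C(1) by (metis borel_closed closed_cbox image_subsetI)
  have [measurable]: "B k \<in> sets borel" for k
    using sets.range_disjointed_sets[OF rangeC] unfolding B_def by blast
  define \<phi> where "\<phi> k y = \<psi> y * indicator (B k) y" for k y
  have [measurable]: "\<phi> k \<in> borel_measurable borel" for k
    unfolding \<phi>_def by measurable
  have sum: "\<psi> y = (\<Sum>k. \<phi> k y)" for y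
  proof (cases "y \<in> noncrit i")
    case True
    then obtain k where "y \<in> B k" using UB by blast
    from suminf_cmult_indicator[OF dis this, of "\<lambda>_. \<psi> y"] show ?thesis
      by (simp add: \<phi>_def)
  qed (simp add: \<phi>_def zero)
  have sheets_sum: "sheets i P \<psi> v = (\<Sum>k. sheets i P (\<phi> k) v)" for v
    by (rule sheets_suminf[OF sum])
  have meas[measurable]: "sheets i P (\<phi> k) \<in> borel_measurable borel"
    and int: "w \<in> space (lines_measure i) \<Longrightarrow> (\<integral>\<^sup>+s. sheets i P (\<phi> k) (glue i w s) \<partial>lborel)
      = (\<integral>\<^sup>+t. \<phi> k (glue i w t) * ennreal \<bar>partial_derivative i P (glue i w t)\<bar> \<partial>lborel)" for k w
  proof -
    obtain a b where ab: "C k = cbox a b" using C(1) by blast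
    have sub: "cbox a b \<subseteq> noncrit i" using C(2) ab by blast
    have z: "\<phi> k y = 0" if "y \<notin> cbox a b" for y
      using that ab disjointed_subset[of C k]
      by (auto simp: \<phi>_def B_def indicator_eq_0_iff)
    show "sheets i P (\<phi> k) \<in> borel_measurable borel"
      by (rule borel_measurable_sheets_box[OF sub z]) measurable
    show "(\<integral>\<^sup>+s. sheets i P (\<phi> k) (glue i w s) \<partial>lborel)
      = (\<integral>\<^sup>+t. \<phi> k (glue i w t) * ennreal \<bar>partial_derivative i P (glue i w t)\<bar> \<partial>lborel)"
      if "w \<in> space (lines_measure i)"
      by (rule nn_integral_sheets_box[OF sub z _ that]) measurable
  qed
  show "sheets i P \<psi> \<in> borel_measurable borel"
    unfolding sheets_sum[abs_def] by measurable
  have [measurable]: "(\<lambda>y. indicator G y *\<^sub>R partial_derivative i P y) \<in> borel_measurable borel"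
    using open_G continuous_partial_P by (intro borel_measurable_continuous_on_indicator) auto
  \<comment> \<open>Measurability of the partial derivatives of P is known only on G; since \<phi>
    vanishes elsewhere, they may be cut off there.\<close>
  have \<phi>_eq: "\<phi> k y * ennreal \<bar>partial_derivative i P y\<bar>
      = \<phi> k y * ennreal \<bar>indicator G y *\<^sub>R partial_derivative i P y\<bar>" for k y
    using zero[of y] noncrit_subset by (auto simp: \<phi>_def split: split_indicator)
  have meas2[measurable]: "(\<lambda>y. \<phi> k y * ennreal \<bar>partial_derivative i P y\<bar>) \<in> borel_measurable borel" for k
    unfolding \<phi>_eq by measurable
  have "(\<integral>\<^sup>+v. sheets i P \<psi> v \<partial>lborel) = (\<Sum>k. \<integral>\<^sup>+v. sheets i P (\<phi> k) v \<partial>lborel)"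
    unfolding sheets_sum by (rule nn_integral_suminf) measurable
  also have "\<dots> = (\<Sum>k. \<integral>\<^sup>+y. \<phi> k y * ennreal \<bar>partial_derivative i P y\<bar> \<partial>lborel)"
    by (subst (1 2) nn_integral_glue[of _ i]) (auto intro!: suminf_cong nn_integral_cong int)
  also have "\<dots> = (\<integral>\<^sup>+y. \<psi> y * ennreal \<bar>partial_derivative i P y\<bar> \<partial>lborel)"
    by (subst nn_integral_suminf[symmetric]) (auto simp: sum)
  finally show "(\<integral>\<^sup>+v. sheets i P \<psi> v \<partial>lborel)
      = (\<integral>\<^sup>+y. \<psi> y * ennreal \<bar>partial_derivative i P y\<bar> \<partial>lborel)" .
qed

subsection \<open>The surface measure\<close>

abbreviation dP :: "'n \<Rightarrow> real^'n \<Rightarrow> real" where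
  "dP i y \<equiv> partial_derivative i P y"

definition chart :: "'n \<Rightarrow> (real^'n) set" where
  "chart i = {y \<in> G. graph_coordinate P y = i}"

lemma G_borel [measurable]: "G \<in> sets borel"
  using open_G by simp

lemma borel_measurable_indicator_G:
  fixes f :: "real^'n \<Rightarrow> 'b::real_normed_vector"
  shows "continuous_on G f \<Longrightarrow> (\<lambda>y. indicator G y *\<^sub>R f y) \<in> borel_measurable borel"
  by (intro borel_measurable_continuous_on_indicator G_borel)

lemma borel_measurable_dP [measurable]: "(\<lambda>y. indicator G y *\<^sub>R dP i y) \<in> borel_measurable borel"
  by (intro borel_measurable_indicator_G continuous_partial_P)

text \<open>Turns the choice of a minimal index into finitely many comparisons between partial
  derivatives, from which the charts are seen to be Borel sets. A maximal index exists because the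
  index type is finite.\<close>

lemma graph_coordinate_iff:
  "graph_coordinate P y = i \<longleftrightarrow> (\<forall>j. \<bar>dP j y\<bar> \<le> \<bar>dP i y\<bar>) \<and>
    (\<forall>k. (\<forall>j. \<bar>dP j y\<bar> \<le> \<bar>dP k y\<bar>) \<longrightarrow> to_nat i \<le> to_nat k)" (is "?L \<longleftrightarrow> ?R")
proof -
  let ?m = "\<lambda>i. \<forall>j. \<bar>dP j y\<bar> \<le> \<bar>dP i y\<bar>"
  let ?f = "\<lambda>j. \<bar>dP j y\<bar>"
  have "Max (range ?f) \<in> range ?f" by (rule Max_in) auto
  then obtain k where "Max (range ?f) = ?f k" by blast
  moreover have "?f j \<le> Max (range ?f)" for j by (rule Max_ge) auto
  ultimately have k: "?m k" by simp
  have 1: "?m (graph_coordinate P y)"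
    unfolding graph_coordinate_def using arg_min_natI[of ?m k to_nat] k by blast
  have 2: "to_nat (graph_coordinate P y) \<le> to_nat l" if "?m l" for l
    unfolding graph_coordinate_def using arg_min_nat_le[of ?m l to_nat] that by blast
  show ?thesis
  proof
    assume ?L
    with 1 2 show ?R by blast
  next
    assume R: ?R
    then have "to_nat (graph_coordinate P y) = to_nat i"
      using 1 2[of i] by (meson order_antisym)
    then show ?L by simp
  qed
qed

lemma chart_borel [measurable]: "chart i \<in> sets borel"
proof -
  define D where "D j y = indicator G y *\<^sub>R dP j y" for j y
  have [measurable]: "D j \<in> borel_measurable borel" for j
    unfolding D_def by measurable
  have "chart i = {y \<in> space borel. y \<in> G \<and> (\<forall>j. \<bar>D j y\<bar> \<le> \<bar>D i y\<bar>) \<and>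
    (\<forall>k. (\<forall>j. \<bar>D j y\<bar> \<le> \<bar>D k y\<bar>) \<longrightarrow> to_nat i \<le> to_nat k)}"
    by (auto simp: chart_def graph_coordinate_iff D_def)
  also have "\<dots> \<in> sets borel"
    by measurable
  finally show ?thesis .
qed

lemma chart_max: "y \<in> chart i \<Longrightarrow> \<bar>dP j y\<bar> \<le> \<bar>dP i y\<bar>"
  unfolding chart_def using graph_coordinate_iff by blast

lemma max_partial_nonzero:
  assumes "y \<in> G" "\<And>j. \<bar>dP j y\<bar> \<le> \<bar>dP i y\<bar>"
  shows "dP i y \<noteq> 0"
proof
  assume "dP i y = 0"
  then have "dP j y = 0" for j using assms(2)[of j] by simp
  then have "gradient P y = 0" by (simp add: gradient_def vec_eq_iff)
  with gradient_nonzero assms(1) show False by blast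
qed

lemma chart_subset: "chart i \<subseteq> noncrit i"
  using max_partial_nonzero chart_max by (auto simp: noncrit_def chart_def)

lemma sum_indicator_chart: "(\<Sum>i\<in>UNIV. indicator (chart i) y :: ennreal) = indicator G y"
proof (cases "y \<in> G")
  case True
  have "indicator (chart i) y = (if i = graph_coordinate P y then 1 else 0 :: ennreal)" for i
    using True by (auto simp: chart_def split: split_indicator)
  then show ?thesis using True by simp
qed (simp add: chart_def)

definition area :: "'n \<Rightarrow> real^'n \<Rightarrow> ennreal" where
  "area i y = indicator (chart i) y * ennreal (graph_area_factor P i y)"

lemma borel_measurable_area [measurable]: "area i \<in> borel_measurable borel"
proof -
  define D where "D j y = indicator G y *\<^sub>R dP j y" for j y
  have [measurable]: "D j \<in> borel_measurable borel" for j
    unfolding D_def by measurable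
  have "area i = (\<lambda>y. indicator (chart i) y * ennreal (sqrt (1 + (\<Sum>j\<in>UNIV - {i}. (D j y / D i y)\<^sup>2))))"
    by (auto simp: fun_eq_iff area_def graph_area_factor_def D_def chart_def split: split_indicator)
  then show ?thesis by simp
qed

lemma area_eq_0: "y \<notin> noncrit i \<Longrightarrow> area i y = 0"
  using chart_subset by (auto simp: area_def split: split_indicator)

lemma hyperplane_measure_eq: "hyperplane_measure i = distr (lines_measure i) borel (\<lambda>w. glue i w 0)"
  by (simp add: hyperplane_measure_def glue_def)

lemma measurable_replace [measurable]: "(\<lambda>u::real^'n. glue i (($) u) x) \<in> borel_measurable borel"
proof (rule borel_measurable_vecI)
  fix j
  show "(\<lambda>u::real^'n. glue i (($) u) x $ j) \<in> borel_measurable borel"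
    by (cases "j = i") auto
qed

text \<open>Counting measure is invariant under translation, so the base point u may slide along its
  line. Its i-th coordinate thereby becomes free and is used to store the level x, as
  \<open>sheets\<close> expects.\<close>

lemma sheet_integral_eq:
  assumes [measurable]: "A \<in> sets borel"
  shows "(\<integral>\<^sup>+u. (\<integral>\<^sup>+t.
        indicator (A \<inter> level_set G P x \<inter> {y. graph_coordinate P y = i}) (u + t *\<^sub>R axis i 1)
        * ennreal (graph_area_factor P i (u + t *\<^sub>R axis i 1))
      \<partial>count_space UNIV) \<partial>hyperplane_measure i)
    = (\<integral>\<^sup>+w. sheets i P (\<lambda>y. indicator A y * area i y) (glue i w x) \<partial>lines_measure i)"
proof -
  let ?\<psi> = "\<lambda>y. indicator A y * area i y"
  have [measurable]: "sheets i P ?\<psi> \<in> borel_measurable borel"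
    by (rule borel_measurable_sheets) (auto simp: area_eq_0)
  have inner: "(\<integral>\<^sup>+t.
        indicator (A \<inter> level_set G P x \<inter> {y. graph_coordinate P y = i}) (u + t *\<^sub>R axis i 1)
        * ennreal (graph_area_factor P i (u + t *\<^sub>R axis i 1)) \<partial>count_space UNIV)
      = sheets i P ?\<psi> (glue i (($) u) x)" for u
  proof -
    let ?F = "\<lambda>t. indicator {t. P (glue i (($) u) t) = x} t * ?\<psi> (glue i (($) u) t)"
    have eq: "u + t *\<^sub>R axis i 1 = glue i (($) u) (u $ i + t)" for t
      by (simp add: vec_eq_iff axis_def)
    have "(\<integral>\<^sup>+t.
        indicator (A \<inter> level_set G P x \<inter> {y. graph_coordinate P y = i}) (u + t *\<^sub>R axis i 1)
        * ennreal (graph_area_factor P i (u + t *\<^sub>R axis i 1)) \<partial>count_space UNIV)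
      = (\<integral>\<^sup>+t. ?F (u $ i + t) \<partial>count_space UNIV)"
      unfolding eq
      by (intro nn_integral_cong) (auto simp: area_def chart_def level_set_def split: split_indicator)
    also have "\<dots> = (\<integral>\<^sup>+t. ?F t \<partial>count_space UNIV)"
      by (rule nn_integral_bij_count_space)
        (rule bij_betw_byWitness[where f' = "\<lambda>t. t - u $ i"], auto)
    finally show ?thesis by (simp only: sheets_glue)
  qed
  show ?thesis
    unfolding inner hyperplane_measure_eq
    by (subst nn_integral_distr) (auto simp: glue_glue)
qed

lemma borel_measurable_sheets_line:
  assumes "\<psi> \<in> borel_measurable borel" "\<And>y. y \<notin> noncrit i \<Longrightarrow> \<psi> y = 0"
  shows "(\<lambda>w. sheets i P \<psi> (glue i w x)) \<in> borel_measurable (lines_measure i)"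
  using measurable_compose[OF measurable_glue1 borel_measurable_sheets[OF assms]] .

text \<open>Integration against the surface measure, written down before the latter is known to be a
  measure; countable additivity is proved for this functional.\<close>

definition surface_sum :: "real \<Rightarrow> (real^'n \<Rightarrow> ennreal) \<Rightarrow> ennreal" where
  "surface_sum x \<phi> = (\<Sum>i\<in>UNIV. \<integral>\<^sup>+w. sheets i P (\<lambda>y. \<phi> y * area i y) (glue i w x) \<partial>lines_measure i)"

lemma surface_sum_suminf:
  assumes [measurable]: "\<And>k. \<phi> k \<in> borel_measurable borel"
  shows "surface_sum x (\<lambda>y. \<Sum>k. \<phi> k y) = (\<Sum>k. surface_sum x (\<phi> k))"
proof -
  have "(\<integral>\<^sup>+w. sheets i P (\<lambda>y. (\<Sum>k. \<phi> k y) * area i y) (glue i w x) \<partial>lines_measure i)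
      = (\<Sum>k. \<integral>\<^sup>+w. sheets i P (\<lambda>y. \<phi> k y * area i y) (glue i w x) \<partial>lines_measure i)" for i
    by (subst sheets_suminf[of _ "\<lambda>k y. \<phi> k y * area i y"], simp,
        rule nn_integral_suminf, rule borel_measurable_sheets_line) (auto simp: area_eq_0)
  then show ?thesis
    unfolding surface_sum_def by (simp only: suminf_sum[OF summableI])
qed

lemma sets_surface_measure [measurable_cong]: "sets (surface_measure G P x) = sets borel"
  unfolding surface_measure_def using sets.sets_measure_of_eq[of borel] by (simp only: space_borel)

text \<open>\<open>measure_of\<close> takes the prescribed values only if these form a measure, so
  positivity and countable additivity have to be verified. The latter is
  \<open>surface_sum_suminf\<close> applied to indicators of disjoint sets.\<close>

lemma emeasure_surface_measure:
  assumes "A \<in> sets borel"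
  shows "emeasure (surface_measure G P x) A = surface_sum x (indicator A)"
proof -
  let ?\<mu> = "\<lambda>A. \<Sum>i\<in>UNIV. \<integral>\<^sup>+u. (\<integral>\<^sup>+t.
        indicator (A \<inter> level_set G P x \<inter> {y. graph_coordinate P y = i}) (u + t *\<^sub>R axis i 1)
        * ennreal (graph_area_factor P i (u + t *\<^sub>R axis i 1))
      \<partial>count_space UNIV) \<partial>hyperplane_measure i"
  have \<mu>: "?\<mu> A = surface_sum x (indicator A)" if "A \<in> sets borel" for A
    unfolding surface_sum_def by (intro sum.cong refl sheet_integral_eq that)
  have "emeasure (surface_measure G P x) A = ?\<mu> A"
    unfolding surface_measure_def
  proof (rule emeasure_measure_of_sigma)
    show "sigma_algebra UNIV (sets borel)"
      using sets.sigma_algebra_axioms[of borel] by simp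
    show "positive (sets borel) ?\<mu>"
      by (simp add: positive_def)
    show "countably_additive (sets borel) ?\<mu>"
    proof (rule countably_additiveI)
      fix A :: "nat \<Rightarrow> (real^'n) set"
      assume A: "range A \<subseteq> sets borel" "disjoint_family A" "(\<Union>i. A i) \<in> sets borel"
      have [measurable]: "A k \<in> sets borel" for k using A(1) by blast
      have ind: "indicator (\<Union>k. A k) = (\<lambda>y. \<Sum>k. indicator (A k) y :: ennreal)"
        by (rule ext) (rule suminf_indicator[OF A(2), symmetric])
      show "(\<Sum>k. ?\<mu> (A k)) = ?\<mu> (\<Union>k. A k)"
        using A by (simp only: \<mu> ind surface_sum_suminf) (auto simp: \<mu> ind surface_sum_suminf)
    qed
  qed (rule assms)
  with \<mu>[OF assms] show ?thesis by simp
qed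

lemma nn_integral_surface_measure:
  assumes "\<phi> \<in> borel_measurable borel"
  shows "(\<integral>\<^sup>+y. \<phi> y \<partial>surface_measure G P x) = surface_sum x \<phi>"
  using assms
proof (induction rule: borel_measurable_induct)
  case (cong f g)
  then have "f = g" by auto
  with cong show ?case by simp
next
  case (set A)
  then show ?case
    by (subst nn_integral_indicator) (auto simp: emeasure_surface_measure sets_surface_measure)
next
  case (mult u c)
  note [measurable] = mult.hyps(2)
  have s: "sheets i P (\<lambda>y. c * u y * area i y) v = c * sheets i P (\<lambda>y. u y * area i y) v" for i v
    unfolding sheets_def by (subst nn_integral_cmult[symmetric]) (auto simp: ac_simps)
  have "surface_sum x (\<lambda>y. c * u y) = c * surface_sum x u"
    unfolding surface_sum_def s sum_distrib_left
    by (intro sum.cong refl nn_integral_cmult borel_measurable_sheets_line) (auto simp: area_eq_0)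
  with mult.IH show ?case
    by (subst nn_integral_cmult) auto
next
  case (add u v)
  note [measurable] = add.hyps
  have s: "sheets i P (\<lambda>y. (v y + u y) * area i y) z
    = sheets i P (\<lambda>y. v y * area i y) z + sheets i P (\<lambda>y. u y * area i y) z" for i z
    unfolding sheets_def by (subst nn_integral_add[symmetric]) (auto simp: distrib_left distrib_right)
  have "surface_sum x (\<lambda>y. v y + u y) = surface_sum x v + surface_sum x u"
    unfolding surface_sum_def s sum.distrib[symmetric]
    by (intro sum.cong refl nn_integral_add borel_measurable_sheets_line) (auto simp: area_eq_0)
  with add.IH show ?case
    by (subst nn_integral_add) auto
next
  case (seq U)
  note [measurable] = seq.hyps(1)
  have mono: "U k y \<le> U l y" if "k \<le> l" for k l y
    using seq.hyps(3) that by (auto simp: incseq_def le_fun_def)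
  have s: "sheets i P (\<lambda>y. (SUP k. U k y) * area i y) z = (SUP k. sheets i P (\<lambda>y. U k y * area i y) z)" for i z
    unfolding sheets_def
    by (subst nn_integral_monotone_convergence_SUP[symmetric])
      (auto simp: incseq_def le_fun_def SUP_mult_left_ennreal SUP_mult_right_ennreal
        intro!: mult_mono mono)
  have sm: "sheets i P (\<lambda>y. U k y * area i y) z \<le> sheets i P (\<lambda>y. U l y * area i y) z" if "k \<le> l" for i k l z
    unfolding sheets_def by (intro nn_integral_mono mult_mono mono that) auto
  have "surface_sum x (\<lambda>y. SUP k. U k y) = (SUP k. surface_sum x (U k))"
  proof -
    have "(\<integral>\<^sup>+w. (SUP k. sheets i P (\<lambda>y. U k y * area i y) (glue i w x)) \<partial>lines_measure i)
      = (SUP k. \<integral>\<^sup>+w. sheets i P (\<lambda>y. U k y * area i y) (glue i w x) \<partial>lines_measure i)" for i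
      by (rule nn_integral_monotone_convergence_SUP)
        (auto simp: incseq_def le_fun_def area_eq_0 intro!: sm borel_measurable_sheets_line)
    then show ?thesis
      unfolding surface_sum_def s
      by (subst ennreal_SUP_sum) (auto simp: incseq_def intro!: nn_integral_mono sm)
  qed
  moreover have "(\<integral>\<^sup>+y. (SUP k. U k y) \<partial>surface_measure G P x)
      = (SUP k. \<integral>\<^sup>+y. U k y \<partial>surface_measure G P x)"
    by (rule nn_integral_monotone_convergence_SUP) (auto intro: seq.hyps(3))
  ultimately show ?case
    using seq.IH by (simp add: image_comp SUP_apply[abs_def])
qed

end

lemma sheets_mono: "(\<And>y. \<psi> y \<le> \<phi> y) \<Longrightarrow> sheets i P \<psi> v \<le> sheets i P \<phi> v"
  unfolding sheets_def by (intro nn_integral_mono mult_left_mono) auto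

lemma sheets_sum:
  "sheets i P (\<lambda>y. \<Sum>d\<in>D. \<phi> d y) v = (\<Sum>d\<in>D. sheets i P (\<phi> d) v)"
  unfolding sheets_def by (subst nn_integral_sum[symmetric]) (auto simp: sum_distrib_left)

context smooth_levels
begin

subsection \<open>The level measure and the coarea formula\<close>

text \<open>The graph area factor divided by the norm of the gradient. By
  \<open>norm_gradient_eq\<close> the square roots cancel, and what remains is the reciprocal of the
  absolute Jacobian of \<open>flatten i\<close>.\<close>

definition chart_weight :: "'n \<Rightarrow> real^'n \<Rightarrow> ennreal" where
  "chart_weight i y = indicator (chart i) y * ennreal (1 / \<bar>dP i y\<bar>)"

lemma borel_measurable_chart_weight [measurable]: "chart_weight i \<in> borel_measurable borel"
proof -
  have "chart_weight i = (\<lambda>y. indicator (chart i) y * ennreal (1 / \<bar>indicator G y *\<^sub>R dP i y\<bar>))"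
    by (auto simp: fun_eq_iff chart_weight_def chart_def split: split_indicator)
  also have "\<dots> \<in> borel_measurable borel"
    by measurable
  finally show ?thesis .
qed

lemma chart_weight_eq_0: "y \<notin> noncrit i \<Longrightarrow> chart_weight i y = 0"
  using chart_subset by (auto simp: chart_weight_def indicator_eq_0_iff)

lemma norm_gradient: "norm (gradient P y) = sqrt (\<Sum>j\<in>UNIV. (dP j y)\<^sup>2)"
  by (simp add: norm_vec_def L2_set_def gradient_def)

lemma norm_gradient_eq:
  assumes "dP i y \<noteq> 0"
  shows "norm (gradient P y) = \<bar>dP i y\<bar> * graph_area_factor P i y"
proof -
  have "(\<Sum>j\<in>UNIV. (dP j y)\<^sup>2) = (dP i y)\<^sup>2 + (\<Sum>j\<in>UNIV - {i}. (dP j y)\<^sup>2)"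
    by (rule sum.remove) auto
  also have "\<dots> = (dP i y)\<^sup>2 * (1 + (\<Sum>j\<in>UNIV - {i}. (dP j y / dP i y)\<^sup>2))"
    using assms by (simp add: distrib_left sum_distrib_left power_divide)
  finally show ?thesis
    by (simp add: norm_gradient graph_area_factor_def real_sqrt_mult)
qed

definition level_sum :: "real \<Rightarrow> (real^'n \<Rightarrow> ennreal) \<Rightarrow> ennreal" where
  "level_sum x \<phi> = (\<Sum>i\<in>UNIV. \<integral>\<^sup>+w. sheets i P (\<lambda>y. \<phi> y * chart_weight i y) (glue i w x) \<partial>lines_measure i)"

lemma sets_level_measure [measurable_cong]: "sets (level_measure G P x) = sets borel"
  by (simp add: level_measure_def sets_surface_measure)

lemma nn_integral_level_measure:
  assumes [measurable]: "\<phi> \<in> borel_measurable borel"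
  shows "(\<integral>\<^sup>+y. \<phi> y \<partial>level_measure G P x) = level_sum x \<phi>"
proof -
  define d where "d y = ennreal (indicator G y / norm (gradient P y))" for y
  have "d = (\<lambda>y. ennreal (indicator G y / sqrt (\<Sum>j\<in>UNIV. (indicator G y *\<^sub>R dP j y)\<^sup>2)))"
    by (auto simp: fun_eq_iff d_def norm_gradient split: split_indicator)
  also have "\<dots> \<in> borel_measurable borel"
    by measurable
  finally have [measurable]: "d \<in> borel_measurable borel" .
  have "(\<integral>\<^sup>+y. \<phi> y \<partial>level_measure G P x) = (\<integral>\<^sup>+y. d y * \<phi> y \<partial>surface_measure G P x)"
    unfolding level_measure_def d_def[symmetric] by (rule nn_integral_density) auto
  also have "\<dots> = surface_sum x (\<lambda>y. d y * \<phi> y)"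
    by (rule nn_integral_surface_measure) measurable
  also have "\<dots> = level_sum x \<phi>"
  proof -
    have "d y * area i y = chart_weight i y" for i y
    proof (cases "y \<in> chart i")
      case True
      then have nz: "dP i y \<noteq> 0" and "y \<in> G"
        using chart_subset by (auto simp: noncrit_def)
      have "graph_area_factor P i y > 0"
        unfolding graph_area_factor_def by (auto intro!: add_pos_nonneg sum_nonneg)
      then have "d y * area i y = ennreal (1 / norm (gradient P y) * graph_area_factor P i y)"
        using True \<open>y \<in> G\<close> by (simp add: d_def area_def ennreal_mult[symmetric])
      also have "1 / norm (gradient P y) * graph_area_factor P i y = 1 / \<bar>dP i y\<bar>"
        using nz \<open>graph_area_factor P i y > 0\<close> by (simp add: norm_gradient_eq[OF nz])
      finally show ?thesis using True by (simp add: chart_weight_def)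
    qed (simp add: area_def chart_weight_def)
    then have "d y * \<phi> y * area i y = \<phi> y * chart_weight i y" for i y
      by (metis mult.assoc mult.commute)
    then show ?thesis
      by (simp only: surface_sum_def level_sum_def)
  qed
  finally show ?thesis .
qed

lemma borel_measurable_level_sum_chart:
  assumes [measurable]: "\<phi> \<in> borel_measurable borel"
  shows "(\<lambda>x. \<integral>\<^sup>+w. sheets i P (\<lambda>y. \<phi> y * chart_weight i y) (glue i w x) \<partial>lines_measure i)
    \<in> borel_measurable borel"
proof -
  interpret L: sigma_finite_measure "lines_measure i" by (rule sigma_finite_lines_measure)
  have [measurable]: "sheets i P (\<lambda>y. \<phi> y * chart_weight i y) \<in> borel_measurable borel"
    by (rule borel_measurable_sheets) (auto simp: chart_weight_eq_0)
  have "(\<lambda>p. glue i (snd p) (fst p)) \<in> borel_measurable (borel \<Otimes>\<^sub>M lines_measure i)"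
    using measurable_compose[OF measurable_pair_swap' measurable_glue[of i]]
    by (simp add: case_prod_beta')
  from measurable_compose[OF this, of "sheets i P (\<lambda>y. \<phi> y * chart_weight i y)"]
  show ?thesis
    by (intro L.borel_measurable_nn_integral) (simp add: case_prod_beta')
qed

lemma borel_measurable_level_sum [measurable]:
  assumes "\<phi> \<in> borel_measurable borel"
  shows "(\<lambda>x. level_sum x \<phi>) \<in> borel_measurable borel"
  unfolding level_sum_def
  by (intro borel_measurable_sum borel_measurable_level_sum_chart assms)

text \<open>By Tonelli's theorem the integrals over the level and over the hyperplane combine to one
  over the flattened space. There the factor \<open>\<bar>dP i y\<bar>\<close> of
  \<open>nn_integral_sheets\<close> cancels the chart weight, and the charts partition G.\<close>

lemma coarea_nn:
  assumes [measurable]: "\<phi> \<in> borel_measurable borel"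
  shows "(\<integral>\<^sup>+x. level_sum x \<phi> \<partial>lborel) = (\<integral>\<^sup>+y. \<phi> y * indicator G y \<partial>lborel)"
proof -
  have "(\<integral>\<^sup>+x. level_sum x \<phi> \<partial>lborel)
      = (\<Sum>i\<in>UNIV. \<integral>\<^sup>+x. \<integral>\<^sup>+w. sheets i P (\<lambda>y. \<phi> y * chart_weight i y) (glue i w x)
          \<partial>lines_measure i \<partial>lborel)"
    unfolding level_sum_def
    by (rule nn_integral_sum) (simp add: borel_measurable_level_sum_chart)
  also have "\<dots> = (\<Sum>i\<in>UNIV. \<integral>\<^sup>+v. sheets i P (\<lambda>y. \<phi> y * chart_weight i y) v \<partial>lborel)"
    by (intro sum.cong refl nn_integral_glue_swap[symmetric] borel_measurable_sheets)
      (auto simp: chart_weight_eq_0)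
  also have "\<dots> = (\<Sum>i\<in>UNIV. \<integral>\<^sup>+y. \<phi> y * chart_weight i y * ennreal \<bar>dP i y\<bar> \<partial>lborel)"
    by (intro sum.cong refl nn_integral_sheets) (auto simp: chart_weight_eq_0)
  also have "\<dots> = (\<Sum>i\<in>UNIV. \<integral>\<^sup>+y. \<phi> y * indicator (chart i) y \<partial>lborel)"
  proof (intro sum.cong refl nn_integral_cong)
    fix i y
    have "chart_weight i y * ennreal \<bar>dP i y\<bar> = indicator (chart i) y"
    proof (cases "y \<in> chart i")
      case True
      then have "dP i y \<noteq> 0" using chart_subset by (auto simp: noncrit_def)
      with True show ?thesis
        by (simp add: chart_weight_def ennreal_mult[symmetric])
    qed (simp add: chart_weight_def)
    then show "\<phi> y * chart_weight i y * ennreal \<bar>dP i y\<bar> = \<phi> y * indicator (chart i) y"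
      by (simp add: mult.assoc)
  qed
  also have "\<dots> = (\<integral>\<^sup>+y. \<phi> y * indicator G y \<partial>lborel)"
    by (subst nn_integral_sum[symmetric])
      (auto simp: sum_distrib_left[symmetric] sum_indicator_chart)
  finally show ?thesis .
qed

text \<open>The part of C that belongs to coordinate i is covered by finitely many boxes on which
  \<open>\<partial>\<^sub>iP\<close> has no zeros, and \<open>|\<partial>\<^sub>iP|\<close> has a
  positive lower bound c on that part. In each box a level is a graph, so its contribution is at
  most the volume of the projected box divided by c, whatever x is.\<close>

lemma level_sum_bounded:
  assumes C: "compact C" "C \<subseteq> G"
  shows "\<exists>M<top. \<forall>x. level_sum x (indicator C) \<le> M"
proof -
  have "\<exists>M<top. \<forall>x. (\<integral>\<^sup>+w. sheets i P (\<lambda>y. indicator C y * chart_weight i y) (glue i w x) \<partial>lines_measure i) \<le> M"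
    for i
  proof -
    \<comment> \<open>Unlike \<open>chart i\<close>, this set retains the points where several
      partial derivatives tie for the maximum; that makes it closed, hence compact.\<close>
    define Ci where "Ci = {y \<in> C. \<forall>j. \<bar>dP j y\<bar> \<le> \<bar>dP i y\<bar>}"
    have cont: "continuous_on C (dP j)" for j
      by (rule continuous_on_subset[OF continuous_partial_P C(2)])
    have "Ci = (\<Inter>j. {y \<in> C. \<bar>dP j y\<bar> \<le> \<bar>dP i y\<bar>})"
      by (auto simp: Ci_def)
    moreover have "closed {y \<in> C. \<bar>dP j y\<bar> \<le> \<bar>dP i y\<bar>}" for j
    proof -
      have "closed (C \<inter> (\<lambda>y. \<bar>dP i y\<bar> - \<bar>dP j y\<bar>) -` {0..})"
        using C(1) by (intro continuous_closed_preimage continuous_intros cont compact_imp_closed) auto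
      also have "C \<inter> (\<lambda>y. \<bar>dP i y\<bar> - \<bar>dP j y\<bar>) -` {0..} = {y \<in> C. \<bar>dP j y\<bar> \<le> \<bar>dP i y\<bar>}"
        by auto
      finally show ?thesis .
    qed
    ultimately have "closed Ci" by auto
    then have compact: "compact Ci"
      using compact_Int_closed[OF C(1), of Ci] by (simp add: Ci_def Int_def conj_ac)
    have sub: "Ci \<subseteq> noncrit i"
      using max_partial_nonzero C(2) by (auto simp: Ci_def noncrit_def)
    obtain c where c: "c > 0" "\<And>y. y \<in> Ci \<Longrightarrow> c \<le> \<bar>dP i y\<bar>"
    proof (cases "Ci = {}")
      case True
      then show ?thesis using that[of 1] by simp
    next
      case False
      have "continuous_on Ci (\<lambda>y. \<bar>dP i y\<bar>)"
        using sub noncrit_subset by (intro continuous_intros continuous_on_subset[OF continuous_partial_P]) blast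
      from continuous_attains_inf[OF compact False this]
      obtain y where "y \<in> Ci" "\<forall>z\<in>Ci. \<bar>dP i y\<bar> \<le> \<bar>dP i z\<bar>" by blast
      with that[of "\<bar>dP i y\<bar>"] sub show ?thesis by (auto simp: noncrit_def)
    qed
    define BB where "BB = {(a, b). cbox a b \<subseteq> noncrit i}"
    have "\<exists>d\<in>BB. y \<in> (case d of (a, b) \<Rightarrow> box a b)" if y: "y \<in> Ci" for y
    proof -
      from y sub have "y \<in> noncrit i" by blast
      from open_contains_cbox[OF open_noncrit this] obtain a b
        where "cbox a b \<subseteq> noncrit i" "y \<in> box a b" by metis
      then show ?thesis by (auto simp: BB_def)
    qed
    then have "Ci \<subseteq> (\<Union>d\<in>BB. case d of (a, b) \<Rightarrow> box a b)" by blast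
    moreover have "open (case d of (a, b) \<Rightarrow> box a b)" for d :: "(real^'n) \<times> (real^'n)"
      by (cases d) (simp add: open_box)
    ultimately obtain D where D: "D \<subseteq> BB" "finite D" "Ci \<subseteq> (\<Union>d\<in>D. case d of (a, b) \<Rightarrow> box a b)"
      using compactE_image[OF compact, of BB "\<lambda>d. case d of (a, b) \<Rightarrow> box a b"] by metis
    define V where "V d = (case d of (a, b) \<Rightarrow> \<Pi>\<^sub>E j\<in>UNIV - {i}. {a $ j..b $ j})"
      for d :: "(real^'n) \<times> (real^'n)"
    define \<phi> where "\<phi> d y = indicator (case d of (a, b) \<Rightarrow> cbox a b) y * ennreal (1 / c)"
      for d :: "(real^'n) \<times> (real^'n)" and y
    have V_meas: "V d \<in> sets (lines_measure i)" for d
      by (cases d) (auto simp: V_def intro!: sets_PiM_I_finite)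
    have V_fin: "emeasure (lines_measure i) (V d) < top" for d
    proof -
      interpret product_sigma_finite "\<lambda>_::'n. lborel :: real measure"
        by standard
      obtain a b where d: "d = (a, b)" by (cases d)
      have "emeasure (lines_measure i) (V d) = (\<Prod>j\<in>UNIV - {i}. emeasure lborel {a $ j..b $ j})"
        unfolding V_def d by (simp, subst emeasure_PiM) auto
      also have "\<dots> < top"
        by (simp add: less_top[symmetric] ennreal_prod_eq_top emeasure_lborel_Icc_eq)
      finally show ?thesis .
    qed
    have le: "indicator C y * chart_weight i y \<le> (\<Sum>d\<in>D. \<phi> d y)" for y
    proof (cases "y \<in> C \<and> y \<in> chart i")
      case True
      then have y: "y \<in> Ci" using chart_max by (auto simp: Ci_def)
      then obtain d where d: "d \<in> D" "y \<in> (case d of (a, b) \<Rightarrow> box a b)" using D(3) by blast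
      then have "y \<in> (case d of (a, b) \<Rightarrow> cbox a b)"
        using box_subset_cbox by (cases d) auto
      then have "\<phi> d y = ennreal (1 / c)" by (simp add: \<phi>_def)
      moreover have "1 / \<bar>dP i y\<bar> \<le> 1 / c"
        using c(1) c(2)[OF y] by (intro frac_le) auto
      moreover have "\<phi> d y \<le> (\<Sum>d\<in>D. \<phi> d y)"
        using D(2) d(1) by (intro member_le_sum) auto
      ultimately show ?thesis
        using True by (simp add: chart_weight_def) (metis ennreal_leI order_trans)
    qed (auto simp: chart_weight_def)
    have "(\<integral>\<^sup>+w. sheets i P (\<lambda>y. indicator C y * chart_weight i y) (glue i w x) \<partial>lines_measure i)
      \<le> (\<Sum>d\<in>D. ennreal (1 / c) * emeasure (lines_measure i) (V d))" for x
    proof -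
      have bound: "sheets i P (\<phi> d) (glue i w x) \<le> ennreal (1 / c) * indicator (V d) w"
        if "d \<in> D" "w \<in> space (lines_measure i)" for d w
      proof -
        obtain a b where d: "d = (a, b)" by (cases d)
        have ab: "cbox a b \<subseteq> noncrit i" using that(1) D(1) d by (auto simp: BB_def)
        have z: "\<phi> d y = 0" if "y \<notin> cbox a b" for y
          using that by (simp add: \<phi>_def d)
        show ?thesis
        proof (cases "glue i w x \<in> flatten i ` cbox a b")
          case True
          then obtain y where y: "y \<in> cbox a b" "glue i w x = flatten i y" by blast
          have "w j = y $ j" if "j \<noteq> i" for j
            using arg_cong[OF y(2), of "\<lambda>v. v $ j"] that by simp
          then have "w \<in> V d"
            using that(2) y(1) by (auto simp: V_def d space_PiM PiE_iff mem_box_cart)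
          then show ?thesis
            by (subst sheets_box[OF ab z]) (auto simp: \<phi>_def split: split_indicator)
        next
          case False
          then show ?thesis by (subst sheets_box[OF ab z]) simp_all
        qed
      qed
      have "(\<integral>\<^sup>+w. sheets i P (\<lambda>y. indicator C y * chart_weight i y) (glue i w x) \<partial>lines_measure i)
        \<le> (\<integral>\<^sup>+w. (\<Sum>d\<in>D. ennreal (1 / c) * indicator (V d) w) \<partial>lines_measure i)"
      proof (rule nn_integral_mono)
        fix w assume w: "w \<in> space (lines_measure i)"
        have "sheets i P (\<lambda>y. indicator C y * chart_weight i y) (glue i w x)
          \<le> sheets i P (\<lambda>y. \<Sum>d\<in>D. \<phi> d y) (glue i w x)"
          by (rule sheets_mono[OF le])
        also have "\<dots> \<le> (\<Sum>d\<in>D. ennreal (1 / c) * indicator (V d) w)"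
          unfolding sheets_sum by (intro sum_mono bound w)
        finally show "sheets i P (\<lambda>y. indicator C y * chart_weight i y) (glue i w x)
          \<le> (\<Sum>d\<in>D. ennreal (1 / c) * indicator (V d) w)" .
      qed
      also have "\<dots> = (\<Sum>d\<in>D. ennreal (1 / c) * emeasure (lines_measure i) (V d))"
        using V_meas by (subst nn_integral_sum) (auto simp: nn_integral_cmult_indicator)
      finally show ?thesis .
    qed
    moreover have "(\<Sum>d\<in>D. ennreal (1 / c) * emeasure (lines_measure i) (V d)) < top"
      using D(2) V_fin by (simp add: less_top[symmetric] ennreal_mult_eq_top_iff)
    ultimately show ?thesis by blast
  qed
  then obtain M where M: "\<And>i. M i < top"
    "\<And>i x. (\<integral>\<^sup>+w. sheets i P (\<lambda>y. indicator C y * chart_weight i y) (glue i w x) \<partial>lines_measure i) \<le> M i"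
    by metis
  have "level_sum x (indicator C) \<le> (\<Sum>i\<in>UNIV. M i)" for x
    unfolding level_sum_def by (intro sum_mono M)
  moreover have "(\<Sum>i\<in>UNIV. M i) < top"
    using M(1) by (simp add: less_top)
  ultimately show ?thesis by blast
qed

end

section \<open>Integrals over compact subsets\<close>

text \<open>The power -1/2 is an integrable singularity that dominates the logarithm near x.\<close>

lemma nn_integral_inverse_sqrt_finite:
  fixes R :: real
  shows "(\<integral>\<^sup>+\<omega>. ennreal (\<bar>x - \<omega>\<bar> powr (-1/2)) * indicator {-R..R} \<omega> \<partial>lborel) < \<infinity>"
proof -
  define c where "c = \<bar>x\<bar> + \<bar>R\<bar>"
  \<comment> \<open>One half of the singularity, cut off at c, which bounds
    \<open>\<bar>x - \<omega>\<bar>\<close> for \<open>\<bar>\<omega>\<bar> \<le> R\<close>. The two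
    sides of x are covered by \<open>h (x - \<omega>)\<close> and its mirror image.\<close>
  define h where "h s = (if s \<in> {0..c} then s powr (-1/2) else 0)" for s :: real
  have [measurable]: "h \<in> borel_measurable borel"
    unfolding h_def by measurable
  have "(\<lambda>s. s powr (-1/2)) integrable_on {0..c}"
    by (rule integrable_on_powr_from_0) (auto simp: c_def)
  then obtain J where J: "((\<lambda>s. s powr (-1/2)) has_integral J) {0..c}"
    unfolding integrable_on_def by blast
  then have "(h has_integral J) UNIV"
    unfolding h_def by (subst has_integral_restrict_UNIV)
  from nn_integral_has_integral_lborel[OF _ _ this]
  have hJ: "(\<integral>\<^sup>+s. ennreal (h s) \<partial>lborel) = ennreal J"
    by (auto simp: h_def)
  have "(\<integral>\<^sup>+s. ennreal (h (x - s)) \<partial>lborel) = ennreal J"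
    using nn_integral_real_affine[of "\<lambda>s. ennreal (h s)" "-1" x] hJ by simp
  moreover have "(\<integral>\<^sup>+s. ennreal (h (s - x)) \<partial>lborel) = ennreal J"
    using nn_integral_real_affine[of "\<lambda>s. ennreal (h s)" 1 "- x"] hJ by (simp add: add.commute)
  ultimately have "(\<integral>\<^sup>+s. ennreal (h (x - s)) + ennreal (h (s - x)) \<partial>lborel) = ennreal J + ennreal J"
    by (subst nn_integral_add) auto
  moreover have "(\<integral>\<^sup>+\<omega>. ennreal (\<bar>x - \<omega>\<bar> powr (-1/2)) * indicator {-R..R} \<omega> \<partial>lborel)
    \<le> (\<integral>\<^sup>+s. ennreal (h (x - s)) + ennreal (h (s - x)) \<partial>lborel)"
  proof (rule nn_integral_mono)
    fix \<omega>
    show "ennreal (\<bar>x - \<omega>\<bar> powr (-1/2)) * indicator {-R..R} \<omega> \<le> ennreal (h (x - \<omega>)) + ennreal (h (\<omega> - x))"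
    proof (cases "\<omega> \<in> {-R..R}")
      case True
      then have "\<bar>x - \<omega>\<bar> \<in> {0..c}" by (auto simp: c_def)
      then have "\<bar>x - \<omega>\<bar> powr (-1/2) \<le> h (x - \<omega>) + h (\<omega> - x)"
        by (cases "\<omega> \<le> x") (auto simp: h_def)
      then show ?thesis
        using True by (subst ennreal_plus[symmetric]) (auto simp: h_def)
    qed simp
  qed
  moreover have "ennreal J + ennreal J < \<infinity>" by simp
  ultimately show ?thesis
    by (metis le_less_trans)
qed

text \<open>The inequality \<open>ln t \<le> t - 1\<close> is used twice: with
  \<open>t = \<bar>s\<bar> powr (-1/2)\<close> for small arguments, with
  \<open>t = \<bar>s\<bar>\<close> for large ones. At \<open>s = 0\<close> both sides are 0 by
  convention.\<close>

lemma abs_ln_abs_le: "\<bar>ln \<bar>s\<bar>\<bar> \<le> 2 * \<bar>s\<bar> powr (-1/2) + \<bar>s\<bar>" for s :: real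
proof (cases "s = 0")
  case False
  then have pos: "\<bar>s\<bar> > 0" by simp
  have "ln (\<bar>s\<bar> powr (-1/2)) \<le> \<bar>s\<bar> powr (-1/2) - 1"
    using pos by (intro ln_le_minus_one) simp
  then have "- ln \<bar>s\<bar> \<le> 2 * \<bar>s\<bar> powr (-1/2)"
    using pos by (simp add: ln_powr)
  moreover have "ln \<bar>s\<bar> \<le> \<bar>s\<bar> - 1"
    using pos by (rule ln_le_minus_one)
  moreover have "0 \<le> \<bar>s\<bar> powr (-1/2)" by simp
  ultimately show ?thesis by linarith
qed simp

context smooth_levels
begin

text \<open>A class wider than the test functions: it also admits products with discontinuous
  functions of P, such as the truncated kernels of the principal value.\<close>

definition compactly_bounded :: "(real^'n \<Rightarrow> 'b::real_normed_vector) \<Rightarrow> bool" where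
  "compactly_bounded F \<longleftrightarrow> F \<in> borel_measurable borel \<and>
    (\<exists>C B. compact C \<and> C \<subseteq> G \<and> (\<forall>y. norm (F y) \<le> B * indicator C y))"

lemma compactly_boundedE:
  assumes "compactly_bounded F"
  obtains C B where "compact C" "C \<subseteq> G" "\<And>y. norm (F y) \<le> B * indicator C y" "B \<ge> 0"
proof -
  obtain C B where CB: "compact C" "C \<subseteq> G" "\<And>y. norm (F y) \<le> B * indicator C y"
    using assms unfolding compactly_bounded_def by blast
  have "norm (F y) \<le> \<bar>B\<bar> * indicator C y" for y
    using CB(3)[of y] by (auto split: split_indicator)
  with CB(1,2) show ?thesis using that[of C "\<bar>B\<bar>"] by simp
qed

lemma compactly_bounded_measurable [measurable_dest]:
  "compactly_bounded F \<Longrightarrow> F \<in> borel_measurable borel"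
  by (simp add: compactly_bounded_def)

lemma compactly_boundedI:
  assumes "F \<in> borel_measurable borel" "compact C" "C \<subseteq> G"
    "\<And>y. y \<notin> C \<Longrightarrow> F y = 0" "\<And>y. y \<in> C \<Longrightarrow> norm (F y) \<le> B"
  shows "compactly_bounded F"
proof -
  have "norm (F y) \<le> B * indicator C y" for y
    using assms(4,5)[of y] by (cases "y \<in> C") auto
  with assms(1-3) show ?thesis unfolding compactly_bounded_def by blast
qed

lemma compactly_bounded_mono:
  assumes "compactly_bounded F" "H \<in> borel_measurable borel" "\<And>y. norm (H y) \<le> norm (F y)"
  shows "compactly_bounded H"
  using assms unfolding compactly_bounded_def by (meson order_trans)

lemma compactly_bounded_test:
  assumes "F \<in> test_functions G"
  shows "compactly_bounded F"
proof -
  have cont: "continuous_on UNIV F"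
    by (rule smooth_on_open_continuous_on[OF test_functions_smooth[OF assms]])
  have "compact (F ` supp F)"
    using cont by (intro compact_continuous_image test_functions_support[OF assms])
      (rule continuous_on_subset, auto)
  then obtain B where "\<And>z. z \<in> F ` supp F \<Longrightarrow> norm z \<le> B"
    using compact_imp_bounded bounded_iff by metis
  then show ?thesis
    by (intro compactly_boundedI[OF borel_measurable_continuous_onI[OF cont]
          test_functions_support[OF assms]]) (auto intro: notin_supp)
qed

lemma compactly_bounded_times_P:
  fixes F :: "real^'n \<Rightarrow> complex" and q :: "real \<Rightarrow> complex"
  assumes F: "compactly_bounded F" and [measurable]: "q \<in> borel_measurable borel"
    and bd: "\<And>S. compact S \<Longrightarrow> bounded (q ` S)"
  shows "compactly_bounded (\<lambda>y. F y * q (P y))"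
proof -
  obtain C B where C: "compact C" "C \<subseteq> G" "\<And>y. norm (F y) \<le> B * indicator C y" "B \<ge> 0"
    using compactly_boundedE[OF F] by metis
  have zero: "F y = 0" if "y \<notin> C" for y
    using C(3)[of y] that by simp
  have [measurable]: "F \<in> borel_measurable borel"
    by (rule compactly_bounded_measurable[OF F])
  have [measurable]: "(\<lambda>y. indicator G y *\<^sub>R P y) \<in> borel_measurable borel"
    by (rule borel_measurable_indicator_G[OF continuous_P])
  have "compact (P ` C)"
    by (intro compact_continuous_image C continuous_on_subset[OF continuous_P])
  from bd[OF this] obtain B' where B': "\<And>\<omega>. \<omega> \<in> P ` C \<Longrightarrow> norm (q \<omega>) \<le> B'"
    unfolding bounded_iff by auto
  show ?thesis
  proof (rule compactly_boundedI[OF _ C(1,2), of _ "B * B'"])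
    have "(\<lambda>y. F y * q (indicator G y *\<^sub>R P y)) \<in> borel_measurable borel"
      by measurable
    also have "(\<lambda>y. F y * q (indicator G y *\<^sub>R P y)) = (\<lambda>y. F y * q (P y))"
      using zero C(2) by (auto simp: fun_eq_iff split: split_indicator)
    finally show "(\<lambda>y. F y * q (P y)) \<in> borel_measurable borel" .
    show "norm (F y * q (P y)) \<le> B * B'" if "y \<in> C" for y
      unfolding norm_mult using C(3)[of y] C(4) B' that by (intro mult_mono) auto
  qed (simp add: zero)
qed

text \<open>By the coarea formula the left side is an integral of q against the density of the level
  measures, which is bounded on a compact set. Integrability of a singular function of P is thus
  reduced to one real variable; R bounds P on the support of F.\<close>

lemma nn_integral_times_P:
  fixes F :: "real^'n \<Rightarrow> 'b::real_normed_vector" and q :: "real \<Rightarrow> ennreal"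
  assumes F: "compactly_bounded F" and [measurable]: "q \<in> borel_measurable borel"
  shows "\<exists>M R. M < top \<and> (\<integral>\<^sup>+y. ennreal (norm (F y)) * q (P y) \<partial>lborel)
    \<le> M * (\<integral>\<^sup>+\<omega>. q \<omega> * indicator {-R..R} \<omega> \<partial>lborel)"
proof -
  obtain C B where C: "compact C" "C \<subseteq> G" "\<And>y. norm (F y) \<le> B * indicator C y" "B \<ge> 0"
    using compactly_boundedE[OF F] by metis
  obtain M where M: "M < top" "\<And>x. level_sum x (indicator C) \<le> M"
    using level_sum_bounded[OF C(1,2)] by blast
  have "compact (P ` C)"
    by (intro compact_continuous_image C continuous_on_subset[OF continuous_P])
  then obtain R where R: "\<And>\<omega>. \<omega> \<in> P ` C \<Longrightarrow> \<bar>\<omega>\<bar> \<le> R"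
    using compact_imp_bounded[of "P ` C"] unfolding bounded_iff real_norm_def by blast
  define q' where "q' \<omega> = q \<omega> * indicator {-R..R} \<omega>" for \<omega>
  have [measurable]: "q' \<in> borel_measurable borel"
    unfolding q'_def by measurable
  have [measurable]: "C \<in> sets borel" using C(1) by (rule borel_compact)
  \<comment> \<open>P is known to be continuous on G only; cut off there it is Borel on the whole
    space and unchanged on C.\<close>
  define Q where "Q y = indicator G y *\<^sub>R P y" for y
  have [measurable]: "Q \<in> borel_measurable borel"
    unfolding Q_def by (rule borel_measurable_indicator_G[OF continuous_P])
  have Q: "Q y = P y" if "y \<in> C" for y
    using that C(2) by (auto simp: Q_def)
  define \<phi> where "\<phi> y = indicator C y * q' (Q y)" for y
  have [measurable]: "\<phi> \<in> borel_measurable borel"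
    unfolding \<phi>_def by measurable
  have "(\<integral>\<^sup>+y. ennreal (norm (F y)) * q (P y) \<partial>lborel) \<le> (\<integral>\<^sup>+y. ennreal B * (\<phi> y * indicator G y) \<partial>lborel)"
  proof (rule nn_integral_mono)
    fix y
    show "ennreal (norm (F y)) * q (P y) \<le> ennreal B * (\<phi> y * indicator G y)"
    proof (cases "y \<in> C")
      case True
      then have "q' (P y) = q (P y)"
        using R[of "P y"] by (auto simp: q'_def abs_le_iff split: split_indicator)
      then show ?thesis
        using True C(3)[of y] subsetD[OF C(2) True]
        by (simp add: \<phi>_def Q mult_right_mono ennreal_leI)
    next
      case False
      then show ?thesis using C(3)[of y] by (simp add: \<phi>_def)
    qed
  qed
  also have "\<dots> = ennreal B * (\<integral>\<^sup>+x. level_sum x \<phi> \<partial>lborel)"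
    by (subst nn_integral_cmult) (auto simp: coarea_nn)
  also have "\<dots> \<le> ennreal B * (\<integral>\<^sup>+x. M * q' x \<partial>lborel)"
  proof (intro mult_left_mono nn_integral_mono)
    fix x
    have "sheets i P (\<lambda>y. \<phi> y * chart_weight i y) (glue i w x)
      \<le> q' x * sheets i P (\<lambda>y. indicator C y * chart_weight i y) (glue i w x)" for i w
    proof -
      have "sheets i P (\<lambda>y. \<phi> y * chart_weight i y) (glue i w x)
        \<le> (\<integral>\<^sup>+t. q' x * (indicator {t. P (glue i w t) = x} t
          * (indicator C (glue i w t) * chart_weight i (glue i w t))) \<partial>count_space UNIV)"
        unfolding sheets_glue
        by (intro nn_integral_mono) (auto simp: \<phi>_def Q ac_simps split: split_indicator)
      also have "\<dots> = q' x * sheets i P (\<lambda>y. indicator C y * chart_weight i y) (glue i w x)"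
        unfolding sheets_glue by (rule nn_integral_cmult) simp
      finally show ?thesis .
    qed
    then have "level_sum x \<phi> \<le> (\<Sum>i\<in>UNIV. \<integral>\<^sup>+w. q' x *
      sheets i P (\<lambda>y. indicator C y * chart_weight i y) (glue i w x) \<partial>lines_measure i)"
      unfolding level_sum_def by (intro sum_mono nn_integral_mono)
    also have "\<dots> = q' x * level_sum x (indicator C)"
      unfolding level_sum_def sum_distrib_left
      by (intro sum.cong refl nn_integral_cmult borel_measurable_sheets_line)
        (auto simp: chart_weight_eq_0)
    also have "\<dots> \<le> M * q' x"
      using mult_left_mono[OF M(2)[of x], of "q' x"] by (simp add: mult.commute)
    finally show "level_sum x \<phi> \<le> M * q' x" .
  qed simp
  also have "\<dots> = (ennreal B * M) * (\<integral>\<^sup>+\<omega>. q \<omega> * indicator {-R..R} \<omega> \<partial>lborel)"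
    by (subst nn_integral_cmult) (auto simp: q'_def[abs_def] mult.assoc)
  finally show ?thesis
    using M(1) by (intro exI[of _ "ennreal B * M"] exI[of _ R]) (simp add: ennreal_mult_less_top)
qed

text \<open>The estimate \<open>nn_integral_times_P\<close> with \<open>q = indicator {x}\<close>: a
  point is a null set on the axis of values. Pointwise limits may therefore disregard the
  singularity at \<open>P y = x\<close>.\<close>

lemma AE_level_null:
  fixes F :: "real^'n \<Rightarrow> 'b::real_normed_vector"
  assumes F: "compactly_bounded F"
  shows "AE y in lborel. F y \<noteq> 0 \<longrightarrow> P y \<noteq> x"
proof -
  obtain C B where C: "compact C" "C \<subseteq> G" "\<And>y. norm (F y) \<le> B * indicator C y" "B \<ge> 0"
    using compactly_boundedE[OF F] by metis
  have [measurable]: "C \<in> sets borel" using C(1) by (rule borel_compact)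
  define Q where "Q y = indicator G y *\<^sub>R P y" for y
  have [measurable]: "Q \<in> borel_measurable borel"
    unfolding Q_def by (rule borel_measurable_indicator_G[OF continuous_P])
  have Q: "Q y = P y" if "y \<in> C" for y
    using that C(2) by (auto simp: Q_def)
  have cb: "compactly_bounded (indicator C :: _ \<Rightarrow> real)"
    using C(1,2) by (intro compactly_boundedI[OF _ C(1,2), of _ 1]) auto
  obtain M R where M: "M < top" "(\<integral>\<^sup>+y. ennreal (norm (indicator C y :: real)) * indicator {x} (P y) \<partial>lborel)
    \<le> M * (\<integral>\<^sup>+\<omega>. indicator {x} \<omega> * indicator {-R..R} \<omega> \<partial>lborel)"
    using nn_integral_times_P[OF cb, of "indicator {x}"] by auto
  have "AE \<omega> in lborel. (indicator {x} \<omega> * indicator {-R..R} \<omega> :: ennreal) = 0"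
    using AE_lborel_singleton[of x] by eventually_elim auto
  then have "(\<integral>\<^sup>+\<omega>. indicator {x} \<omega> * indicator {-R..R} \<omega> \<partial>lborel) = 0"
    by (subst nn_integral_0_iff_AE) auto
  with M(2) have "(\<integral>\<^sup>+y. ennreal (norm (indicator C y :: real)) * indicator {x} (P y) \<partial>lborel) = 0"
    by simp
  also have "(\<lambda>y. ennreal (norm (indicator C y :: real)) * indicator {x} (P y))
      = (\<lambda>y. indicator C y * indicator {x} (Q y))"
    by (auto simp: fun_eq_iff Q split: split_indicator)
  finally have "AE y in lborel. (indicator C y * indicator {x} (Q y) :: ennreal) = 0"
    by (subst (asm) nn_integral_0_iff_AE) auto
  then show ?thesis
  proof eventually_elim
    case (elim y)
    then show ?case
      using C(3)[of y] Q[of y] by (auto split: split_indicator_asm)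
  qed
qed

lemma integrable_compactly_bounded:
  fixes F :: "real^'n \<Rightarrow> 'b::{banach, second_countable_topology}"
  assumes F: "compactly_bounded F"
  shows "integrable lborel F" "integrable (level_measure G P x) F"
proof -
  obtain C B where C: "compact C" "C \<subseteq> G" "\<And>y. norm (F y) \<le> B * indicator C y" "B \<ge> 0"
    using compactly_boundedE[OF F] by metis
  have [measurable]: "C \<in> sets borel" using C(1) by (rule borel_compact)
  have [measurable]: "F \<in> borel_measurable borel"
    by (rule compactly_bounded_measurable[OF F])
  have le: "ennreal (norm (F y)) \<le> ennreal B * indicator C y" for y
    using C(3)[of y] C(4) by (auto split: split_indicator intro: ennreal_leI)
  show "integrable lborel F"
  proof (rule integrableI_bounded)
    have "(\<integral>\<^sup>+y. ennreal (norm (F y)) \<partial>lborel) \<le> (\<integral>\<^sup>+y. ennreal B * indicator C y \<partial>lborel)"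
      by (intro nn_integral_mono le)
    also have "\<dots> = ennreal B * emeasure lborel C"
      by (rule nn_integral_cmult_indicator) simp
    also have "\<dots> < \<infinity>"
      using emeasure_compact_finite[OF C(1)] by (simp add: ennreal_mult_less_top)
    finally show "(\<integral>\<^sup>+y. ennreal (norm (F y)) \<partial>lborel) < \<infinity>" .
  qed simp
  show "integrable (level_measure G P x) F"
  proof (rule integrableI_bounded)
    obtain M where M: "M < top" "\<And>x. level_sum x (indicator C) \<le> M"
      using level_sum_bounded[OF C(1,2)] by blast
    have "(\<integral>\<^sup>+y. ennreal (norm (F y)) \<partial>level_measure G P x)
        \<le> (\<integral>\<^sup>+y. ennreal B * indicator C y \<partial>level_measure G P x)"
      by (intro nn_integral_mono le)
    also have "\<dots> = ennreal B * (\<integral>\<^sup>+y. indicator C y \<partial>level_measure G P x)"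
      by (rule nn_integral_cmult) simp
    also have "\<dots> \<le> ennreal B * M"
      using M(2)[of x] by (simp only: nn_integral_level_measure[of "indicator C"] borel_measurable_indicator
        \<open>C \<in> sets borel\<close> mult_left_mono zero_le)
    also have "\<dots> < \<infinity>"
      using M(1) by (simp add: ennreal_mult_less_top)
    finally show "(\<integral>\<^sup>+y. ennreal (norm (F y)) \<partial>level_measure G P x) < \<infinity>" .
  qed simp
qed

lemma coarea_nonneg:
  fixes F :: "real^'n \<Rightarrow> real"
  assumes F: "compactly_bounded F" and nonneg: "\<And>y. F y \<ge> 0"
  shows "has_bochner_integral lborel (\<lambda>x. integral\<^sup>L (level_measure G P x) F) (integral\<^sup>L lborel F)"
proof (rule has_bochner_integral_nn_integral)
  have [measurable]: "F \<in> borel_measurable borel"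
    by (rule compactly_bounded_measurable[OF F])
  have level: "level_sum x F = ennreal (integral\<^sup>L (level_measure G P x) F)" for x
    using nn_integral_eq_integral[OF integrable_compactly_bounded(2)[OF F, of x]] nonneg
    by (simp add: nn_integral_level_measure)
  have int: "integral\<^sup>L (level_measure G P x) F = enn2real (level_sum x F)" for x
    unfolding level using nonneg by (simp add: integral_nonneg)
  show "(\<lambda>x. integral\<^sup>L (level_measure G P x) F) \<in> borel_measurable lborel"
    unfolding int by measurable
  show "AE x in lborel. 0 \<le> integral\<^sup>L (level_measure G P x) F"
    using nonneg by (simp add: integral_nonneg)
  show "0 \<le> integral\<^sup>L lborel F"
    using nonneg by (simp add: integral_nonneg)
  have supp: "F y = 0" if "y \<notin> G" for y
    using F that by (elim compactly_boundedE) (metis indicator_simps(2) mult_zero_right norm_le_zero_iff subsetD)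
  have "(\<integral>\<^sup>+x. ennreal (integral\<^sup>L (level_measure G P x) F) \<partial>lborel)
    = (\<integral>\<^sup>+y. ennreal (F y) * indicator G y \<partial>lborel)"
    unfolding level[symmetric] by (rule coarea_nn) measurable
  also have "\<dots> = (\<integral>\<^sup>+y. ennreal (F y) \<partial>lborel)"
    using supp by (intro nn_integral_cong) (auto split: split_indicator)
  also have "\<dots> = ennreal (integral\<^sup>L lborel F)"
    using nonneg by (intro nn_integral_eq_integral integrable_compactly_bounded[OF F]) auto
  finally show "(\<integral>\<^sup>+x. ennreal (integral\<^sup>L (level_measure G P x) F) \<partial>lborel) = ennreal (integral\<^sup>L lborel F)" .
qed

lemma coarea_real:
  fixes F :: "real^'n \<Rightarrow> real"
  assumes F: "compactly_bounded F"
  shows "has_bochner_integral lborel (\<lambda>x. integral\<^sup>L (level_measure G P x) F) (integral\<^sup>L lborel F)"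
proof -
  have [measurable]: "F \<in> borel_measurable borel"
    by (rule compactly_bounded_measurable[OF F])
  have p: "compactly_bounded (\<lambda>y. max (F y) 0)" and m: "compactly_bounded (\<lambda>y. max (- F y) 0)"
    by (rule compactly_bounded_mono[OF F]; auto)+
  have eq: "F = (\<lambda>y. max (F y) 0 - max (- F y) 0)" by (auto simp: fun_eq_iff)
  have "integral\<^sup>L M F = integral\<^sup>L M (\<lambda>y. max (F y) 0) - integral\<^sup>L M (\<lambda>y. max (- F y) 0)"
    if "integrable M (\<lambda>y. max (F y) 0)" "integrable M (\<lambda>y. max (- F y) 0)" for M
    by (subst eq) (rule Bochner_Integration.integral_diff[OF that])
  note split = this[OF integrable_compactly_bounded(1)[OF p] integrable_compactly_bounded(1)[OF m]]
    this[OF integrable_compactly_bounded(2)[OF p] integrable_compactly_bounded(2)[OF m]]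
  show ?thesis
    unfolding split by (intro has_bochner_integral_diff coarea_nonneg p m) auto
qed

lemma coarea:
  fixes F :: "real^'n \<Rightarrow> complex"
  assumes F: "compactly_bounded F"
  shows "has_bochner_integral lborel (\<lambda>x. integral\<^sup>L (level_measure G P x) F) (integral\<^sup>L lborel F)"
proof -
  have [measurable]: "F \<in> borel_measurable borel"
    by (rule compactly_bounded_measurable[OF F])
  have re: "compactly_bounded (\<lambda>y. Re (F y))" and im: "compactly_bounded (\<lambda>y. Im (F y))"
    by (rule compactly_bounded_mono[OF F]; simp add: abs_Re_le_cmod abs_Im_le_cmod)+
  have split: "integral\<^sup>L M F = of_real (integral\<^sup>L M (\<lambda>y. Re (F y))) + \<i> * of_real (integral\<^sup>L M (\<lambda>y. Im (F y)))"
    if "integrable M F" for M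
    using that by (simp add: complex_eq_iff)
  show ?thesis
    unfolding split[OF integrable_compactly_bounded(1)[OF F]] split[OF integrable_compactly_bounded(2)[OF F]]
    by (intro has_bochner_integral_add has_bochner_integral_mult_right
        has_bochner_integral_bounded_linear[OF bounded_linear_of_real] coarea_real re im)
qed

end

section \<open>Integration by parts\<close>

lemma test_functions_sum:
  assumes "open G" "finite A" "\<And>i. i \<in> A \<Longrightarrow> f i \<in> test_functions G"
  shows "(\<lambda>y. \<Sum>i\<in>A. f i y) \<in> test_functions G"
  using assms(2,3)
proof (induction rule: finite_induct)
  case empty
  show ?case
    by (rule test_functionsI[OF assms(1), of _ "{}"]) (simp_all add: smooth_on_open_const[OF assms(1)])
next
  case (insert i A)
  then show ?case by (simp add: test_functions_add[OF assms(1)])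
qed

lemma continuous_on_UNIV_zero_extension:
  assumes "open G" "closed C" "C \<subseteq> G" "continuous_on G f" "\<And>y. y \<notin> C \<Longrightarrow> f y = 0"
  shows "continuous_on UNIV f"
proof -
  have "continuous_on (- C) f"
    using continuous_on_const[of "- C" 0] by (rule continuous_on_eq) (simp add: assms(5))
  with assms have "continuous_on (G \<union> - C) f"
    by (intro continuous_on_open_Un) (auto simp: open_Compl)
  moreover have "G \<union> - C = UNIV" using assms(3) by auto
  ultimately show ?thesis by simp
qed

context smooth_levels
begin

text \<open>The factor \<open>\<partial>\<^sub>iP / |\<nabla>P|\<^sup>2\<close> is arbitrary outside \<open>G\<close>, where \<open>F\<close> vanishes.\<close>

definition flux :: "'n \<Rightarrow> (real^'n \<Rightarrow> complex) \<Rightarrow> real^'n \<Rightarrow> complex" where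
  "flux i F y = of_real (dP i y * inverse (\<Sum>j\<in>UNIV. dP j y * dP j y)) * F y"

definition divergence :: "(real^'n \<Rightarrow> complex) \<Rightarrow> real^'n \<Rightarrow> complex" where
  "divergence F y = (\<Sum>i\<in>UNIV. partial_derivative i (flux i F) y)"

lemma sum_squares_nonzero:
  assumes "y \<in> G"
  shows "(\<Sum>j\<in>UNIV. dP j y * dP j y) \<noteq> 0"
proof
  assume "(\<Sum>j\<in>UNIV. dP j y * dP j y) = 0"
  then have "norm (gradient P y) = 0"
    by (simp add: norm_gradient power2_eq_square)
  with gradient_nonzero[OF assms] show False by simp
qed

lemma flux_test:
  assumes "F \<in> test_functions G"
  shows "flux i F \<in> test_functions G"
proof -
  have d: "smooth_on_open G (dP j)" for j
    by (rule smooth_on_open_partial_derivative[OF open_G smooth_P])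
  have "smooth_on_open G (\<lambda>y. \<Sum>j\<in>UNIV. dP j y * dP j y)"
    by (rule smooth_on_open_sum[OF finite open_G smooth_on_open_mult[OF open_G d d]])
  from smooth_on_open_inverse[OF open_G sum_squares_nonzero this]
  have "smooth_on_open G (\<lambda>y. dP i y * inverse (\<Sum>j\<in>UNIV. dP j y * dP j y))"
    by (rule smooth_on_open_mult[OF open_G d])
  from test_functions_mult[OF open_G assms smooth_on_open_of_real[OF open_G this]]
  show ?thesis by (simp add: flux_def[abs_def])
qed

lemma divergence_test:
  "F \<in> test_functions G \<Longrightarrow> divergence F \<in> test_functions G"
  unfolding divergence_def[abs_def]
  by (rule test_functions_sum[OF open_G finite partial_derivative_test_functions[OF open_G flux_test]])

text \<open>The vector field is normalized so that its product with the gradient of P is 1; outside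
  G, where the normalization fails, F vanishes.\<close>

lemma sum_flux:
  assumes "F \<in> test_functions G"
  shows "(\<Sum>i\<in>UNIV. of_real (dP i y) * flux i F y) = F y"
proof (cases "y \<in> G")
  case True
  let ?S = "\<Sum>j\<in>UNIV. dP j y * dP j y"
  have "(\<Sum>i\<in>UNIV. of_real (dP i y) * flux i F y) = (\<Sum>i\<in>UNIV. of_real (dP i y * dP i y * inverse ?S) * F y)"
    by (simp add: flux_def mult.assoc)
  also have "\<dots> = of_real (?S * inverse ?S) * F y"
    by (simp only: sum_distrib_right of_real_sum)
  finally show ?thesis using sum_squares_nonzero[OF True] by simp
next
  case False
  then have "F y = 0"
    using notin_supp test_functions_support[OF assms] by blast
  then show ?thesis by (simp add: flux_def)
qed

lemma bounded_image_compact: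
  fixes \<Psi> :: "real \<Rightarrow> complex"
  shows "continuous_on UNIV \<Psi> \<Longrightarrow> compact S \<Longrightarrow> bounded (\<Psi> ` S)"
  by (meson compact_continuous_image compact_imp_bounded continuous_on_subset subset_UNIV)

lemma compactly_bounded_continuous:
  assumes "F \<in> test_functions G" "continuous_on UNIV (q :: real \<Rightarrow> complex)"
  shows "compactly_bounded (\<lambda>y. F y * q (P y))"
  by (intro compactly_bounded_times_P compactly_bounded_test assms bounded_image_compact
      borel_measurable_continuous_onI)

text \<open>Along each line in direction i the integrand is the derivative of
  \<open>W * \<Psi>(P)\<close>, which has compact support, so every line integral vanishes by the
  fundamental theorem of calculus.\<close>

lemma integral_line_derivative:
  fixes \<Psi> k :: "real \<Rightarrow> complex"
  assumes W: "W \<in> test_functions G"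
    and \<Psi>: "\<And>\<omega>. (\<Psi> has_vector_derivative k \<omega>) (at \<omega>)" and k: "continuous_on UNIV k"
  shows "integral\<^sup>L lborel (\<lambda>y. partial_derivative i W y * \<Psi> (P y)
    + of_real (dP i y) * W y * k (P y)) = 0" (is "integral\<^sup>L lborel ?J = 0")
    and "integrable lborel (\<lambda>y. partial_derivative i W y * \<Psi> (P y))"
    and "integrable lborel (\<lambda>y. of_real (dP i y) * W y * k (P y))"
proof -
  have contP: "continuous_on UNIV \<Psi>"
    using \<Psi> by (meson continuous_at_imp_continuous_on has_vector_derivative_continuous)
  have dW: "partial_derivative i W \<in> test_functions G"
    by (rule partial_derivative_test_functions[OF open_G W])
  have WP: "(\<lambda>y. of_real (dP i y) * W y) \<in> test_functions G"
    by (intro test_functions_mult[OF open_G W] smooth_on_open_of_real[OF open_G]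
        smooth_on_open_partial_derivative[OF open_G smooth_P])
  show int1: "integrable lborel (\<lambda>y. partial_derivative i W y * \<Psi> (P y))"
    by (intro integrable_compactly_bounded compactly_bounded_continuous dW contP)
  show int2: "integrable lborel (\<lambda>y. of_real (dP i y) * W y * k (P y))"
    by (intro integrable_compactly_bounded compactly_bounded_continuous WP k)
  note supp = test_functions_support[OF W]
  have J0: "?J y = 0" if "y \<notin> supp W" for y
    using that by (simp add: notin_supp partial_derivative_eq_0)
  have contJ: "continuous_on UNIV ?J"
  proof (rule continuous_on_UNIV_zero_extension[OF open_G closed_supp supp(2) _ J0])
    have c: "continuous_on G (\<lambda>y. q (P y))" if "continuous_on UNIV q" for q :: "real \<Rightarrow> complex"
      using continuous_on_compose2[OF that continuous_P] by simp
    show "continuous_on G ?J"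
      by (intro continuous_intros c contP k continuous_partial_P
          smooth_on_open_continuous_on[OF test_functions_smooth[OF dW]]
          smooth_on_open_continuous_on[OF test_functions_smooth[OF W]])
  qed
  obtain R where R: "\<And>y. y \<in> supp W \<Longrightarrow> norm y \<le> R"
    using compact_imp_bounded[OF supp(1)] unfolding bounded_iff by blast
  \<comment> \<open>R may be negative if the support is empty; the absolute value and the added 1
    make b positive and put the end points of the interval strictly outside the support.\<close>
  define b where "b = \<bar>R\<bar> + 1"
  have out: "glue i w t \<notin> supp W" if "\<bar>t\<bar> \<ge> b" for w t
  proof
    assume "glue i w t \<in> supp W"
    with R have "norm (glue i w t) \<le> R" by blast
    moreover have "\<bar>t\<bar> \<le> norm (glue i w t)"
      using component_le_norm_cart[of "glue i w t" i] by simp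
    ultimately show False using that by (simp add: b_def)
  qed
  show "integral\<^sup>L lborel ?J = 0"
  proof (rule integral_glue_eq_zero[of _ i])
    show "integrable lborel ?J"
      by (rule Bochner_Integration.integrable_add[OF int1 int2])
    fix w
    define \<theta> where "\<theta> t = W (glue i w t) * \<Psi> (P (glue i w t))" for t
    have der: "(\<theta> has_vector_derivative ?J (glue i w t)) (at t)" for t
    proof (cases "glue i w t \<in> G")
      case True
      have "((\<lambda>t. P (glue i w t)) has_vector_derivative dP i (glue i w t)) (at t)"
        using line_derivative[OF True] by (simp add: has_real_derivative_iff_has_vector_derivative)
      from vector_diff_chain_at[OF this \<Psi>]
      have 1: "((\<lambda>t. \<Psi> (P (glue i w t))) has_vector_derivative dP i (glue i w t) *\<^sub>R k (P (glue i w t))) (at t)"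
        by (simp add: o_def)
      have 2: "((\<lambda>t. W (glue i w t)) has_vector_derivative partial_derivative i W (glue i w t)) (at t)"
        by (rule has_vector_derivative_glue)
          (rule smooth_on_open_differentiable[OF test_functions_smooth[OF W] UNIV_I])
      from has_vector_derivative_mult[OF 2 1] show ?thesis
        unfolding \<theta>_def[abs_def] by (simp add: scaleR_conv_of_real algebra_simps)
    next
      \<comment> \<open>Outside G nothing is known about P, but the product vanishes identically
        near such a point of the line because the support of W is closed and contained in G.\<close>
      case False
      then have notin: "glue i w t \<notin> supp W" using supp by blast
      have "open (glue i w -` (- supp W))"
        by (rule continuous_open_vimage) (auto simp: open_Compl continuous_on_eq_continuous_at
            intro: continuous_glue[of UNIV, unfolded continuous_on_eq_continuous_at[OF open_UNIV], rule_format])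
      moreover have "0 = \<theta> s" if "s \<in> glue i w -` (- supp W)" for s
        using that by (simp add: \<theta>_def notin_supp)
      ultimately have "(\<theta> has_vector_derivative 0) (at t)"
        using has_vector_derivative_transform_within_open[OF has_vector_derivative_const] notin
        by (metis ComplI vimageI2)
      with J0[OF notin] show ?thesis by simp
    qed
    have "integral\<^sup>L lborel (\<lambda>t. indicator {-b..b} t *\<^sub>R ?J (glue i w t)) = \<theta> b - \<theta> (- b)"
    proof (rule integral_FTC_Icc)
      show "- b \<le> b" by (simp add: b_def)
      show "(\<theta> has_vector_derivative ?J (glue i w t)) (at t within {-b..b})" for t
        by (rule has_vector_derivative_at_within[OF der])
      show "continuous_on {-b..b} (\<lambda>t. ?J (glue i w t))"
        using continuous_on_compose2[OF contJ continuous_glue] by simp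
    qed
    also have "\<dots> = 0"
      using out[of b w] out[of "- b" w] by (simp add: \<theta>_def notin_supp b_def)
    also have "(\<lambda>t. indicator {-b..b} t *\<^sub>R ?J (glue i w t)) = (\<lambda>t. ?J (glue i w t))"
    proof
      fix t
      show "indicator {-b..b} t *\<^sub>R ?J (glue i w t) = ?J (glue i w t)"
      proof (cases "t \<in> {-b..b}")
        case False
        then have "glue i w t \<notin> supp W" by (intro out) auto
        from J0[OF this] False show ?thesis by simp
      qed simp
    qed
    finally show "integral\<^sup>L lborel (\<lambda>t. ?J (glue i w t)) = 0" .
  qed
qed

lemma integration_by_parts:
  fixes \<Psi> k :: "real \<Rightarrow> complex"
  assumes F: "F \<in> test_functions G"
    and \<Psi>: "\<And>\<omega>. (\<Psi> has_vector_derivative k \<omega>) (at \<omega>)" and k: "continuous_on UNIV k"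
  shows "integral\<^sup>L lborel (\<lambda>y. F y * k (P y)) = - integral\<^sup>L lborel (\<lambda>y. divergence F y * \<Psi> (P y))"
proof -
  note line = integral_line_derivative[OF flux_test[OF F] \<Psi> k]
  have "0 = (\<Sum>i\<in>UNIV. integral\<^sup>L lborel (\<lambda>y. partial_derivative i (flux i F) y * \<Psi> (P y)
    + of_real (dP i y) * flux i F y * k (P y)))"
    by (simp only: line(1) sum.neutral_const)
  also have "\<dots> = (\<Sum>i\<in>UNIV. integral\<^sup>L lborel (\<lambda>y. partial_derivative i (flux i F) y * \<Psi> (P y)))
    + (\<Sum>i\<in>UNIV. integral\<^sup>L lborel (\<lambda>y. of_real (dP i y) * flux i F y * k (P y)))"
    by (simp only: Bochner_Integration.integral_add[OF line(2,3)] sum.distrib)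
  also have "(\<Sum>i\<in>UNIV. integral\<^sup>L lborel (\<lambda>y. partial_derivative i (flux i F) y * \<Psi> (P y)))
    = integral\<^sup>L lborel (\<lambda>y. divergence F y * \<Psi> (P y))"
    by (subst Bochner_Integration.integral_sum[symmetric], rule line(2))
      (simp add: divergence_def sum_distrib_right)
  also have "(\<Sum>i\<in>UNIV. integral\<^sup>L lborel (\<lambda>y. of_real (dP i y) * flux i F y * k (P y)))
    = integral\<^sup>L lborel (\<lambda>y. F y * k (P y))"
    by (subst Bochner_Integration.integral_sum[symmetric], rule line(3))
      (simp only: sum_distrib_right[symmetric] sum_flux[OF F])
  finally show ?thesis by (simp add: eq_neg_iff_add_eq_0 add.commute)
qed

end

section \<open>Boundary values and principal values\<close>

text \<open>Dominated convergence for a real parameter, obtained by testing the limit on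
  sequences.\<close>

lemma tendsto_integral_at_within:
  fixes s :: "real \<Rightarrow> 'a \<Rightarrow> 'b::{banach, second_countable_topology}"
  assumes "\<And>u. u \<in> S - {a} \<Longrightarrow> s u \<in> borel_measurable M" "f \<in> borel_measurable M" "integrable M w"
    and "\<And>u. u \<in> S - {a} \<Longrightarrow> AE y in M. norm (s u y) \<le> w y"
    and "AE y in M. ((\<lambda>u. s u y) \<longlongrightarrow> f y) (at a within S)"
  shows "((\<lambda>u. integral\<^sup>L M (s u)) \<longlongrightarrow> integral\<^sup>L M f) (at a within S)"
  unfolding tendsto_at_iff_sequentially
proof (intro allI impI)
  fix X assume X: "\<forall>i. X i \<in> S - {a}" "X \<longlonglongrightarrow> a"
  have "(\<lambda>i. integral\<^sup>L M (s (X i))) \<longlonglongrightarrow> integral\<^sup>L M f"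
  proof (rule integral_dominated_convergence[where w = w])
    show "AE y in M. (\<lambda>i. s (X i) y) \<longlonglongrightarrow> f y"
      using assms(5)
    proof eventually_elim
      case (elim y)
      then show ?case
        using X unfolding tendsto_at_iff_sequentially by (auto simp: o_def)
    qed
  qed (use X assms in auto)
  then show "((\<lambda>u. integral\<^sup>L M (s u)) \<circ> X) \<longlonglongrightarrow> integral\<^sup>L M f"
    by (simp add: o_def)
qed

text \<open>The positive part has a kink at 0, but its square is continuously differentiable; the
  smoothing of the truncated kernel involves only the square.\<close>

lemma has_real_derivative_pos_part_square:
  "((\<lambda>q::real. (max q 0)\<^sup>2) has_real_derivative 2 * max q 0) (at q)"
proof (cases q "0::real" rule: linorder_cases)
  case less
  have "((\<lambda>q::real. (max q 0)\<^sup>2) has_real_derivative 0) (at q)"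
    by (rule has_field_derivative_transform_within_open[of "\<lambda>_. 0" _ _ "{..<0}"]) (use less in auto)
  with less show ?thesis by simp
next
  case greater
  have "((\<lambda>q::real. q\<^sup>2) has_real_derivative 2 * q) (at q)"
    by (auto intro!: derivative_eq_intros)
  then have "((\<lambda>q::real. (max q 0)\<^sup>2) has_real_derivative 2 * q) (at q)"
    by (rule has_field_derivative_transform_within_open[of _ _ _ "{0<..}"]) (use greater in auto)
  with greater show ?thesis by simp
next
  case equal
  have "((\<lambda>h::real. max h 0) \<longlongrightarrow> max 0 0) (at 0)"
    by (intro tendsto_intros)
  then have "((\<lambda>h::real. max h 0) \<longlongrightarrow> 0) (at 0)" by simp
  moreover have "\<forall>\<^sub>F h::real in at 0. max h 0 = ((max (0 + h) 0)\<^sup>2 - (max 0 0)\<^sup>2) / h"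
    by (auto simp: eventually_at_filter max_def power2_eq_square)
  ultimately have "((\<lambda>h::real. ((max (0 + h) 0)\<^sup>2 - (max 0 0)\<^sup>2) / h) \<longlongrightarrow> 0) (at 0)"
    by (rule Lim_transform_eventually)
  with equal show ?thesis by (simp add: DERIV_def)
qed

lemma ln_square: "s \<noteq> 0 \<Longrightarrow> ln (s\<^sup>2) = 2 * ln \<bar>s\<bar>" for s :: real
  using ln_realpow[of "\<bar>s\<bar>" 2] by simp

text \<open>From below the logarithm is compared with \<open>ln (s\<^sup>2)\<close>; from above
  \<open>ln t \<le> t - 1\<close> is used, and \<open>u\<^sup>2 \<le> 1\<close> absorbs the summand
  -1.\<close>

lemma log_regularization_bound:
  fixes s u :: real
  assumes "s \<noteq> 0" "\<bar>u\<bar> < 1"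
  shows "\<bar>ln (s\<^sup>2 + u\<^sup>2) / 2\<bar> \<le> \<bar>ln \<bar>s\<bar>\<bar> + s\<^sup>2"
proof -
  have pos: "s\<^sup>2 > 0" "s\<^sup>2 + u\<^sup>2 > 0"
    using assms(1) by (auto simp: add_pos_nonneg)
  have "u\<^sup>2 \<le> 1"
    using assms(2) by (simp add: abs_square_le_1)
  then have "ln (s\<^sup>2 + u\<^sup>2) \<le> s\<^sup>2"
    using ln_le_minus_one[OF pos(2)] by linarith
  moreover have "ln (s\<^sup>2) \<le> ln (s\<^sup>2 + u\<^sup>2)"
    using pos by simp
  moreover have "ln (s\<^sup>2) = 2 * ln \<bar>s\<bar>"
    by (rule ln_square[OF assms(1)])
  ultimately show ?thesis
    using pos(1) by linarith
qed

context smooth_levels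
begin

lemma borel_measurable_times_P:
  fixes F :: "real^'n \<Rightarrow> complex" and q :: "real \<Rightarrow> complex"
  assumes F: "compactly_bounded F" and [measurable]: "q \<in> borel_measurable borel"
  shows "(\<lambda>y. F y * q (P y)) \<in> borel_measurable borel"
proof -
  have [measurable]: "F \<in> borel_measurable borel"
    by (rule compactly_bounded_measurable[OF F])
  define Q where "Q y = indicator G y *\<^sub>R P y" for y
  have [measurable]: "Q \<in> borel_measurable borel"
    unfolding Q_def by (rule borel_measurable_indicator_G[OF continuous_P])
  have "(\<lambda>y. F y * q (P y)) = (\<lambda>y. F y * q (Q y))"
  proof
    fix y
    show "F y * q (P y) = F y * q (Q y)"
    proof (cases "y \<in> G")
      case False
      then have "F y = 0"
        using F by (elim compactly_boundedE) (metis indicator_simps(2) mult_zero_right norm_le_zero_iff subsetD)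
      then show ?thesis by simp
    qed (simp add: Q_def)
  qed
  then show ?thesis by simp
qed

lemma singular_integrable:
  fixes F :: "real^'n \<Rightarrow> complex"
  assumes F: "compactly_bounded F"
  shows "integrable lborel (\<lambda>y. norm (F y) * \<bar>x - P y\<bar> powr (-1/2))"
proof (rule integrableI_bounded)
  have "(\<lambda>y. F y * complex_of_real (\<bar>x - P y\<bar> powr (-1/2))) \<in> borel_measurable borel"
    by (rule borel_measurable_times_P[OF F, of "\<lambda>\<omega>. complex_of_real (\<bar>x - \<omega>\<bar> powr (-1/2))"]) measurable
  then have "(\<lambda>y. norm (F y * complex_of_real (\<bar>x - P y\<bar> powr (-1/2)))) \<in> borel_measurable borel"
    by (rule measurable_compose[OF _ borel_measurable_norm])
  then show "(\<lambda>y. norm (F y) * \<bar>x - P y\<bar> powr (-1/2)) \<in> borel_measurable lborel"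
    by (simp add: norm_mult)
  obtain M R where M: "M < top" "(\<integral>\<^sup>+y. ennreal (norm (F y)) * ennreal (\<bar>x - P y\<bar> powr (-1/2)) \<partial>lborel)
    \<le> M * (\<integral>\<^sup>+\<omega>. ennreal (\<bar>x - \<omega>\<bar> powr (-1/2)) * indicator {-R..R} \<omega> \<partial>lborel)"
    using nn_integral_times_P[OF F, of "\<lambda>\<omega>. ennreal (\<bar>x - \<omega>\<bar> powr (-1/2))"] by auto
  note M(2)
  also have "M * (\<integral>\<^sup>+\<omega>. ennreal (\<bar>x - \<omega>\<bar> powr (-1/2)) * indicator {-R..R} \<omega> \<partial>lborel) < \<infinity>"
    using M(1) nn_integral_inverse_sqrt_finite[of x R] by (simp add: ennreal_mult_less_top)
  finally show "(\<integral>\<^sup>+y. ennreal (norm (norm (F y) * \<bar>x - P y\<bar> powr (-1/2))) \<partial>lborel) < \<infinity>"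
    by (simp add: ennreal_mult)
qed

text \<open>The common step behind boundary values and principal values. In the bound, the square
  comes from \<open>log_regularization_bound\<close> and the constant 2 from the arctangent in the
  primitive of the resolvent kernel. Nothing is asked at \<open>\<omega> = x\<close>, because that
  level is a null set.\<close>

lemma log_dominated_limit:
  fixes \<Phi> :: "real \<Rightarrow> real \<Rightarrow> complex"
  assumes F: "compactly_bounded F"
    and meas: "\<And>u. u \<in> S - {a} \<Longrightarrow> \<Phi> u \<in> borel_measurable borel" "L \<in> borel_measurable borel"
    and bound: "\<And>u \<omega>. u \<in> S - {a} \<Longrightarrow> \<omega> \<noteq> x \<Longrightarrow>
      norm (\<Phi> u \<omega>) \<le> \<bar>ln \<bar>x - \<omega>\<bar>\<bar> + (x - \<omega>)\<^sup>2 + 2"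
    and lim: "\<And>\<omega>. \<omega> \<noteq> x \<Longrightarrow> ((\<lambda>u. \<Phi> u \<omega>) \<longlongrightarrow> L \<omega>) (at a within S)"
  shows "((\<lambda>u. integral\<^sup>L lborel (\<lambda>y. F y * \<Phi> u (P y))) \<longlongrightarrow> integral\<^sup>L lborel (\<lambda>y. F y * L (P y))) (at a within S)"
proof (rule tendsto_integral_at_within)
  \<comment> \<open>Collects the locally bounded part of the majorant, including the linear term of
    \<open>abs_ln_abs_le\<close>; the remaining inverse square root is handled by
    \<open>singular_integrable\<close>.\<close>
  define c where "c \<omega> = complex_of_real (\<bar>x - \<omega>\<bar> + (x - \<omega>)\<^sup>2 + 2)" for \<omega>
  have contc: "continuous_on UNIV c"
    unfolding c_def by (intro continuous_intros)
  have c: "compactly_bounded (\<lambda>y. F y * c (P y))"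
    by (intro compactly_bounded_times_P[OF F] borel_measurable_continuous_onI bounded_image_compact contc)
  show "integrable lborel (\<lambda>y. 2 * (norm (F y) * \<bar>x - P y\<bar> powr (-1/2)) + norm (F y * c (P y)))"
    by (intro Bochner_Integration.integrable_add integrable_mult_right singular_integrable[OF F]
        integrable_norm integrable_compactly_bounded[OF c])
  have null: "AE y in lborel. F y \<noteq> 0 \<longrightarrow> P y \<noteq> x"
    by (rule AE_level_null[OF F])
  show "AE y in lborel. norm (F y * \<Phi> u (P y)) \<le> 2 * (norm (F y) * \<bar>x - P y\<bar> powr (-1/2)) + norm (F y * c (P y))"
    if u: "u \<in> S - {a}" for u
    using null
  proof eventually_elim
    case (elim y)
    show ?case
    proof (cases "F y = 0")
      case False
      with elim have "norm (\<Phi> u (P y)) \<le> \<bar>ln \<bar>x - P y\<bar>\<bar> + (x - P y)\<^sup>2 + 2"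
        by (intro bound[OF u]) simp
      also have "\<dots> \<le> 2 * \<bar>x - P y\<bar> powr (-1/2) + norm (c (P y))"
        using abs_ln_abs_le[of "x - P y"] unfolding c_def norm_of_real by simp
      finally have "norm (F y) * norm (\<Phi> u (P y)) \<le> norm (F y) * (2 * \<bar>x - P y\<bar> powr (-1/2) + norm (c (P y)))"
        by (rule mult_left_mono) simp
      then show ?thesis by (simp add: norm_mult algebra_simps)
    qed simp
  qed
  show "AE y in lborel. ((\<lambda>u. F y * \<Phi> u (P y)) \<longlongrightarrow> F y * L (P y)) (at a within S)"
    using null
  proof eventually_elim
    case (elim y)
    then show ?case
      by (cases "F y = 0") (auto intro!: tendsto_mult_left lim)
  qed
qed (use borel_measurable_times_P[OF F] meas in auto)

section \<open>Limits of the resolvent at the real axis\<close>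

lemma resolvent_limit_right:
  assumes F: "F \<in> test_functions G"
  shows "\<exists>l. ((\<lambda>u. integral\<^sup>L lborel (\<lambda>y. F y * (1 / (Complex x u - of_real (P y))))) \<longlongrightarrow> l) (at_right 0)"
proof -
  \<comment> \<open>For \<open>u > 0\<close> this differs by a constant from minus the principal
    logarithm of \<open>x + iu - \<omega>\<close>. The arctangent keeps it free of branch cuts and
    turns into a step at \<open>\<omega> = x\<close> as u tends to 0.\<close>
  define \<Phi> where "\<Phi> u \<omega> = complex_of_real (- (ln ((x - \<omega>)\<^sup>2 + u\<^sup>2) / 2)) + \<i> * complex_of_real (arctan ((x - \<omega>) / u))"
    for u \<omega>
  define L where "L \<omega> = complex_of_real (- ln \<bar>x - \<omega>\<bar>) + \<i> * complex_of_real (pi / 2 * sgn (x - \<omega>))" for \<omega>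
  have der: "(\<Phi> u has_vector_derivative 1 / (Complex x u - of_real \<omega>)) (at \<omega>)" if "u > 0" for u \<omega>
  proof -
    have pos: "(x - \<omega>)\<^sup>2 + u\<^sup>2 > 0" using that by (simp add: add_nonneg_pos)
    have 1: "((\<lambda>\<omega>. - (ln ((x - \<omega>)\<^sup>2 + u\<^sup>2) / 2)) has_real_derivative (x - \<omega>) / ((x - \<omega>)\<^sup>2 + u\<^sup>2)) (at \<omega>)"
    proof -
      have "((\<lambda>\<omega>. (x - \<omega>)\<^sup>2 + u\<^sup>2) has_real_derivative - 2 * (x - \<omega>)) (at \<omega>)"
        by (auto intro!: derivative_eq_intros)
      from DERIV_minus[OF DERIV_cdivide[OF DERIV_chain2[OF DERIV_ln_divide[OF pos] this], of 2]]
      moreover have "- (1 / d * (- 2 * s) / 2) = s / d" for s d :: real by simp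
      ultimately show ?thesis by metis
    qed
    have "((\<lambda>\<omega>. arctan ((x - \<omega>) / u)) has_real_derivative inverse (1 + ((x - \<omega>) / u)\<^sup>2) * (- 1 / u)) (at \<omega>)"
      using that by (auto intro!: derivative_eq_intros)
    also have "inverse (1 + ((x - \<omega>) / u)\<^sup>2) * (- 1 / u) = - u / ((x - \<omega>)\<^sup>2 + u\<^sup>2)"
      using that pos by (simp add: power_divide field_simps power2_eq_square)
    finally have 2: "((\<lambda>\<omega>. arctan ((x - \<omega>) / u)) has_real_derivative - u / ((x - \<omega>)\<^sup>2 + u\<^sup>2)) (at \<omega>)" .
    have cancel: "c * ((x - \<omega>)\<^sup>2 + u\<^sup>2) / ((x - \<omega>)\<^sup>2 + u\<^sup>2)\<^sup>2 = c / ((x - \<omega>)\<^sup>2 + u\<^sup>2)" for c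
      using pos by (simp add: power2_eq_square[of "(x - \<omega>)\<^sup>2 + u\<^sup>2"])
    have "(\<Phi> u has_vector_derivative complex_of_real ((x - \<omega>) / ((x - \<omega>)\<^sup>2 + u\<^sup>2))
      + \<i> * complex_of_real (- u / ((x - \<omega>)\<^sup>2 + u\<^sup>2))) (at \<omega>)"
      unfolding \<Phi>_def[abs_def]
      by (intro has_vector_derivative_add has_vector_derivative_mult_right has_vector_derivative_of_real 1 2)
    also have "complex_of_real ((x - \<omega>) / ((x - \<omega>)\<^sup>2 + u\<^sup>2)) + \<i> * complex_of_real (- u / ((x - \<omega>)\<^sup>2 + u\<^sup>2))
      = 1 / (Complex x u - of_real \<omega>)"
      by (simp add: complex_eq_iff Re_divide Im_divide cancel)
    finally show ?thesis .
  qed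
  have cont: "continuous_on UNIV (\<lambda>\<omega>. 1 / (Complex x u - of_real \<omega>))" if "u > 0" for u
    using that by (intro continuous_intros) (auto simp: complex_eq_iff)
  have parts: "integral\<^sup>L lborel (\<lambda>y. F y * (1 / (Complex x u - of_real (P y))))
      = - integral\<^sup>L lborel (\<lambda>y. divergence F y * \<Phi> u (P y))" if "u > 0" for u
    by (rule integration_by_parts[OF F der[OF that] cont[OF that]])
  \<comment> \<open>The parameter is restricted to \<open>u < 1\<close> for the sake of
    \<open>log_regularization_bound\<close>; near 0 this gives the same filter as
    \<open>at_right 0\<close>.\<close>
  have "((\<lambda>u. integral\<^sup>L lborel (\<lambda>y. divergence F y * \<Phi> u (P y)))
      \<longlongrightarrow> integral\<^sup>L lborel (\<lambda>y. divergence F y * L (P y))) (at 0 within {0<..<1})"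
  proof (rule log_dominated_limit[where x = x, OF compactly_bounded_test[OF divergence_test[OF F]]])
    show "norm (\<Phi> u \<omega>) \<le> \<bar>ln \<bar>x - \<omega>\<bar>\<bar> + (x - \<omega>)\<^sup>2 + 2" if u: "u \<in> {0<..<1} - {0}" and "\<omega> \<noteq> x" for u \<omega>
    proof -
      have "norm (\<Phi> u \<omega>) \<le> \<bar>ln ((x - \<omega>)\<^sup>2 + u\<^sup>2) / 2\<bar> + \<bar>arctan ((x - \<omega>) / u)\<bar>"
        unfolding \<Phi>_def by (rule order_trans[OF norm_triangle_ineq]) (simp add: norm_mult del: of_real_divide of_real_minus)
      also have "\<bar>arctan ((x - \<omega>) / u)\<bar> \<le> 2"
        using arctan_bounded[of "(x - \<omega>) / u"] pi_less_4 by (auto simp: abs_le_iff)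
      finally show ?thesis
        using log_regularization_bound[of "x - \<omega>" u] that by auto
    qed
    show "((\<lambda>u. \<Phi> u \<omega>) \<longlongrightarrow> L \<omega>) (at 0 within {0<..<1})" if "\<omega> \<noteq> x" for \<omega>
    proof -
      have "((\<lambda>u. - (ln ((x - \<omega>)\<^sup>2 + u\<^sup>2) / 2)) \<longlongrightarrow> - (ln ((x - \<omega>)\<^sup>2 + 0\<^sup>2) / 2)) (at 0 within {0<..<1})"
        using that by (intro tendsto_intros) auto
      moreover have "ln ((x - \<omega>)\<^sup>2 + 0\<^sup>2) = 2 * ln \<bar>x - \<omega>\<bar>"
        using that by (simp add: ln_square)
      ultimately have 1: "((\<lambda>u. - (ln ((x - \<omega>)\<^sup>2 + u\<^sup>2) / 2)) \<longlongrightarrow> - ln \<bar>x - \<omega>\<bar>) (at 0 within {0<..<1})"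
        by simp
      have 2: "((\<lambda>u. arctan ((x - \<omega>) / u)) \<longlongrightarrow> pi / 2 * sgn (x - \<omega>)) (at 0 within {0<..<1})"
      proof -
        have top: "((\<lambda>u. arctan (c / u)) \<longlongrightarrow> pi / 2) (at_right 0)" if "c > 0" for c :: real
        proof (rule filterlim_compose[OF tendsto_arctan_at_top])
          have "filterlim (\<lambda>u::real. c * inverse u) at_top (at_right 0)"
            by (rule filterlim_tendsto_pos_mult_at_top[OF tendsto_const that filterlim_inverse_at_top_right])
          then show "filterlim (\<lambda>u::real. c / u) at_top (at_right 0)"
            by (simp add: divide_inverse)
        qed
        have [simp]: "at (0::real) within {0<..<1} = at_right 0"
          by (rule at_within_nhd[of _ "{-1<..<1}"]) auto
        show ?thesis
        proof (cases "x > \<omega>")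
          case True
          with top[of "x - \<omega>"] show ?thesis by simp
        next
          case False
          with \<open>\<omega> \<noteq> x\<close> have "\<omega> > x" by simp
          have "arctan ((x - \<omega>) / u) = - arctan ((\<omega> - x) / u)" for u
            by (metis arctan_minus minus_diff_eq minus_divide_left)
          then show ?thesis
            using tendsto_minus[OF top[of "\<omega> - x"]] \<open>\<omega> > x\<close> by simp
        qed
      qed
      show ?thesis
        unfolding \<Phi>_def L_def by (intro tendsto_add tendsto_mult_left tendsto_of_real 1 2)
    qed
  qed (auto simp: \<Phi>_def[abs_def] L_def[abs_def])
  also have "at (0::real) within {0<..<1} = at_right 0"
    by (rule at_within_nhd[of _ "{-1<..<1}"]) auto
  finally have "((\<lambda>u. - integral\<^sup>L lborel (\<lambda>y. divergence F y * \<Phi> u (P y)))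
      \<longlongrightarrow> - integral\<^sup>L lborel (\<lambda>y. divergence F y * L (P y))) (at_right 0)"
    by (rule tendsto_minus)
  moreover have "\<forall>\<^sub>F u in at_right 0. - integral\<^sup>L lborel (\<lambda>y. divergence F y * \<Phi> u (P y))
      = integral\<^sup>L lborel (\<lambda>y. F y * (1 / (Complex x u - of_real (P y))))"
    using eventually_at_right_less[of "0::real"] by eventually_elim (rule parts[symmetric])
  ultimately have "((\<lambda>u. integral\<^sup>L lborel (\<lambda>y. F y * (1 / (Complex x u - of_real (P y)))))
      \<longlongrightarrow> - integral\<^sup>L lborel (\<lambda>y. divergence F y * L (P y))) (at_right 0)"
    by (rule Lim_transform_eventually)
  then show ?thesis by blast
qed

text \<open>Complex conjugation exchanges \<open>x + iu\<close> and \<open>x - iu\<close>, so the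
  limit from below for F is the conjugate of the limit from above for \<open>cnj F\<close>.\<close>

lemma resolvent_limit_left:
  assumes F: "F \<in> test_functions G"
  shows "\<exists>l. ((\<lambda>u. integral\<^sup>L lborel (\<lambda>y. F y * (1 / (Complex x u - of_real (P y))))) \<longlongrightarrow> l) (at_left 0)"
proof -
  have "(\<lambda>y. cnj (F y)) \<in> test_functions G"
  proof (rule test_functionsI[OF open_G])
    show "smooth_on_open G (\<lambda>y. cnj (F y))"
      by (rule smooth_on_open_linear[OF open_G bounded_linear_cnj test_functions_smooth[OF F]])
  qed (use test_functions_support[OF F] notin_supp in auto)
  from resolvent_limit_right[OF this, of x] obtain l where
    "((\<lambda>u. integral\<^sup>L lborel (\<lambda>y. cnj (F y) * (1 / (Complex x u - of_real (P y))))) \<longlongrightarrow> l) (at_right 0)"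
    by blast
  from tendsto_cnj[OF this]
  have "((\<lambda>u. cnj (integral\<^sup>L lborel (\<lambda>y. cnj (F y) * (1 / (Complex x u - of_real (P y)))))) \<longlongrightarrow> cnj l) (at_right 0)" .
  moreover have "cnj (integral\<^sup>L lborel (\<lambda>y. cnj (F y) * (1 / (Complex x u - of_real (P y)))))
      = integral\<^sup>L lborel (\<lambda>y. F y * (1 / (Complex x (- u) - of_real (P y))))" for u
  proof -
    have "cnj (Complex x u - of_real (P y)) = Complex x (- u) - of_real (P y)" for y
      by (simp add: complex_eq_iff)
    then show ?thesis
      by (subst Bochner_Integration.integral_cnj[symmetric]) (simp only: complex_cnj_mult complex_cnj_divide complex_cnj_cnj complex_cnj_one)
  qed
  ultimately have "((\<lambda>u. integral\<^sup>L lborel (\<lambda>y. F y * (1 / (Complex x u - of_real (P y))))) \<longlongrightarrow> cnj l) (at_left 0)"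
    by (simp add: filterlim_at_left_to_right)
  then show ?thesis by blast
qed

section \<open>Truncated kernels and existence of principal values\<close>

definition pv_kernel :: "real \<Rightarrow> real \<Rightarrow> real \<Rightarrow> complex" where
  "pv_kernel x \<epsilon> \<omega> = indicator {\<omega>. \<epsilon> < \<bar>x - \<omega>\<bar>} \<omega> / of_real (x - \<omega>)"

lemma borel_measurable_pv_kernel [measurable]: "pv_kernel x \<epsilon> \<in> borel_measurable borel"
  unfolding pv_kernel_def by measurable

lemma norm_pv_kernel: "\<epsilon> > 0 \<Longrightarrow> norm (pv_kernel x \<epsilon> \<omega>) \<le> 1 / \<epsilon>"
  by (auto simp: pv_kernel_def norm_divide simp del: of_real_diff intro!: divide_left_mono mult_pos_pos
      split: split_indicator)

lemma compactly_bounded_pv_kernel: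
  assumes "compactly_bounded F" "\<epsilon> > 0"
  shows "compactly_bounded (\<lambda>y. F y * pv_kernel x \<epsilon> (P y))"
  using norm_pv_kernel[OF assms(2)]
  by (intro compactly_bounded_times_P assms(1)) (auto simp: bounded_iff)

text \<open>The primitive of the truncated kernel is not differentiable where \<open>|x - \<omega>| = \<epsilon>\<close>. In the proof
  the positive part \<open>m\<close> of \<open>(x - \<omega>)\<^sup>2 - \<epsilon>\<^sup>2\<close> is smoothed to \<open>sqrt (m\<^sup>2 + d\<^sup>2) - d\<close>, and \<open>d \<rightarrow> 0\<close>.\<close>

lemma pv_integration_by_parts:
  assumes F: "F \<in> test_functions G" and \<epsilon>: "\<epsilon> > 0"
  shows "integral\<^sup>L lborel (\<lambda>y. F y * pv_kernel x \<epsilon> (P y))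
    = - integral\<^sup>L lborel (\<lambda>y. divergence F y * of_real (- (ln (max ((x - P y)\<^sup>2) (\<epsilon>\<^sup>2)) / 2)))"
proof -
  define e where "e = \<epsilon>\<^sup>2"
  have e: "e > 0" using \<epsilon> by (simp add: e_def)
  define m where "m \<omega> = max ((x - \<omega>)\<^sup>2 - e) 0" for \<omega>
  define r where "r d \<omega> = sqrt ((m \<omega>)\<^sup>2 + d\<^sup>2) - d" for d \<omega>
  \<comment> \<open>Since \<open>e + m \<omega> = max ((x - \<omega>)\<^sup>2) e\<close>, this tends
    to the primitive of the truncated kernel as d tends to 0.\<close>
  define \<Psi> where "\<Psi> d \<omega> = complex_of_real (- (ln (e + r d \<omega>) / 2))" for d \<omega>
  \<comment> \<open>The quotient of m and the square root is a continuous substitute for the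
    indicator of \<open>\<epsilon> < \<bar>x - \<omega>\<bar>\<close>; where that inequality holds,
    the denominator tends to \<open>(x - \<omega>)\<^sup>2\<close>.\<close>
  define k where "k d \<omega> = complex_of_real ((x - \<omega>) * (m \<omega> / sqrt ((m \<omega>)\<^sup>2 + d\<^sup>2)) / (e + r d \<omega>))" for d \<omega>
  have m0: "m \<omega> \<ge> 0" for \<omega> by (simp add: m_def)
  have r0: "r d \<omega> \<ge> 0" if "d > 0" for d \<omega>
    using that real_sqrt_sum_squares_ge2[of d "m \<omega>"] by (simp add: r_def add.commute)
  have rm: "r d \<omega> \<le> m \<omega>" if "d > 0" for d \<omega>
    using that sqrt_sum_squares_le_sum[OF m0, of d \<omega>] by (simp add: r_def)
  have contm: "continuous_on UNIV m"
    unfolding m_def by (intro continuous_intros)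
  have contr: "continuous_on UNIV (r d)" for d
    unfolding r_def by (intro continuous_intros contm)
  have pos: "e + r d \<omega> > 0" if "d > 0" for d \<omega>
    using e r0[OF that, of \<omega>] by simp
  have sq: "sqrt ((m \<omega>)\<^sup>2 + d\<^sup>2) > 0" if "d > 0" for d \<omega>
    using that by (simp add: add_nonneg_pos)
  have der: "(\<Psi> d has_vector_derivative k d \<omega>) (at \<omega>)" if d: "d > 0" for d \<omega>
  proof -
    have 1: "((\<lambda>\<omega>. (x - \<omega>)\<^sup>2 - e) has_real_derivative - 2 * (x - \<omega>)) (at \<omega>)"
      by (auto intro!: derivative_eq_intros)
    have 2: "((\<lambda>\<omega>. (m \<omega>)\<^sup>2) has_real_derivative 2 * m \<omega> * (- 2 * (x - \<omega>))) (at \<omega>)"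
      unfolding m_def by (rule DERIV_chain2[OF has_real_derivative_pos_part_square 1])
    have 3: "((\<lambda>\<omega>. (m \<omega>)\<^sup>2 + d\<^sup>2) has_real_derivative 2 * m \<omega> * (- 2 * (x - \<omega>))) (at \<omega>)"
      using DERIV_add[OF 2 DERIV_const[of "d\<^sup>2"]] by simp
    have "(m \<omega>)\<^sup>2 + d\<^sup>2 > 0" using d by (simp add: add_nonneg_pos)
    from DERIV_chain2[OF DERIV_real_sqrt[OF this] 3]
    have 4: "((\<lambda>\<omega>. sqrt ((m \<omega>)\<^sup>2 + d\<^sup>2)) has_real_derivative
      inverse (sqrt ((m \<omega>)\<^sup>2 + d\<^sup>2)) / 2 * (2 * m \<omega> * (- 2 * (x - \<omega>)))) (at \<omega>)" .
    have 5: "((\<lambda>\<omega>. e + r d \<omega>) has_real_derivative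
      inverse (sqrt ((m \<omega>)\<^sup>2 + d\<^sup>2)) / 2 * (2 * m \<omega> * (- 2 * (x - \<omega>)))) (at \<omega>)"
      unfolding r_def using DERIV_add[OF DERIV_const[of e] DERIV_diff[OF 4 DERIV_const[of d]]] by simp
    have 6: "((\<lambda>\<omega>. - (ln (e + r d \<omega>) / 2)) has_real_derivative
        - (1 / (e + r d \<omega>) * (inverse (sqrt ((m \<omega>)\<^sup>2 + d\<^sup>2)) / 2 * (2 * m \<omega> * (- 2 * (x - \<omega>)))) / 2)) (at \<omega>)"
      using DERIV_chain2[where f = ln and g = "\<lambda>\<omega>. e + r d \<omega>", OF DERIV_ln_divide[OF pos[OF d]] 5]
      by (intro DERIV_minus DERIV_cdivide)
    have eq: "- (1 / p * (inverse q / 2 * (2 * n * (- 2 * s))) / 2) = s * (n / q) / p" for p q n s :: real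
      by simp (simp only: divide_inverse inverse_mult_distrib mult_ac)
    have "((\<lambda>\<omega>. - (ln (e + r d \<omega>) / 2)) has_real_derivative
        (x - \<omega>) * (m \<omega> / sqrt ((m \<omega>)\<^sup>2 + d\<^sup>2)) / (e + r d \<omega>)) (at \<omega>)"
      by (rule DERIV_cong[OF 6 eq])
    then show ?thesis
      unfolding \<Psi>_def[abs_def] k_def by (rule has_vector_derivative_of_real)
  qed
  have contk: "continuous_on UNIV (k d)" if d: "d > 0" for d
    unfolding k_def
    by (intro continuous_intros contm contr ballI less_imp_neq[OF sq[OF d], symmetric]
        less_imp_neq[OF pos[OF d], symmetric])
  have cont\<Psi>: "continuous_on UNIV (\<Psi> d)" if d: "d > 0" for d
    unfolding \<Psi>_def
    by (intro continuous_intros contr ballI less_imp_neq[OF pos[OF d], symmetric]) simp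
  have parts: "integral\<^sup>L lborel (\<lambda>y. F y * k d (P y)) = - integral\<^sup>L lborel (\<lambda>y. divergence F y * \<Psi> d (P y))"
    if "d > 0" for d
    by (rule integration_by_parts[OF F der[OF that] contk[OF that]])
  have lim_r: "((\<lambda>d. r d \<omega>) \<longlongrightarrow> m \<omega>) (at_right 0)" for \<omega>
  proof -
    have "((\<lambda>d. sqrt ((m \<omega>)\<^sup>2 + d\<^sup>2) - d) \<longlongrightarrow> sqrt ((m \<omega>)\<^sup>2 + 0\<^sup>2) - 0) (at_right 0)"
      by (intro tendsto_intros)
    then show ?thesis using m0[of \<omega>] by (simp add: r_def)
  qed
  have em: "e + m \<omega> = max ((x - \<omega>)\<^sup>2) e" for \<omega>
    by (simp add: m_def)
  have "((\<lambda>d. integral\<^sup>L lborel (\<lambda>y. divergence F y * \<Psi> d (P y))) \<longlongrightarrow>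
    integral\<^sup>L lborel (\<lambda>y. divergence F y * of_real (- (ln (max ((x - P y)\<^sup>2) e) / 2)))) (at_right 0)"
  proof (rule tendsto_integral_at_within)
    define c where "c \<omega> = complex_of_real (\<bar>ln e\<bar> + e + (x - \<omega>)\<^sup>2)" for \<omega>
    show "integrable lborel (\<lambda>y. norm (divergence F y * c (P y)))"
      unfolding c_def
      by (intro integrable_norm integrable_compactly_bounded compactly_bounded_continuous
          divergence_test[OF F] continuous_intros)
    show "(\<lambda>y. divergence F y * \<Psi> u (P y)) \<in> borel_measurable lborel" if "u \<in> {0<..} - {0}" for u
      using compactly_bounded_measurable[OF compactly_bounded_continuous[OF divergence_test[OF F] cont\<Psi>]] that
      by simp
    have "continuous_on UNIV (\<lambda>\<omega>. complex_of_real (- (ln (max ((x - \<omega>)\<^sup>2) e) / 2)))"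
      using e by (intro continuous_intros) (auto simp: max_def)
    from compactly_bounded_measurable[OF compactly_bounded_continuous[OF divergence_test[OF F] this]]
    show "(\<lambda>y. divergence F y * of_real (- (ln (max ((x - P y)\<^sup>2) e) / 2))) \<in> borel_measurable lborel"
      by simp
    have "norm (\<Psi> u \<omega>) \<le> norm (c \<omega>)" if u: "u > 0" for u \<omega>
    proof -
      have "ln e \<le> ln (e + r u \<omega>)"
        using e r0[OF u, of \<omega>] by simp
      moreover have "ln (e + r u \<omega>) \<le> e + (x - \<omega>)\<^sup>2"
      proof -
        have "r u \<omega> \<le> (x - \<omega>)\<^sup>2"
          by (rule order_trans[OF rm[OF u]]) (use e in \<open>simp add: m_def\<close>)
        then show ?thesis
          using ln_le_minus_one[OF pos[OF u, of \<omega>]] by linarith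
      qed
      moreover have "0 \<le> (x - \<omega>)\<^sup>2" by simp
      ultimately have "\<bar>ln (e + r u \<omega>) / 2\<bar> \<le> \<bar>ln e\<bar> + e + (x - \<omega>)\<^sup>2"
        using e by linarith
      moreover have "norm (c \<omega>) = \<bar>ln e\<bar> + e + (x - \<omega>)\<^sup>2"
        unfolding c_def norm_of_real using e by simp
      ultimately show ?thesis unfolding \<Psi>_def norm_of_real by simp
    qed
    then show "AE y in lborel. norm (divergence F y * \<Psi> u (P y)) \<le> norm (divergence F y * c (P y))"
      if "u \<in> {0<..} - {0}" for u
      using that by (auto simp: norm_mult intro!: AE_I2 mult_left_mono)
    have pl: "((\<lambda>u. \<Psi> u \<omega>) \<longlongrightarrow> of_real (- (ln (max ((x - \<omega>)\<^sup>2) e) / 2))) (at_right 0)" for \<omega>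
      unfolding \<Psi>_def em[symmetric] using e m0[of \<omega>]
      by (intro tendsto_intros lim_r) auto
    show "AE y in lborel. ((\<lambda>u. divergence F y * \<Psi> u (P y))
      \<longlongrightarrow> divergence F y * of_real (- (ln (max ((x - P y)\<^sup>2) e) / 2))) (at_right 0)"
      by (intro AE_I2 tendsto_mult_left pl)
  qed
  moreover have "\<forall>\<^sub>F d in at_right 0. - integral\<^sup>L lborel (\<lambda>y. divergence F y * \<Psi> d (P y))
      = integral\<^sup>L lborel (\<lambda>y. F y * k d (P y))"
    using eventually_at_right_less[of "0::real"] by eventually_elim (rule parts[symmetric])
  ultimately have A: "((\<lambda>d. integral\<^sup>L lborel (\<lambda>y. F y * k d (P y))) \<longlongrightarrow>
    - integral\<^sup>L lborel (\<lambda>y. divergence F y * of_real (- (ln (max ((x - P y)\<^sup>2) e) / 2)))) (at_right 0)"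
    by (rule Lim_transform_eventually[OF tendsto_minus])
  have B: "((\<lambda>d. integral\<^sup>L lborel (\<lambda>y. F y * k d (P y))) \<longlongrightarrow>
    integral\<^sup>L lborel (\<lambda>y. F y * pv_kernel x \<epsilon> (P y))) (at_right 0)"
  proof (rule tendsto_integral_at_within)
    \<comment> \<open>A majorant independent of d: the smoothed indicator is at most 1 and the
      denominator at least e.\<close>
    define c where "c \<omega> = complex_of_real (\<bar>x - \<omega>\<bar> / e)" for \<omega>
    show "integrable lborel (\<lambda>y. norm (F y * c (P y)))"
      unfolding c_def using e
      by (intro integrable_norm integrable_compactly_bounded compactly_bounded_continuous
          F continuous_intros) auto
    show "(\<lambda>y. F y * k u (P y)) \<in> borel_measurable lborel" if "u \<in> {0<..} - {0}" for u
      using compactly_bounded_measurable[OF compactly_bounded_continuous[OF F contk]] that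
      by simp
    show "(\<lambda>y. F y * pv_kernel x \<epsilon> (P y)) \<in> borel_measurable lborel"
      using borel_measurable_times_P[OF compactly_bounded_test[OF F] borel_measurable_pv_kernel] by simp
    have "norm (k u \<omega>) \<le> norm (c \<omega>)" if u: "u > 0" for u \<omega>
    proof -
      have "m \<omega> / sqrt ((m \<omega>)\<^sup>2 + u\<^sup>2) \<le> 1"
        using sq[OF u, of \<omega>] real_sqrt_sum_squares_ge1[of "m \<omega>" u] by simp
      then have "\<bar>x - \<omega>\<bar> * (m \<omega> / sqrt ((m \<omega>)\<^sup>2 + u\<^sup>2)) / (e + r u \<omega>) \<le> \<bar>x - \<omega>\<bar> * 1 / e"
        using e r0[OF u, of \<omega>] m0[of \<omega>] by (intro frac_le mult_left_mono mult_nonneg_nonneg divide_nonneg_nonneg) auto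
      then show ?thesis
        unfolding k_def c_def norm_of_real abs_divide abs_mult
        using e r0[OF u, of \<omega>] m0[of \<omega>] by simp
    qed
    then show "AE y in lborel. norm (F y * k u (P y)) \<le> norm (F y * c (P y))"
      if "u \<in> {0<..} - {0}" for u
      using that by (auto simp: norm_mult intro!: AE_I2 mult_left_mono)
    have pl: "((\<lambda>u. k u \<omega>) \<longlongrightarrow> pv_kernel x \<epsilon> \<omega>) (at_right 0)" for \<omega>
    proof (cases "\<epsilon> < \<bar>x - \<omega>\<bar>")
      case True
      then have "e < (x - \<omega>)\<^sup>2"
        using power_strict_mono[OF True, of 2] \<epsilon> by (simp add: e_def)
      then have m: "m \<omega> = (x - \<omega>)\<^sup>2 - e" "m \<omega> > 0" by (auto simp: m_def)
      have "((\<lambda>u. (x - \<omega>) * (m \<omega> / sqrt ((m \<omega>)\<^sup>2 + u\<^sup>2)) / (e + r u \<omega>))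
        \<longlongrightarrow> (x - \<omega>) * (m \<omega> / sqrt ((m \<omega>)\<^sup>2 + 0\<^sup>2)) / (e + m \<omega>)) (at_right 0)"
        using m e by (intro tendsto_intros lim_r) auto
      also have "(x - \<omega>) * (m \<omega> / sqrt ((m \<omega>)\<^sup>2 + 0\<^sup>2)) / (e + m \<omega>) = 1 / (x - \<omega>)"
        using m by (simp add: power2_eq_square)
      finally show ?thesis
        unfolding k_def[abs_def] using True
        by (auto simp: pv_kernel_def dest: tendsto_of_real[where 'a = complex])
    next
      \<comment> \<open>This includes \<open>\<bar>x - \<omega>\<bar> = \<epsilon>\<close>: there m
        is 0, so the smoothed kernel vanishes for every d, in accordance with the strict inequality
        in \<open>pv_kernel\<close>.\<close>
      case False
      then have "(x - \<omega>)\<^sup>2 \<le> e"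
        using \<epsilon> unfolding e_def by (simp add: abs_le_square_iff[symmetric])
      then have "m \<omega> = 0" by (simp add: m_def)
      with False show ?thesis by (simp add: k_def pv_kernel_def)
    qed
    show "AE y in lborel. ((\<lambda>u. F y * k u (P y)) \<longlongrightarrow> F y * pv_kernel x \<epsilon> (P y)) (at_right 0)"
      by (intro AE_I2 tendsto_mult_left pl)
  qed
  from tendsto_unique[OF trivial_limit_at_right_real B A] show ?thesis
    by (simp add: e_def)
qed

text \<open>After integration by parts the primitive is bounded by the logarithm and, for fixed
  \<open>\<omega> \<noteq> x\<close>, no longer depends on \<epsilon> once
  \<open>\<epsilon> < \<bar>x - \<omega>\<bar>\<close>; so the dominated limit exists.\<close>

lemma pv_limit_exists:
  assumes F: "F \<in> test_functions G"
  shows "\<exists>l. ((\<lambda>\<epsilon>. integral\<^sup>L lborel (\<lambda>y. F y * pv_kernel x \<epsilon> (P y))) \<longlongrightarrow> l) (at_right 0)"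
proof -
  define \<Phi> where "\<Phi> \<epsilon> \<omega> = complex_of_real (- (ln (max ((x - \<omega>)\<^sup>2) (\<epsilon>\<^sup>2)) / 2))" for \<epsilon> \<omega>
  define L where "L \<omega> = complex_of_real (- ln \<bar>x - \<omega>\<bar>)" for \<omega>
  have [simp]: "at (0::real) within {0<..<1} = at_right 0"
    by (rule at_within_nhd[of _ "{-1<..<1}"]) auto
  have big: "ln (max (s\<^sup>2) (\<epsilon>\<^sup>2)) / 2 = ln \<bar>s\<bar>" if "0 < \<epsilon>" "\<epsilon> < \<bar>s\<bar>" for s \<epsilon> :: real
  proof -
    have "\<epsilon>\<^sup>2 \<le> s\<^sup>2" using that by (simp add: abs_le_square_iff[symmetric])
    then have "max (s\<^sup>2) (\<epsilon>\<^sup>2) = s\<^sup>2" by simp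
    with that show ?thesis by (simp add: ln_square)
  qed
  have "((\<lambda>u. integral\<^sup>L lborel (\<lambda>y. divergence F y * \<Phi> u (P y)))
      \<longlongrightarrow> integral\<^sup>L lborel (\<lambda>y. divergence F y * L (P y))) (at 0 within {0<..<1})"
  proof (rule log_dominated_limit[where x = x, OF compactly_bounded_test[OF divergence_test[OF F]]])
    show "norm (\<Phi> \<epsilon> \<omega>) \<le> \<bar>ln \<bar>x - \<omega>\<bar>\<bar> + (x - \<omega>)\<^sup>2 + 2"
      if \<epsilon>: "\<epsilon> \<in> {0<..<1} - {0}" and ne: "\<omega> \<noteq> x" for \<epsilon> \<omega>
    proof -
      have "\<bar>ln (max ((x - \<omega>)\<^sup>2) (\<epsilon>\<^sup>2)) / 2\<bar> \<le> \<bar>ln \<bar>x - \<omega>\<bar>\<bar>"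
      proof (cases "\<epsilon> < \<bar>x - \<omega>\<bar>")
        case True
        then show ?thesis using big[of \<epsilon> "x - \<omega>"] \<epsilon> by simp
      next
        \<comment> \<open>Here
          \<open>ln \<bar>x - \<omega>\<bar> \<le> ln \<epsilon> \<le> 0\<close>, the last step by
          \<open>\<epsilon> < 1\<close>; truncation can only decrease the absolute value of the
          logarithm.\<close>
        case False
        then have "(x - \<omega>)\<^sup>2 \<le> \<epsilon>\<^sup>2" using \<epsilon> by (simp add: abs_le_square_iff[symmetric])
        then have "ln (max ((x - \<omega>)\<^sup>2) (\<epsilon>\<^sup>2)) / 2 = ln \<epsilon>"
          using ln_square[of \<epsilon>] \<epsilon> by (simp add: max_absorb2)
        moreover have "ln \<bar>x - \<omega>\<bar> \<le> ln \<epsilon>"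
          using False \<epsilon> ne by simp
        moreover have "ln \<epsilon> \<le> 0" using \<epsilon> by simp
        ultimately show ?thesis by linarith
      qed
      moreover have "norm (\<Phi> \<epsilon> \<omega>) = \<bar>ln (max ((x - \<omega>)\<^sup>2) (\<epsilon>\<^sup>2)) / 2\<bar>"
        unfolding \<Phi>_def norm_of_real by simp
      moreover have "0 \<le> (x - \<omega>)\<^sup>2" by simp
      ultimately show ?thesis by linarith
    qed
    show "((\<lambda>\<epsilon>. \<Phi> \<epsilon> \<omega>) \<longlongrightarrow> L \<omega>) (at 0 within {0<..<1})" if "\<omega> \<noteq> x" for \<omega>
    proof -
      have "\<forall>\<^sub>F \<epsilon> in at_right 0. \<epsilon> \<in> {0<..<\<bar>x - \<omega>\<bar>}"
        using that by (intro eventually_at_right_real) simp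
      then have "\<forall>\<^sub>F \<epsilon> in at_right 0. L \<omega> = \<Phi> \<epsilon> \<omega>"
        by eventually_elim (simp add: \<Phi>_def L_def big)
      from Lim_transform_eventually[OF tendsto_const this] show ?thesis by simp
    qed
  qed (auto simp: \<Phi>_def[abs_def] L_def[abs_def])
  from tendsto_minus[OF this]
  have "((\<lambda>u. - integral\<^sup>L lborel (\<lambda>y. divergence F y * \<Phi> u (P y)))
      \<longlongrightarrow> - integral\<^sup>L lborel (\<lambda>y. divergence F y * L (P y))) (at_right 0)"
    by simp
  moreover have "\<forall>\<^sub>F \<epsilon> in at_right 0. - integral\<^sup>L lborel (\<lambda>y. divergence F y * \<Phi> \<epsilon> (P y))
      = integral\<^sup>L lborel (\<lambda>y. F y * pv_kernel x \<epsilon> (P y))"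
    unfolding \<Phi>_def using eventually_at_right_less[of "0::real"]
    by eventually_elim (rule pv_integration_by_parts[OF F, symmetric])
  ultimately have "((\<lambda>\<epsilon>. integral\<^sup>L lborel (\<lambda>y. F y * pv_kernel x \<epsilon> (P y)))
      \<longlongrightarrow> - integral\<^sup>L lborel (\<lambda>y. divergence F y * L (P y))) (at_right 0)"
    by (rule Lim_transform_eventually)
  then show ?thesis by blast
qed

end

section \<open>The eigenvalue equations\<close>

lemma cnj_braket: "cnj (braket G f1 f2) = braket G f2 f1"
  unfolding braket_def set_lebesgue_integral_def Bochner_Integration.integral_cnj[symmetric]
  by (simp add: mult.commute)

context smooth_levels
begin

abbreviation test :: "(real^'n \<Rightarrow> complex) set" where
  "test \<equiv> test_functions G"

lemma product_test: "f1 \<in> test \<Longrightarrow> f2 \<in> test \<Longrightarrow> (\<lambda>y. cnj (f1 y) * f2 y) \<in> test"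
  by (rule test_functions_cnj_mult[OF open_G])

lemma times_P_test:
  assumes "F \<in> test"
  shows "(\<lambda>y. of_real (P y) * F y) \<in> test"
  using test_functions_Omega[OF open_G smooth_P assms] by (simp add: Omega_def)

lemma test_zero: "F \<in> test \<Longrightarrow> y \<notin> G \<Longrightarrow> F y = 0"
  using test_functions_support(2) notin_supp by blast

section \<open>The delta form\<close>

lemma level_set_borel [measurable]: "level_set G P x \<in> sets borel"
proof -
  define Q where "Q y = indicator G y *\<^sub>R P y" for y
  have [measurable]: "Q \<in> borel_measurable borel"
    unfolding Q_def by (rule borel_measurable_indicator_G[OF continuous_P])
  have "level_set G P x = {y \<in> space borel. y \<in> G \<and> Q y = x}"
    by (auto simp: level_set_def Q_def)
  also have "\<dots> \<in> sets borel" by measurable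
  finally show ?thesis .
qed

text \<open>The sheets carry the condition \<open>P y = x\<close> and the chart weight the condition
  \<open>y \<in> G\<close>, so the complement has measure 0. Hence functions of P become constants
  under the level integral, which is the eigenvalue equation of
  \<open>\<delta>(x - \<Omega>)\<close>.\<close>

lemma AE_level_set: "AE y in level_measure G P x. y \<in> level_set G P x"
proof -
  have "sheets i P (\<lambda>y. indicator (- level_set G P x) y * chart_weight i y) (glue i w x) = 0" for i w
  proof -
    have "indicator {t. P (glue i w t) = x} t *
      (indicator (- level_set G P x) (glue i w t) * chart_weight i (glue i w t)) = 0" for t
      by (auto simp: level_set_def chart_weight_def chart_def split: split_indicator)
    then show ?thesis by (simp only: sheets_glue) simp
  qed
  then have "(\<integral>\<^sup>+y. indicator (- level_set G P x) y \<partial>level_measure G P x) = 0"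
    by (subst nn_integral_level_measure) (simp_all add: level_sum_def)
  then have "AE y in level_measure G P x. (indicator (- level_set G P x) y :: ennreal) = 0"
    by (subst (asm) nn_integral_0_iff_AE) simp_all
  then show ?thesis
    by eventually_elim (simp split: split_indicator_asm)
qed

lemma delta_form_eq:
  assumes "f1 \<in> test" "f2 \<in> test"
  shows "delta_form G P x f1 f2 = integral\<^sup>L (level_measure G P x) (\<lambda>y. cnj (f1 y) * f2 y)"
  unfolding delta_form_def set_lebesgue_integral_def
proof (rule integral_cong_AE)
  have [measurable]: "(\<lambda>y. cnj (f1 y) * f2 y) \<in> borel_measurable borel"
    by (rule compactly_bounded_measurable[OF compactly_bounded_test[OF product_test[OF assms]]])
  show "(\<lambda>y. cnj (f1 y) * f2 y) \<in> borel_measurable (level_measure G P x)"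
    by measurable
  show "(\<lambda>y. indicat_real (level_set G P x) y *\<^sub>R (cnj (f1 y) * f2 y)) \<in> borel_measurable (level_measure G P x)"
    by measurable
  show "AE y in level_measure G P x. indicat_real (level_set G P x) y *\<^sub>R (cnj (f1 y) * f2 y) = cnj (f1 y) * f2 y"
    using AE_level_set by eventually_elim simp
qed

lemma level_integral_times_P:
  fixes q :: "real \<Rightarrow> complex"
  assumes F: "F \<in> test" and q: "compactly_bounded (\<lambda>y. F y * q (P y))"
  shows "integral\<^sup>L (level_measure G P x) (\<lambda>y. F y * q (P y)) = integral\<^sup>L (level_measure G P x) F * q x"
proof -
  have [measurable]: "F \<in> borel_measurable borel" "(\<lambda>y. F y * q (P y)) \<in> borel_measurable borel"
    using compactly_bounded_measurable[OF compactly_bounded_test[OF F]] compactly_bounded_measurable[OF q]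
    by auto
  have "integral\<^sup>L (level_measure G P x) (\<lambda>y. F y * q (P y)) = integral\<^sup>L (level_measure G P x) (\<lambda>y. F y * q x)"
  proof (rule integral_cong_AE)
    show "(\<lambda>y. F y * q (P y)) \<in> borel_measurable (level_measure G P x)" by measurable
    show "(\<lambda>y. F y * q x) \<in> borel_measurable (level_measure G P x)" by measurable
    show "AE y in level_measure G P x. F y * q (P y) = F y * q x"
      using AE_level_set by eventually_elim (simp add: level_set_def)
  qed
  then show ?thesis by simp
qed

lemma level_integral_combination:
  assumes F: "F \<in> test" and F': "F' \<in> test"
  shows "integral\<^sup>L (level_measure G P x) (\<lambda>y. of_real (P y) * F y + b * F' y)
    = of_real x * integral\<^sup>L (level_measure G P x) F + b * integral\<^sup>L (level_measure G P x) F'"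
proof -
  have c: "compactly_bounded (\<lambda>y. F y * complex_of_real (P y))"
    using compactly_bounded_test[OF times_P_test[OF F]] by (simp add: mult.commute)
  have "integral\<^sup>L (level_measure G P x) (\<lambda>y. F y * complex_of_real (P y) + b * F' y)
    = integral\<^sup>L (level_measure G P x) (\<lambda>y. F y * complex_of_real (P y))
      + integral\<^sup>L (level_measure G P x) (\<lambda>y. b * F' y)"
    by (intro Bochner_Integration.integral_add integrable_mult_right
        integrable_compactly_bounded(2) c compactly_bounded_test[OF F'])
  then show ?thesis
    by (simp add: level_integral_times_P[OF F c] mult.commute)
qed

lemma braket_eq:
  assumes "f1 \<in> test"
  shows "braket G f1 f2 = integral\<^sup>L lborel (\<lambda>y. cnj (f1 y) * f2 y)"
  unfolding braket_def set_lebesgue_integral_def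
  using test_zero[OF assms] by (intro Bochner_Integration.integral_cong) (auto split: split_indicator)

text \<open>All forms depend on their two arguments only through the product
  \<open>cnj f1 * f2\<close>. The operator on the right and its adjoint on the left change this
  product in the same way: it is multiplied by the real function P, and a multiple of another
  product is added. The lemmas on such combinations therefore serve both sides.\<close>

lemma cnj_perturbed_mult:
  "cnj (perturbed G P h g f1 y) * f2 y
    = of_real (P y) * (cnj (f1 y) * f2 y) + braket G f1 g * (cnj (h y) * f2 y)"
  unfolding perturbed_def Omega_def cnj_braket[of G g f1, symmetric]
  by (simp add: cnj_braket algebra_simps)

lemma mult_perturbed:
  "cnj (f1 y) * perturbed G P g h f2 y
    = of_real (P y) * (cnj (f1 y) * f2 y) + braket G h f2 * (cnj (f1 y) * g y)"
  by (simp add: perturbed_def Omega_def algebra_simps)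

lemma perturbed_test: "f \<in> test \<Longrightarrow> g \<in> test \<Longrightarrow> perturbed G P g h f \<in> test"
  by (rule perturbed_in_test_functions[OF open_G smooth_P])

lemma delta_form_perturbed:
  assumes "f1 \<in> test" "f2 \<in> test" "g \<in> test" "h \<in> test"
  shows "delta_form G P x f1 (perturbed G P g h f2)
      = of_real x * delta_form G P x f1 f2 + braket G h f2 * delta_form G P x f1 g"
    and "delta_form G P x (perturbed G P h g f1) f2
      = of_real x * delta_form G P x f1 f2 + braket G f1 g * delta_form G P x h f2"
  using assms
  by (simp_all only: delta_form_eq perturbed_test cnj_perturbed_mult mult_perturbed
      level_integral_combination product_test)

section \<open>The principal value form\<close>

lemma pv_form_tendsto:
  assumes f: "f1 \<in> test" "f2 \<in> test"
  shows "((\<lambda>\<epsilon>. integral\<^sup>L lborel (\<lambda>y. cnj (f1 y) * f2 y * pv_kernel x \<epsilon> (P y)))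
    \<longlongrightarrow> pv_form G P x f1 f2) (at_right 0)"
proof -
  let ?F = "\<lambda>y. cnj (f1 y) * f2 y"
  have F: "?F \<in> test" by (rule product_test[OF f])
  obtain l where l: "((\<lambda>\<epsilon>. integral\<^sup>L lborel (\<lambda>y. ?F y * pv_kernel x \<epsilon> (P y))) \<longlongrightarrow> l) (at_right 0)"
    using pv_limit_exists[OF F] by blast
  \<comment> \<open>The truncated kernel is constant on every level set, so it can be drawn out of
    the level integral; the coarea formula then converts the integral over \<omega> into a volume
    integral, whose limit is known to exist.\<close>
  have eq: "integral\<^sup>L lborel (\<lambda>y. ?F y * pv_kernel x \<epsilon> (P y))
    = (LINT \<omega>:{\<omega>. \<epsilon> < \<bar>x - \<omega>\<bar>}|lebesgue. delta_form G P \<omega> f1 f2 / of_real (x - \<omega>))" if "\<epsilon> > 0" for \<epsilon>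
  proof -
    have cb: "compactly_bounded (\<lambda>y. ?F y * pv_kernel x \<epsilon> (P y))"
      by (rule compactly_bounded_pv_kernel[OF compactly_bounded_test[OF F] that])
    have "has_bochner_integral lborel (\<lambda>\<omega>. integral\<^sup>L (level_measure G P \<omega>) ?F * pv_kernel x \<epsilon> \<omega>)
      (integral\<^sup>L lborel (\<lambda>y. ?F y * pv_kernel x \<epsilon> (P y)))"
      using coarea[OF cb] by (simp only: level_integral_times_P[OF F cb])
    also have "(\<lambda>\<omega>. integral\<^sup>L (level_measure G P \<omega>) ?F * pv_kernel x \<epsilon> \<omega>)
      = (\<lambda>\<omega>. indicat_real {\<omega>. \<epsilon> < \<bar>x - \<omega>\<bar>} \<omega> *\<^sub>R (delta_form G P \<omega> f1 f2 / of_real (x - \<omega>)))"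
      by (auto simp: fun_eq_iff delta_form_eq[OF f] pv_kernel_def split: split_indicator)
    finally have hb: "has_bochner_integral lborel
      (\<lambda>\<omega>. indicat_real {\<omega>. \<epsilon> < \<bar>x - \<omega>\<bar>} \<omega> *\<^sub>R (delta_form G P \<omega> f1 f2 / of_real (x - \<omega>)))
      (integral\<^sup>L lborel (\<lambda>y. ?F y * pv_kernel x \<epsilon> (P y)))" .
    \<comment> \<open>\<open>principal_value\<close> integrates with respect to
      \<open>lebesgue\<close>, the completion of \<open>lborel\<close>; for a Borel measurable
      integrand the two integrals agree.\<close>
    show ?thesis
      unfolding set_lebesgue_integral_def
      using has_bochner_integral_integral_eq[OF hb]
        integral_completion[OF borel_measurable_has_bochner_integral[OF hb]] by simp
  qed
  have "\<forall>\<^sub>F \<epsilon> in at_right 0. integral\<^sup>L lborel (\<lambda>y. ?F y * pv_kernel x \<epsilon> (P y))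
    = (LINT \<omega>:{\<omega>. \<epsilon> < \<bar>x - \<omega>\<bar>}|lebesgue. delta_form G P \<omega> f1 f2 / of_real (x - \<omega>))"
    using eventually_at_right_less[of "0::real"] by eventually_elim (rule eq)
  from tendsto_Lim[OF trivial_limit_at_right_real Lim_transform_eventually[OF l this]]
  have "pv_form G P x f1 f2 = l"
    unfolding pv_form_def principal_value_def .
  with l show ?thesis by simp
qed

text \<open>The source of the term \<open>- braket G f1 f2\<close>: in the truncated form of
  \<open>(P - x) / (x - P) = - 1\<close> the constant 1 becomes an indicator, which tends to 1 off a
  null set.\<close>

lemma truncation_tendsto:
  assumes F: "F \<in> test"
  shows "((\<lambda>\<epsilon>. integral\<^sup>L lborel (\<lambda>y. F y * indicator {\<omega>. \<epsilon> < \<bar>x - \<omega>\<bar>} (P y)))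
    \<longlongrightarrow> integral\<^sup>L lborel F) (at_right 0)"
proof (rule tendsto_integral_at_within)
  show "integrable lborel (\<lambda>y. norm (F y))"
    by (intro integrable_norm integrable_compactly_bounded(1) compactly_bounded_test F)
  show "(\<lambda>y. F y * indicator {\<omega>. u < \<bar>x - \<omega>\<bar>} (P y)) \<in> borel_measurable lborel" for u
    using borel_measurable_times_P[OF compactly_bounded_test[OF F], of "indicator {\<omega>. u < \<bar>x - \<omega>\<bar>}"]
    by simp
  show "F \<in> borel_measurable lborel"
    using compactly_bounded_measurable[OF compactly_bounded_test[OF F]] by simp
  show "AE y in lborel. norm (F y * indicator {\<omega>. u < \<bar>x - \<omega>\<bar>} (P y)) \<le> norm (F y)" for u
    by (intro AE_I2) (simp split: split_indicator)
  show "AE y in lborel. ((\<lambda>\<epsilon>. F y * indicator {\<omega>. \<epsilon> < \<bar>x - \<omega>\<bar>} (P y)) \<longlongrightarrow> F y) (at_right 0)"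
    using AE_level_null[OF compactly_bounded_test[OF F], of x]
  proof eventually_elim
    case (elim y)
    show ?case
    proof (cases "F y = 0")
      case False
      with elim have "\<bar>x - P y\<bar> > 0" by simp
      then have "\<forall>\<^sub>F \<epsilon> in at_right 0. \<epsilon> \<in> {0<..<\<bar>x - P y\<bar>}"
        by (rule eventually_at_right_real)
      then have "\<forall>\<^sub>F \<epsilon> in at_right 0. F y = F y * indicator {\<omega>. \<epsilon> < \<bar>x - \<omega>\<bar>} (P y)"
        by eventually_elim simp
      from Lim_transform_eventually[OF tendsto_const this] show ?thesis .
    qed simp
  qed
qed

lemma pv_form_combination:
  assumes f: "f1 \<in> test" "f2 \<in> test" and f': "f1' \<in> test" "f2' \<in> test" and f'': "f1'' \<in> test" "f2'' \<in> test"
    and eq: "\<And>y. cnj (f1'' y) * f2'' y = of_real (P y) * (cnj (f1 y) * f2 y) + b * (cnj (f1' y) * f2' y)"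
  shows "pv_form G P x f1'' f2'' = of_real x * pv_form G P x f1 f2 - braket G f1 f2 + b * pv_form G P x f1' f2'"
proof -
  let ?F = "\<lambda>y. cnj (f1 y) * f2 y" and ?F' = "\<lambda>y. cnj (f1' y) * f2' y" and ?F'' = "\<lambda>y. cnj (f1'' y) * f2'' y"
  have F: "?F \<in> test" and F': "?F' \<in> test"
    by (rule product_test[OF f], rule product_test[OF f'])
  \<comment> \<open>Outside the excluded interval this is
    \<open>\<omega> / (x - \<omega>) = x / (x - \<omega>) - 1\<close>; inside it both sides are
    0.\<close>
  have kern: "of_real \<omega> * pv_kernel x \<epsilon> \<omega> = of_real x * pv_kernel x \<epsilon> \<omega> - indicator {\<omega>. \<epsilon> < \<bar>x - \<omega>\<bar>} \<omega>"
    if "\<epsilon> > 0" for \<epsilon> \<omega>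
  proof (cases "\<epsilon> < \<bar>x - \<omega>\<bar>")
    case True
    with that have "complex_of_real x - complex_of_real \<omega> \<noteq> 0" by auto
    then show ?thesis
      using True by (simp add: pv_kernel_def field_simps)
  qed (simp add: pv_kernel_def)
  have split: "integral\<^sup>L lborel (\<lambda>y. ?F'' y * pv_kernel x \<epsilon> (P y))
    = of_real x * integral\<^sup>L lborel (\<lambda>y. ?F y * pv_kernel x \<epsilon> (P y))
      - integral\<^sup>L lborel (\<lambda>y. ?F y * indicator {\<omega>. \<epsilon> < \<bar>x - \<omega>\<bar>} (P y))
      + b * integral\<^sup>L lborel (\<lambda>y. ?F' y * pv_kernel x \<epsilon> (P y))" if \<epsilon>: "\<epsilon> > 0" for \<epsilon>
  proof -
    have i1: "integrable lborel (\<lambda>y. ?F y * pv_kernel x \<epsilon> (P y))"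
      and i2: "integrable lborel (\<lambda>y. ?F' y * pv_kernel x \<epsilon> (P y))"
      by (intro integrable_compactly_bounded compactly_bounded_pv_kernel compactly_bounded_test F F' \<epsilon>)+
    have i3: "integrable lborel (\<lambda>y. ?F y * indicator {\<omega>. \<epsilon> < \<bar>x - \<omega>\<bar>} (P y))"
      by (intro integrable_compactly_bounded compactly_bounded_times_P compactly_bounded_test F)
        (auto simp: bounded_iff indicator_def intro!: exI[of _ 1])
    have pt: "?F'' y * pv_kernel x \<epsilon> (P y) = of_real x * (?F y * pv_kernel x \<epsilon> (P y))
      - ?F y * indicator {\<omega>. \<epsilon> < \<bar>x - \<omega>\<bar>} (P y) + b * (?F' y * pv_kernel x \<epsilon> (P y))" for y
    proof -
      have "?F'' y * pv_kernel x \<epsilon> (P y) = ?F y * (of_real (P y) * pv_kernel x \<epsilon> (P y))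
        + b * (?F' y * pv_kernel x \<epsilon> (P y))"
        unfolding eq by (simp add: algebra_simps)
      then show ?thesis unfolding kern[OF \<epsilon>] by (simp add: algebra_simps)
    qed
    show ?thesis
      unfolding pt
      using i1 i2 i3 by (simp add: Bochner_Integration.integral_add Bochner_Integration.integral_diff)
  qed
  have "((\<lambda>\<epsilon>. of_real x * integral\<^sup>L lborel (\<lambda>y. ?F y * pv_kernel x \<epsilon> (P y))
      - integral\<^sup>L lborel (\<lambda>y. ?F y * indicator {\<omega>. \<epsilon> < \<bar>x - \<omega>\<bar>} (P y))
      + b * integral\<^sup>L lborel (\<lambda>y. ?F' y * pv_kernel x \<epsilon> (P y)))
    \<longlongrightarrow> of_real x * pv_form G P x f1 f2 - integral\<^sup>L lborel ?F + b * pv_form G P x f1' f2') (at_right 0)"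
    by (intro tendsto_intros pv_form_tendsto f f' truncation_tendsto F)
  moreover have "\<forall>\<^sub>F \<epsilon> in at_right 0. of_real x * integral\<^sup>L lborel (\<lambda>y. ?F y * pv_kernel x \<epsilon> (P y))
      - integral\<^sup>L lborel (\<lambda>y. ?F y * indicator {\<omega>. \<epsilon> < \<bar>x - \<omega>\<bar>} (P y))
      + b * integral\<^sup>L lborel (\<lambda>y. ?F' y * pv_kernel x \<epsilon> (P y))
    = integral\<^sup>L lborel (\<lambda>y. ?F'' y * pv_kernel x \<epsilon> (P y))"
    using eventually_at_right_less[of "0::real"] by eventually_elim (rule split[symmetric])
  ultimately have "((\<lambda>\<epsilon>. integral\<^sup>L lborel (\<lambda>y. ?F'' y * pv_kernel x \<epsilon> (P y)))
    \<longlongrightarrow> of_real x * pv_form G P x f1 f2 - integral\<^sup>L lborel ?F + b * pv_form G P x f1' f2') (at_right 0)"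
    by (rule Lim_transform_eventually)
  from tendsto_unique[OF trivial_limit_at_right_real pv_form_tendsto[OF f''] this]
  show ?thesis by (simp add: braket_eq[OF f(1)])
qed

lemma pv_form_perturbed:
  assumes "f1 \<in> test" "f2 \<in> test" "g \<in> test" "h \<in> test"
  shows "pv_form G P x f1 (perturbed G P g h f2)
      = of_real x * pv_form G P x f1 f2 - braket G f1 f2 + braket G h f2 * pv_form G P x f1 g"
    and "pv_form G P x (perturbed G P h g f1) f2
      = of_real x * pv_form G P x f1 f2 - braket G f1 f2 + braket G f1 g * pv_form G P x h f2"
proof -
  show "pv_form G P x f1 (perturbed G P g h f2)
      = of_real x * pv_form G P x f1 f2 - braket G f1 f2 + braket G h f2 * pv_form G P x f1 g"
    by (rule pv_form_combination[OF assms(1,2) assms(1,3) assms(1) perturbed_test[OF assms(2,3)]]) (rule mult_perturbed)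
  show "pv_form G P x (perturbed G P h g f1) f2
      = of_real x * pv_form G P x f1 f2 - braket G f1 f2 + braket G f1 g * pv_form G P x h f2"
    by (rule pv_form_combination[OF assms(1,2) assms(4,2) perturbed_test[OF assms(1,4)] assms(2)]) (rule cnj_perturbed_mult)
qed

section \<open>The perturbed resolvent and its boundary values\<close>

definition resolvent_form :: "complex \<Rightarrow> (real^'n \<Rightarrow> complex) \<Rightarrow> (real^'n \<Rightarrow> complex) \<Rightarrow> complex" where
  "resolvent_form z f1 f2 = braket G f1 (resolvent_Omega P z f2)"

lemma resolvent_form_eq:
  assumes "f1 \<in> test"
  shows "resolvent_form z f1 f2 = integral\<^sup>L lborel (\<lambda>y. cnj (f1 y) * f2 y * (1 / (z - of_real (P y))))"
  by (simp add: resolvent_form_def braket_eq[OF assms] resolvent_Omega_def)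

lemma resolvent_integrable:
  assumes "F \<in> test" "Im z \<noteq> 0"
  shows "integrable lborel (\<lambda>y. F y * (1 / (z - of_real (P y))))"
proof -
  have "z - of_real \<omega> \<noteq> 0" for \<omega>
    using assms(2) by (auto simp: complex_eq_iff)
  then have "continuous_on UNIV (\<lambda>\<omega>. 1 / (z - complex_of_real \<omega>))"
    by (intro continuous_intros) auto
  from integrable_compactly_bounded(1)[OF compactly_bounded_continuous[OF assms(1) this]] show ?thesis .
qed

lemma resolvent_form_combination:
  assumes f: "f1 \<in> test" "f2 \<in> test" and f': "f1' \<in> test" "f2' \<in> test" and f'': "f1'' \<in> test"
    and z: "Im z \<noteq> 0"
    and eq: "\<And>y. cnj (f1'' y) * f2'' y = of_real (P y) * (cnj (f1 y) * f2 y) + b * (cnj (f1' y) * f2' y)"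
  shows "resolvent_form z f1'' f2'' = z * resolvent_form z f1 f2 - braket G f1 f2 + b * resolvent_form z f1' f2'"
proof -
  let ?F = "\<lambda>y. cnj (f1 y) * f2 y" and ?F' = "\<lambda>y. cnj (f1' y) * f2' y" and ?F'' = "\<lambda>y. cnj (f1'' y) * f2'' y"
  let ?r = "\<lambda>y. 1 / (z - of_real (P y))"
  have nz: "z - of_real \<omega> \<noteq> 0" for \<omega>
    using z by (auto simp: complex_eq_iff)
  have i: "integrable lborel (\<lambda>y. ?F y * ?r y)" "integrable lborel (\<lambda>y. ?F' y * ?r y)"
    by (intro resolvent_integrable product_test f f' z)+
  have i3: "integrable lborel ?F"
    by (intro integrable_compactly_bounded compactly_bounded_test product_test f)
  have pt: "?F'' y * ?r y = z * (?F y * ?r y) - ?F y + b * (?F' y * ?r y)" for y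
  proof -
    have "(z - of_real (P y)) * ?r y = 1"
      using nz[of "P y"] by simp
    moreover have "(p * a + b * c) * r = z * (a * r) - a + b * (c * r)" if "(z - p) * r = 1"
      for p r a c :: complex
      using that by algebra
    ultimately show ?thesis unfolding eq by blast
  qed
  have "integral\<^sup>L lborel (\<lambda>y. ?F'' y * ?r y) = z * integral\<^sup>L lborel (\<lambda>y. ?F y * ?r y)
    - integral\<^sup>L lborel ?F + b * integral\<^sup>L lborel (\<lambda>y. ?F' y * ?r y)"
    unfolding pt
    by (subst Bochner_Integration.integral_add, (intro Bochner_Integration.integrable_diff integrable_mult_right i i3)+,
        subst Bochner_Integration.integral_diff, (intro integrable_mult_right i i3)+)
      (simp only: integral_mult_right_zero)
  then show ?thesis
    by (simp only: resolvent_form_eq[OF f''] resolvent_form_eq[OF f(1)] resolvent_form_eq[OF f'(1)]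
        braket_eq[OF f(1)])
qed

lemma braket_resolvent:
  assumes f1: "f1 \<in> test" and f2: "f2 \<in> test" and g: "g \<in> test" and z: "Im z \<noteq> 0"
  shows "braket G f1 (resolvent G P g h z f2)
    = resolvent_form z f1 f2 + resolvent_form z h f2 / C_fun G P g h z * resolvent_form z f1 g"
proof -
  define c where "c = resolvent_form z h f2 / C_fun G P g h z"
  have "cnj (f1 y) * resolvent G P g h z f2 y
    = cnj (f1 y) * f2 y * (1 / (z - of_real (P y))) + c * (cnj (f1 y) * g y * (1 / (z - of_real (P y))))" for y
    by (simp add: resolvent_def resolvent_Omega_def c_def resolvent_form_def algebra_simps)
  then have "braket G f1 (resolvent G P g h z f2)
    = integral\<^sup>L lborel (\<lambda>y. cnj (f1 y) * f2 y * (1 / (z - of_real (P y))) + c * (cnj (f1 y) * g y * (1 / (z - of_real (P y)))))"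
    by (simp only: braket_eq[OF f1])
  also have "\<dots> = resolvent_form z f1 f2 + c * resolvent_form z f1 g"
    unfolding resolvent_form_eq[OF f1]
    by (subst Bochner_Integration.integral_add, (intro integrable_mult_right resolvent_integrable product_test f1 f2 g z)+) (simp only: integral_mult_right_zero)
  finally show ?thesis by (simp add: c_def)
qed

text \<open>The operator on the right adds \<open>\<langle>h|f\<^sub>2\<rangle>
  \<langle>f\<^sub>1|R\<^sub>\<Omega>|g\<rangle>\<close> to the unperturbed term. In the rank one
  correction the factor \<open>\<langle>h|R\<^sub>\<Omega>|f\<^sub>2\<rangle>\<close> acquires
  \<open>- \<langle>h|f\<^sub>2\<rangle> (1 - \<langle>h|R\<^sub>\<Omega>|g\<rangle>) = -
  \<langle>h|f\<^sub>2\<rangle> C(z)\<close>, and division by \<open>C(z)\<close> makes the two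
  cancel. The adjoint on the left is symmetric.\<close>

lemma resolvent_perturbed:
  assumes f: "f1 \<in> test" "f2 \<in> test" "g \<in> test" "h \<in> test" and z: "Im z \<noteq> 0"
    and C: "C_fun G P g h z \<noteq> 0"
  shows "braket G f1 (resolvent G P g h z (perturbed G P g h f2))
      = z * braket G f1 (resolvent G P g h z f2) - braket G f1 f2"
    and "braket G (perturbed G P h g f1) (resolvent G P g h z f2)
      = z * braket G f1 (resolvent G P g h z f2) - braket G f1 f2"
proof -
  let ?E = "resolvent_form z"
  have Cdef: "?E h g = 1 - C_fun G P g h z"
    by (simp add: C_fun_def resolvent_form_def)
  have right: "?E k (perturbed G P g h f2) = z * ?E k f2 - braket G k f2 + braket G h f2 * ?E k g"
    if "k \<in> test" for k
    by (rule resolvent_form_combination[OF that f(2) that f(3) that z]) (rule mult_perturbed)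
  have left: "?E (perturbed G P h g f1) k = z * ?E f1 k - braket G f1 k + braket G f1 g * ?E h k"
    if "k \<in> test" for k
    by (rule resolvent_form_combination[OF f(1) that f(4) that perturbed_test[OF f(1,4)] z]) (rule cnj_perturbed_mult)
  show "braket G f1 (resolvent G P g h z (perturbed G P g h f2))
      = z * braket G f1 (resolvent G P g h z f2) - braket G f1 f2"
    using C by (simp add: braket_resolvent f z perturbed_test right Cdef field_simps)
  show "braket G (perturbed G P h g f1) (resolvent G P g h z f2)
      = z * braket G f1 (resolvent G P g h z f2) - braket G f1 f2"
    using C by (simp add: braket_resolvent f z perturbed_test left Cdef field_simps)
qed

lemma resolvent_form_tendsto:
  assumes "f1 \<in> test" "f2 \<in> test"
  shows "\<exists>l. ((\<lambda>u. resolvent_form (Complex x u) f1 f2) \<longlongrightarrow> l) (at_right 0)"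
    and "\<exists>l. ((\<lambda>u. resolvent_form (Complex x u) f1 f2) \<longlongrightarrow> l) (at_left 0)"
  unfolding resolvent_form_eq[OF assms(1)]
  by (rule resolvent_limit_right[OF product_test[OF assms]], rule resolvent_limit_left[OF product_test[OF assms]])

text \<open>Carries the identity at \<open>z = x + iu\<close> to the boundary, for both sides of the
  axis at once. The limits of the unperturbed forms exist, and the nonzero limit of C controls the
  quotient; only then is \<open>Lim\<close> the actual boundary value.\<close>

lemma Lim_resolvent_perturbed:
  assumes f: "f1 \<in> test" "f2 \<in> test" "g \<in> test" "h \<in> test"
    and S: "S = at_right (0::real) \<or> S = at_left 0"
    and C: "((\<lambda>u. C_fun G P g h (Complex x u)) \<longlongrightarrow> c) S" "c \<noteq> 0"
  defines "R \<equiv> \<lambda>f1 f2. Lim S (\<lambda>u. braket G f1 (resolvent G P g h (Complex x u) f2))"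
  shows "R f1 (perturbed G P g h f2) = of_real x * R f1 f2 - braket G f1 f2"
    and "R (perturbed G P h g f1) f2 = of_real x * R f1 f2 - braket G f1 f2"
proof -
  have nontriv: "S \<noteq> bot"
    using S trivial_limit_at_right_real trivial_limit_at_left_real by metis
  have u: "\<forall>\<^sub>F u in S. u \<noteq> 0"
    using S by (auto simp: eventually_at_filter)
  have Cne: "\<forall>\<^sub>F u in S. C_fun G P g h (Complex x u) \<noteq> 0"
    by (rule tendsto_imp_eventually_ne[OF C])
  have ex: "\<exists>l. ((\<lambda>u. resolvent_form (Complex x u) k1 k2) \<longlongrightarrow> l) S" if "k1 \<in> test" "k2 \<in> test" for k1 k2
    using S resolvent_form_tendsto[OF that, of x] by metis
  obtain a b d where lims: "((\<lambda>u. resolvent_form (Complex x u) f1 f2) \<longlongrightarrow> a) S"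
    "((\<lambda>u. resolvent_form (Complex x u) h f2) \<longlongrightarrow> b) S"
    "((\<lambda>u. resolvent_form (Complex x u) f1 g) \<longlongrightarrow> d) S"
    using ex f by metis
  define r where "r = a + b / c * d"
  have "((\<lambda>u. resolvent_form (Complex x u) f1 f2
      + resolvent_form (Complex x u) h f2 / C_fun G P g h (Complex x u) * resolvent_form (Complex x u) f1 g) \<longlongrightarrow> r) S"
    unfolding r_def by (intro tendsto_intros lims C)
  moreover have "\<forall>\<^sub>F u in S. resolvent_form (Complex x u) f1 f2
      + resolvent_form (Complex x u) h f2 / C_fun G P g h (Complex x u) * resolvent_form (Complex x u) f1 g
      = braket G f1 (resolvent G P g h (Complex x u) f2)"
    using u by eventually_elim (rule braket_resolvent[OF f(1-3), symmetric], simp)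
  ultimately have r: "((\<lambda>u. braket G f1 (resolvent G P g h (Complex x u) f2)) \<longlongrightarrow> r) S"
    by (rule Lim_transform_eventually)
  have "((\<lambda>u. u) \<longlongrightarrow> 0) S"
    using S by (auto intro: tendsto_ident_at)
  then have zx: "((\<lambda>u. Complex x u) \<longlongrightarrow> Complex x 0) S"
    by (intro tendsto_Complex tendsto_const)
  have "((\<lambda>u. Complex x u * braket G f1 (resolvent G P g h (Complex x u) f2) - braket G f1 f2)
      \<longlongrightarrow> Complex x 0 * r - braket G f1 f2) S"
    by (intro tendsto_diff tendsto_mult tendsto_const zx r)
  then have lim: "((\<lambda>u. Complex x u * braket G f1 (resolvent G P g h (Complex x u) f2) - braket G f1 f2)
      \<longlongrightarrow> of_real x * r - braket G f1 f2) S"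
    by (simp add: complex_of_real_def)
  have Rr: "R f1 f2 = r"
    unfolding R_def by (rule tendsto_Lim[OF nontriv r])
  have "\<forall>\<^sub>F u in S. Complex x u * braket G f1 (resolvent G P g h (Complex x u) f2) - braket G f1 f2
      = braket G f1 (resolvent G P g h (Complex x u) (perturbed G P g h f2))"
    using u Cne by eventually_elim (rule resolvent_perturbed(1)[OF f, symmetric], simp_all)
  from tendsto_Lim[OF nontriv Lim_transform_eventually[OF lim this]]
  show "R f1 (perturbed G P g h f2) = of_real x * R f1 f2 - braket G f1 f2"
    unfolding Rr unfolding R_def .
  have "\<forall>\<^sub>F u in S. Complex x u * braket G f1 (resolvent G P g h (Complex x u) f2) - braket G f1 f2
      = braket G (perturbed G P h g f1) (resolvent G P g h (Complex x u) f2)"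
    using u Cne by eventually_elim (rule resolvent_perturbed(2)[OF f, symmetric], simp_all)
  from tendsto_Lim[OF nontriv Lim_transform_eventually[OF lim this]]
  show "R (perturbed G P h g f1) f2 = of_real x * R f1 f2 - braket G f1 f2"
    unfolding Rr unfolding R_def .
qed

section \<open>The equations for \<kappa>, p, \<alpha> and \<alpha>'\<close>

lemma kappa_perturbed:
  assumes f: "f1 \<in> test" "f2 \<in> test" "g \<in> test" "h \<in> test"
    and Cr: "((\<lambda>u. C_fun G P g h (Complex x u)) \<longlongrightarrow> c) (at_right 0)" "c \<noteq> 0"
    and Cl: "((\<lambda>u. C_fun G P g h (Complex x u)) \<longlongrightarrow> c') (at_left 0)" "c' \<noteq> 0"
  shows "kappa G P g h x f1 (perturbed G P g h f2) = of_real x * kappa G P g h x f1 f2"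
    and "kappa G P g h x (perturbed G P h g f1) f2 = of_real x * kappa G P g h x f1 f2"
  unfolding kappa_def Lim_resolvent_perturbed[OF f disjI1[OF refl] Cr]
    Lim_resolvent_perturbed[OF f disjI2[OF refl] Cl]
  by (simp_all add: algebra_simps)

text \<open>The extra term \<open>\<langle>h|f\<^sub>2\<rangle>
  \<langle>f\<^sub>1|\<delta>|g\<rangle>\<close> of the first summand reappears in the subtracted
  one: there the second factor acquires
  \<open>\<langle>h|f\<^sub>2\<rangle> \<langle>h|\<delta>|g\<rangle>\<close>, whose last factor is
  the denominator. The adjoint on the left is analogous.\<close>

lemma p_form_perturbed:
  assumes f: "f1 \<in> test" "f2 \<in> test" "g \<in> test" "h \<in> test" and C2: "C2 G P g h x \<noteq> 0"
  shows "p_form G P g h x f1 (perturbed G P g h f2) = of_real x * p_form G P g h x f1 f2"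
    and "p_form G P g h x (perturbed G P h g f1) f2 = of_real x * p_form G P g h x f1 f2"
  using C2 f by (simp_all add: p_form_def C2_def delta_form_perturbed field_simps)

text \<open>The delta part acquires \<open>\<langle>f|g\<rangle> C2\<close> with coefficient C1. The
  principal value part acquires \<open>- \<langle>f|g\<rangle>\<close> plus
  \<open>\<langle>f|g\<rangle>\<close> times the form of h and g, that is
  \<open>- \<langle>f|g\<rangle> C1\<close>, with coefficient C2. The coefficients are balanced so
  that the two cancel.\<close>

lemma alpha_ket_perturbed:
  assumes "f \<in> test" "g \<in> test" "h \<in> test"
  shows "alpha_ket G P g h c x (perturbed G P h g f) = of_real x * alpha_ket G P g h c x f"
  using assms
  by (simp add: alpha_ket_def C1_def C2_def delta_form_perturbed(2) pv_form_perturbed(2) algebra_simps)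

lemma alpha_bra_perturbed:
  assumes "f \<in> test" "g \<in> test" "h \<in> test"
  shows "alpha_bra G P g h c x (perturbed G P g h f) = of_real x * alpha_bra G P g h c x f"
  using assms
  by (simp add: alpha_bra_def C1_def C2_def delta_form_perturbed(1) pv_form_perturbed(1) algebra_simps)

end

theorem proposition7:
  fixes G K :: "(real^'n::finite) set"
    and P :: "real^'n \<Rightarrow> real"
    and g h :: "real^'n \<Rightarrow> complex"
    and G1 I :: "real set"
    and N :: "real \<Rightarrow> complex"
  assumes "open G" and "bounded G"
    and "smooth_on_open G P"
    and "\<And>js. bounded (iterated_partial js P ` G)"
    and "\<And>y. y \<in> G \<Longrightarrow> gradient P y \<noteq> 0"
    and "g \<in> test_functions G" and "\<And>y. g y \<in> \<real>"
    and "h \<in> test_functions G" and "\<And>y. h y \<in> \<real>"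
    and "compact K" and "K \<subseteq> G" and "supp g \<subseteq> K" and "supp h \<subseteq> K"
    and "open G1" and "P ` K \<subseteq> G1"
    and "open I" and "is_interval I" and "0 \<in> I"
    and "C_fun G P g h holomorphic_on {Complex x u | x u. x \<in> G1 \<and> u \<in> I} - complex_of_real ` P ` K"
    and "\<And>z. z \<in> {Complex x u | x u. x \<in> G1 \<and> u \<in> I} - complex_of_real ` P ` K
           \<Longrightarrow> C_fun G P g h z \<noteq> 0"
    and "\<And>x. x \<in> G1 \<Longrightarrow>
           ((\<lambda>u. C_fun G P g h (Complex x u)) \<longlongrightarrow> C1 G P g h x + \<i> * pi * C2 G P g h x) (at_right 0)"
    and "\<And>x. x \<in> G1 \<Longrightarrow>
           ((\<lambda>u. C_fun G P g h (Complex x u)) \<longlongrightarrow> C1 G P g h x - \<i> * pi * C2 G P g h x) (at_left 0)"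
    and "\<And>x. x \<in> G1 \<Longrightarrow> C1 G P g h x + \<i> * pi * C2 G P g h x \<noteq> 0"
    and "\<And>x. x \<in> G1 \<Longrightarrow> C1 G P g h x - \<i> * pi * C2 G P g h x \<noteq> 0"
    and "\<And>x f. x \<in> G1 \<Longrightarrow> C2 G P g h x = 0 \<Longrightarrow> f \<in> test_functions G \<Longrightarrow>
           delta_form G P x f g = 0 \<and> delta_form G P x h f = 0"
    and "\<And>x. x \<in> G1 \<Longrightarrow> C2 G P g h x \<noteq> 0 \<Longrightarrow>
           (N x)\<^sup>2 = 1 / (((C1 G P g h x)\<^sup>2 + pi\<^sup>2 * (C2 G P g h x)\<^sup>2) * C2 G P g h x)"
  shows "(\<forall>f\<in>test_functions G. perturbed G P g h f \<in> test_functions G) \<and>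
    (\<forall>x\<in>P ` K.
      (\<forall>f1\<in>test_functions G. \<forall>f2\<in>test_functions G.
        kappa G P g h x (perturbed G P h g f1) f2 = x * kappa G P g h x f1 f2 \<and>
        kappa G P g h x f1 (perturbed G P g h f2) = x * kappa G P g h x f1 f2) \<and>
      (C2 G P g h x \<noteq> 0 \<longrightarrow>
        (\<forall>f1\<in>test_functions G. \<forall>f2\<in>test_functions G.
          p_form G P g h x (perturbed G P h g f1) f2 = x * p_form G P g h x f1 f2 \<and>
          p_form G P g h x f1 (perturbed G P g h f2) = x * p_form G P g h x f1 f2) \<and>
        (\<forall>f\<in>test_functions G.
          alpha_ket G P g h (N x) x (perturbed G P h g f) = x * alpha_ket G P g h (N x) x f \<and>
          alpha_bra G P g h (N x) x (perturbed G P g h f) = x * alpha_bra G P g h (N x) x f)))"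
proof -
  interpret smooth_levels G P
    using assms(1,3,5) by unfold_locales
  note g = \<open>g \<in> test_functions G\<close> and h = \<open>h \<in> test_functions G\<close>
  have G1: "x \<in> G1" if "x \<in> P ` K" for x
    using that \<open>P ` K \<subseteq> G1\<close> by blast
  have "kappa G P g h x (perturbed G P h g f1) f2 = x * kappa G P g h x f1 f2 \<and>
      kappa G P g h x f1 (perturbed G P g h f2) = x * kappa G P g h x f1 f2"
    if "x \<in> P ` K" "f1 \<in> test_functions G" "f2 \<in> test_functions G" for x f1 f2
    using kappa_perturbed[OF that(2,3) g h assms(21)[OF G1] assms(23)[OF G1] assms(22)[OF G1] assms(24)[OF G1]]
      that(1) by simp
  then show ?thesis
    using g h by (simp add: perturbed_test p_form_perturbed alpha_ket_perturbed alpha_bra_perturbed)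
qed

end
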